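(* Let $m\ge2$ and let $H(x,y)=\sum_{j=0}^{m+1}h_jx^jy^{m+1-j}$ be a complex $(m+1)$-homogeneous polynomial. Put $H_1(z):=H(1,z)$, $H_2(w):=H(w,1)$, and assume nondegeneracy: $h_0\neq0$ and $h_{m+1}\ne0$; $H_1(e)=0$ implies $H_1'(e)\neq0$; and $H_2(e)=0$ implies $H_2'(e)\ne0$. Consider the Hamiltonian vector field $\dot x=H_y$, $\dot y=-H_x$ in complex time $t$, at the energy level $H=1$, in the projective coordinates $(x,y)$, $(u,z)=(1/x,y/x)$, $(v,w)=(1/y,x/y)$ on $\mathbb{CP}^2$. Then blow-up or blow-down, say at time $t=T=0$, on the closure of any nontrivial leaf $\mathcal{L}\subset\{H=1\}$ only occurs at $(u,z)=(0,e)$, where $z=e$ are simple zeros of the polynomial $H_1(z)=H(1,z)$. Any blow-up or blow-down possesses a local minimal blow-up loop $(\gamma^t,\gamma^{uz})$ based on any small cycle $\gamma^t\subset\mathbb{C}\setminus\{0\}$ of winding number $\mathfrak{w}_t=m-1$, with a real-time blow-up star of $\mathfrak{w}_t$ incoming and $\mathfrak{w}_t$ outgoing branches. The winding numbers of the loop $\gamma^{uz}$ are $\mathfrak{w}_u=1$ (around $u=0$) and $\mathfrak{w}_z=m+1$ (around $z=e$).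
   Context: On the energy level $H=1$, the projective version in $(u,z)$ reads $\frac{du}{dt_1}=-uH_1'(z)$, $\frac{dz}{dt_1}=-(m+1)H_1(z)$, $dt=u^{m-1}dt_1$, on the compactified energy surface $u^{m+1}=H_1(z)$. Leafs are nonstationary solution orbits in complex time. Blow-up (blow-down): solutions on a leaf become unbounded in $(x,y)$, i.e. converge to $u=0$ or $v=0$ in projective coordinates, as $t\to T=0$ in finite original time (in forward, respectively backward, time). Blow-up loop: for a local leaf $\mathcal{L}$ near $(u,z)=(0,e)$, let $\gamma^t:[0,2\pi]\to\mathbb{C}\setminus\{T\}$, $s\mapsto t(s)$, be a closed curve near $T$ with nonzero (without loss of generality positive) winding number $\mathfrak{w}_t$ around $T$, and let $\gamma^{uz}(s)=(u(t(s)),z(t(s)))\in\mathcal{L}$ be the solution continued along it, with components $\gamma^u,\gamma^z$. The pair $(\gamma^t,\gamma^{uz})$ is a blow-up loop if $\gamma^{uz}(2\pi)=\gamma^{uz}(0)$; it is minimal if $\mathfrak{w}_t$ is minimal among all blow-up loops in the local leaf. Real-time blow-up star of a minimal blow-up loop: the collection of all $\mathfrak{w}_t$ blow-up branches (incoming, real $t\nearrow T$) and all $\mathfrak{w}_t$ blow-down branches (outgoing, real $t\searrow T$) of solutions, alternating in the local leaf. *)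

theory Defs
  imports "HOL-Complex_Analysis.Complex_Analysis"
begin

section \<open>The homogeneous Hamiltonian\<close>

definition ham :: "nat \<Rightarrow> (nat \<Rightarrow> complex) \<Rightarrow> complex \<Rightarrow> complex \<Rightarrow> complex" where
  "ham m h x y = (\<Sum>j\<le>m + 1. h j * x ^ j * y ^ (m + 1 - j))"

definition ham1 :: "nat \<Rightarrow> (nat \<Rightarrow> complex) \<Rightarrow> complex \<Rightarrow> complex" where
  "ham1 m h z = ham m h 1 z"

definition ham2 :: "nat \<Rightarrow> (nat \<Rightarrow> complex) \<Rightarrow> complex \<Rightarrow> complex" where
  "ham2 m h w = ham m h w 1"

definition nondegenerate :: "nat \<Rightarrow> (nat \<Rightarrow> complex) \<Rightarrow> bool" where
  "nondegenerate m h \<longleftrightarrow> h 0 \<noteq> 0 \<and> h (m + 1) \<noteq> 0 \<and>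
     (\<forall>e. ham1 m h e = 0 \<longrightarrow> deriv (ham1 m h) e \<noteq> 0) \<and>
     (\<forall>e. ham2 m h e = 0 \<longrightarrow> deriv (ham2 m h) e \<noteq> 0)"

definition energy_level :: "nat \<Rightarrow> (nat \<Rightarrow> complex) \<Rightarrow> complex \<Rightarrow> (complex \<times> complex) set" where
  "energy_level m h c = {(x, y). ham m h x y = c}"

text \<open>The vector field \<open>(H\<^sub>y, - H\<^sub>x)\<close>.\<close>

definition ham_field :: "nat \<Rightarrow> (nat \<Rightarrow> complex) \<Rightarrow> complex \<times> complex \<Rightarrow> complex \<times> complex" where
  "ham_field m h p =
     (deriv (\<lambda>y. ham m h (fst p) y) (snd p), - deriv (\<lambda>x. ham m h x (snd p)) (fst p))"

text \<open>The projective chart \<open>(u, z) = (1/x, y/x)\<close>, meaningful only where \<open>x \<noteq> 0\<close>. Since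
  division by \<open>0\<close> is \<open>0\<close>, statements using it have to carry \<open>x \<noteq> 0\<close> explicitly.\<close>

definition uz :: "complex \<times> complex \<Rightarrow> complex \<times> complex" where
  "uz p = (1 / fst p, snd p / fst p)"


section \<open>Solutions in complex time, continuation and leaves\<close>

definition complex_solution ::
  "nat \<Rightarrow> (nat \<Rightarrow> complex) \<Rightarrow> complex set \<Rightarrow> (complex \<Rightarrow> complex \<times> complex) \<Rightarrow> bool" where
  "complex_solution m h D \<Phi> \<longleftrightarrow> (\<forall>t\<in>D.
     ((\<lambda>t. fst (\<Phi> t)) has_field_derivative fst (ham_field m h (\<Phi> t))) (at t) \<and>
     ((\<lambda>t. snd (\<Phi> t)) has_field_derivative snd (ham_field m h (\<Phi> t))) (at t))"

text \<open>\<open>Y\<close> is the solution continued along the path \<open>g\<close> of complex times: locally in the path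
  parameter, \<open>Y = \<Phi> \<circ> g\<close> for a holomorphic solution \<open>\<Phi>\<close>. Nothing forces \<open>Y\<close> to be a
  single-valued function of \<open>g\<close> globally. Paths are parametrised by \<open>{0..1}\<close>.\<close>

definition continued_along ::
  "nat \<Rightarrow> (nat \<Rightarrow> complex) \<Rightarrow> (real \<Rightarrow> complex) \<Rightarrow> (real \<Rightarrow> complex \<times> complex) \<Rightarrow> bool" where
  "continued_along m h g Y \<longleftrightarrow> path g \<and>
     (\<forall>s\<in>{0..1}. \<exists>D \<Phi> \<delta>. open D \<and> complex_solution m h D \<Phi> \<and> \<delta> > 0 \<and>
        (\<forall>s'\<in>{0..1}. \<bar>s' - s\<bar> < \<delta> \<longrightarrow> g s' \<in> D \<and> Y s' = \<Phi> (g s')))"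

definition orbit :: "nat \<Rightarrow> (nat \<Rightarrow> complex) \<Rightarrow> complex \<times> complex \<Rightarrow> (complex \<times> complex) set" where
  "orbit m h p = {q. \<exists>g Y. continued_along m h g Y \<and> Y 0 = p \<and> Y 1 = q}"

definition is_leaf :: "nat \<Rightarrow> (nat \<Rightarrow> complex) \<Rightarrow> (complex \<times> complex) set \<Rightarrow> bool" where
  "is_leaf m h L \<longleftrightarrow> (\<exists>p. ham_field m h p \<noteq> 0 \<and> L = orbit m h p)"


section \<open>Blow-up and blow-down\<close>

definition real_solution ::
  "nat \<Rightarrow> (nat \<Rightarrow> complex) \<Rightarrow> (complex \<times> complex) set \<Rightarrow> real \<Rightarrow> (real \<Rightarrow> complex \<times> complex) \<Rightarrow> bool" where
  "real_solution m h L t X \<longleftrightarrow>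
     (X has_vector_derivative ham_field m h (X t)) (at t) \<and> X t \<in> L"

text \<open>Blow-up at real time \<open>T\<close> is the case \<open>F = at_left T\<close>, blow-down the case
  \<open>F = at_right T\<close>. Only unboundedness is required; \<open>|X t| \<longrightarrow> \<infinity>\<close> is not assumed.\<close>

definition blows ::
  "nat \<Rightarrow> (nat \<Rightarrow> complex) \<Rightarrow> (complex \<times> complex) set \<Rightarrow> real filter \<Rightarrow> (real \<Rightarrow> complex \<times> complex) \<Rightarrow> bool" where
  "blows m h L F X \<longleftrightarrow> (\<forall>\<^sub>F t in F. real_solution m h L t X) \<and>
     (\<forall>B. \<exists>\<^sub>F t in F. norm (X t) > B)"

text \<open>The local leaf of a blow-up (blow-down) solution \<open>X\<close> at \<open>T\<close>: all values, recorded with their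
  times, reached from \<open>X\<close> by continuation along paths in the punctured disk of radius \<open>r\<close>
  around \<open>T\<close>. Recording the time fixes the time shift of the autonomous equation, so that \<open>T\<close>
  is the blow-up time of everything in the local leaf.\<close>

definition local_leaf ::
  "nat \<Rightarrow> (nat \<Rightarrow> complex) \<Rightarrow> real \<Rightarrow> real filter \<Rightarrow> (real \<Rightarrow> complex \<times> complex) \<Rightarrow> real
     \<Rightarrow> (complex \<times> (complex \<times> complex)) set" where
  "local_leaf m h T F X r = {(t, p). \<forall>\<^sub>F t0 in F. \<exists>g Y. continued_along m h g Y \<and>
     path_image g \<subseteq> ball (of_real T) r - {of_real T} \<and>
     g 0 = of_real t0 \<and> Y 0 = X t0 \<and> g 1 = t \<and> Y 1 = p}"

definition time_cycle :: "real \<Rightarrow> real \<Rightarrow> nat \<Rightarrow> (real \<Rightarrow> complex) \<Rightarrow> bool" where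
  "time_cycle T r w gt \<longleftrightarrow> path gt \<and> pathfinish gt = pathstart gt \<and>
     path_image gt \<subseteq> ball (of_real T) r - {of_real T} \<and>
     winding_number gt (of_real T) = of_nat w"

definition blow_up_loop ::
  "nat \<Rightarrow> (nat \<Rightarrow> complex) \<Rightarrow> real \<Rightarrow> real filter \<Rightarrow> (real \<Rightarrow> complex \<times> complex) \<Rightarrow> real
     \<Rightarrow> nat \<Rightarrow> (real \<Rightarrow> complex) \<Rightarrow> (real \<Rightarrow> complex \<times> complex) \<Rightarrow> bool" where
  "blow_up_loop m h T F X r w gt guz \<longleftrightarrow> 0 < w \<and> time_cycle T r w gt \<and>
     (\<exists>Y. continued_along m h gt Y \<and>
        (\<forall>s\<in>{0..1}. (gt s, Y s) \<in> local_leaf m h T F X r \<and> fst (Y s) \<noteq> 0 \<and> guz s = uz (Y s))) \<and>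
     guz 1 = guz 0"

definition minimal_blow_up_loop ::
  "nat \<Rightarrow> (nat \<Rightarrow> complex) \<Rightarrow> real \<Rightarrow> real filter \<Rightarrow> (real \<Rightarrow> complex \<times> complex) \<Rightarrow> real
     \<Rightarrow> nat \<Rightarrow> (real \<Rightarrow> complex) \<Rightarrow> (real \<Rightarrow> complex \<times> complex) \<Rightarrow> bool" where
  "minimal_blow_up_loop m h T F X r w gt guz \<longleftrightarrow> blow_up_loop m h T F X r w gt guz \<and>
     (\<forall>w' gt' guz'. blow_up_loop m h T F X r w' gt' guz' \<longrightarrow> w \<le> w')"


section \<open>The real-time blow-up star\<close>

text \<open>A branch is the phase curve, in the chart \<open>(u, z)\<close>, of a real-time solution which lives in
  the local leaf over the whole real interval \<open>I\<close> on one side of \<open>T\<close>.\<close>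

definition branches ::
  "nat \<Rightarrow> (nat \<Rightarrow> complex) \<Rightarrow> (complex \<times> complex) set \<Rightarrow> real \<Rightarrow> real filter \<Rightarrow> (real \<Rightarrow> complex \<times> complex) \<Rightarrow> real
     \<Rightarrow> real filter \<Rightarrow> real set \<Rightarrow> (complex \<times> complex) set set" where
  "branches m h L T F X r G I = {(\<lambda>t. uz (Z t)) ` I | Z. blows m h L G Z \<and>
     (\<forall>t\<in>I. real_solution m h L t Z \<and> fst (Z t) \<noteq> 0 \<and>
        (of_real t, Z t) \<in> local_leaf m h T F X r)}"

definition incoming_branches ::
  "nat \<Rightarrow> (nat \<Rightarrow> complex) \<Rightarrow> (complex \<times> complex) set \<Rightarrow> real \<Rightarrow> real filter \<Rightarrow> (real \<Rightarrow> complex \<times> complex) \<Rightarrow> real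
     \<Rightarrow> (complex \<times> complex) set set" where
  "incoming_branches m h L T F X r = branches m h L T F X r (at_left T) {T - r<..<T}"

definition outgoing_branches ::
  "nat \<Rightarrow> (nat \<Rightarrow> complex) \<Rightarrow> (complex \<times> complex) set \<Rightarrow> real \<Rightarrow> real filter \<Rightarrow> (real \<Rightarrow> complex \<times> complex) \<Rightarrow> real
     \<Rightarrow> (complex \<times> complex) set set" where
  "outgoing_branches m h L T F X r = branches m h L T F X r (at_right T) {T<..<T + r}"

text \<open>Walking once along the closed curve \<open>c\<close>, one meets each of the \<open>2 * w\<close> sets in
  \<open>Inc \<union> Out\<close> exactly once, elements of \<open>Inc\<close> and of \<open>Out\<close> taking turns.\<close>

definition alternating_along ::
  "(real \<Rightarrow> 'a) \<Rightarrow> nat \<Rightarrow> 'a set set \<Rightarrow> 'a set set \<Rightarrow> bool" where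
  "alternating_along c w Inc Out \<longleftrightarrow> (\<exists>s B.
     strict_mono_on {..<2 * w} s \<and>
     s ` {..<2 * w} = {\<sigma>\<in>{0..<1}. c \<sigma> \<in> \<Union>(Inc \<union> Out)} \<and>
     bij_betw B {..<2 * w} (Inc \<union> Out) \<and>
     (\<forall>k<2 * w. B k \<in> (if even k then Inc else Out) \<and>
        (\<forall>j<2 * w. c (s k) \<in> B j \<longleftrightarrow> j = k)))"

text \<open>The cyclic order of the branches around the puncture of the local leaf is read off from a
  minimal blow-up loop which is a simple closed curve in the local leaf.\<close>

definition blow_up_star ::
  "nat \<Rightarrow> (nat \<Rightarrow> complex) \<Rightarrow> (complex \<times> complex) set \<Rightarrow> real \<Rightarrow> real filter \<Rightarrow> (real \<Rightarrow> complex \<times> complex) \<Rightarrow> real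
     \<Rightarrow> nat \<Rightarrow> (complex \<times> complex) set set \<Rightarrow> (complex \<times> complex) set set \<Rightarrow> bool" where
  "blow_up_star m h L T F X r w Inc Out \<longleftrightarrow>
     Inc = incoming_branches m h L T F X r \<and> Out = outgoing_branches m h L T F X r \<and>
     (\<exists>gt guz. minimal_blow_up_loop m h T F X r w gt guz \<and> simple_path guz \<and>
        alternating_along guz w Inc Out)"

end

theory Submission
  imports Defs
begin

text \<open>In the chart \<open>(u, z) = (1/x, y/x)\<close> the energy level is the curve \<open>u\<^sup>m\<^sup>+\<^sup>1 = H\<^sub>1(z)\<close>, and on it
  \<open>u' = - u\<^sup>2\<^sup>-\<^sup>m H\<^sub>1'(z)\<close>, \<open>z' = - (m + 1) u\<^sup>2\<close>. The theorem becomes elementary once time itself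
  is expressed in a good coordinate of this curve.

  \<^emph>\<open>Where blow-up happens.\<close> The function \<open>1 / (1 + |X|\<^sup>2)\<^sup>m\<close> is Lipschitz in time along a
  solution, because the field grows like \<open>|X|\<^sup>m\<close>. Hence it has a limit at \<open>T\<close>, and if \<open>X\<close> is
  unbounded the limit is \<open>0\<close>, so that \<open>|X|\<close> tends to infinity (\<open>blows_norm_diverges\<close>). On the
  energy level \<open>y\<close> is bounded in terms of \<open>x\<close>, since \<open>y\<^sup>m\<^sup>+\<^sup>1\<close> has the coefficient \<open>h 0 \<noteq> 0\<close>;
  therefore \<open>u\<close> tends to \<open>0\<close>. Then \<open>z'\<close> is bounded, so \<open>z\<close> converges, and
  \<open>H\<^sub>1(z) = u\<^sup>m\<^sup>+\<^sup>1\<close> forces the limit \<open>e\<close> to be a zero of \<open>H\<^sub>1\<close> (\<open>blows_limit\<close>).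

  \<^emph>\<open>The coordinate.\<close> Since \<open>e\<close> is a simple zero, \<open>z\<close> is a holomorphic function of \<open>u\<^sup>m\<^sup>+\<^sup>1\<close>
  near \<open>(0, e)\<close>, and \<open>dt = - u\<^sup>m\<^sup>-\<^sup>2 du / H\<^sub>1'(z)\<close> integrates to a function of \<open>u\<close> with a zero of
  order exactly \<open>m - 1\<close>. Its \<open>(m - 1)\<close>-th root \<open>q\<close> is again a coordinate, with
  \<open>t - T = q\<^sup>m\<^sup>-\<^sup>1\<close>, \<open>u = q * exp (\<alpha> q)\<close> and \<open>z - e = q\<^sup>m\<^sup>+\<^sup>1 * exp (\<beta> q)\<close>. These facts are
  the content of the locale \<open>blow_up_chart\<close>, whose assumptions are established by
  \<open>blow_up_chart_exists\<close>.

  \<^emph>\<open>The local leaf.\<close> With \<open>q = exp l\<close>, continuing a solution along a path of complex times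
  amounts to lifting that path through \<open>l \<mapsto> T + exp ((m - 1) l)\<close>, because solutions are
  unique. So the local leaf is the image of a half-plane in \<open>l\<close>, that is, a punctured disk in \<open>q\<close>
  (\<open>local_leaf_eq\<close>). All claims can now be read off. A path of times winding \<open>w\<close> times around
  \<open>T\<close> moves \<open>l\<close> by \<open>2 \<pi> i w / (m - 1)\<close>, so its lift closes up in \<open>q\<close> if and only if \<open>m - 1\<close>
  divides \<open>w\<close>; for \<open>w = m - 1\<close>, \<open>q\<close> winds once, hence \<open>u\<close> winds once and \<open>z - e\<close> winds
  \<open>m + 1\<close> times. Real times correspond to real \<open>q\<^sup>m\<^sup>-\<^sup>1\<close>, that is, to \<open>2 (m - 1)\<close> rays in the
  \<open>q\<close>-disk on which \<open>t < T\<close> and \<open>t > T\<close> alternate: the blow-up star.\<close>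

section \<open>Homogeneity of the Hamiltonian\<close>

definition ham_dx :: "nat \<Rightarrow> (nat \<Rightarrow> complex) \<Rightarrow> complex \<Rightarrow> complex \<Rightarrow> complex" where
  "ham_dx m h x y = (\<Sum>j\<le>m + 1. of_nat j * h j * x ^ (j - 1) * y ^ (m + 1 - j))"

definition ham_dy :: "nat \<Rightarrow> (nat \<Rightarrow> complex) \<Rightarrow> complex \<Rightarrow> complex \<Rightarrow> complex" where
  "ham_dy m h x y = (\<Sum>j\<le>m + 1. of_nat (m + 1 - j) * h j * x ^ j * y ^ (m - j))"

lemma DERIV_ham_x: "((\<lambda>x. ham m h x y) has_field_derivative ham_dx m h x y) (at x)"
  unfolding ham_def ham_dx_def
  by (auto intro!: derivative_eq_intros sum.cong simp: mult_ac simp del: sum.atMost_Suc)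

lemma DERIV_ham_y: "((\<lambda>y. ham m h x y) has_field_derivative ham_dy m h x y) (at y)"
  unfolding ham_def ham_dy_def
  by (auto intro!: derivative_eq_intros sum.cong simp: mult_ac simp del: sum.atMost_Suc)

lemma ham_field_eq: "ham_field m h p = (ham_dy m h (fst p) (snd p), - ham_dx m h (fst p) (snd p))"
  unfolding ham_field_def by (simp add: DERIV_imp_deriv[OF DERIV_ham_x] DERIV_imp_deriv[OF DERIV_ham_y])

lemma DERIV_ham1: "(ham1 m h has_field_derivative ham_dy m h 1 z) (at z)"
  using DERIV_ham_y[of m h 1 z] unfolding ham1_def[abs_def] .

lemma deriv_ham1: "deriv (ham1 m h) z = ham_dy m h 1 z"
  by (rule DERIV_imp_deriv[OF DERIV_ham1])

lemma holomorphic_ham1: "ham1 m h holomorphic_on S"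
  unfolding holomorphic_on_def field_differentiable_def
  using DERIV_ham1 DERIV_subset by blast

lemma Euler_homogeneous: "x * ham_dx m h x y + y * ham_dy m h x y = of_nat (m + 1) * ham m h x y"
proof -
  have "x * (of_nat j * h j * x ^ (j - 1) * y ^ (m + 1 - j)) + y * (of_nat (m + 1 - j) * h j * x ^ j * y ^ (m - j))
      = of_nat (m + 1) * (h j * x ^ j * y ^ (m + 1 - j))" if "j \<le> m + 1" for j
  proof -
    have a: "x * (of_nat j * h j * x ^ (j - 1) * y ^ (m + 1 - j)) = of_nat j * (h j * x ^ j * y ^ (m + 1 - j))"
      by (cases j) auto
    have b: "y * (of_nat (m + 1 - j) * h j * x ^ j * y ^ (m - j)) = of_nat (m + 1 - j) * (h j * x ^ j * y ^ (m + 1 - j))"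
    proof (cases "j = m + 1")
      case False
      then have "m + 1 - j = Suc (m - j)" using that by simp
      then show ?thesis by (simp add: mult_ac)
    qed simp
    have "of_nat j + of_nat (m + 1 - j) = (of_nat (m + 1) :: complex)"
      using that by (metis le_add_diff_inverse of_nat_add)
    then show ?thesis unfolding a b by (metis distrib_right)
  qed
  then show ?thesis
    unfolding ham_def ham_dx_def ham_dy_def
    by (simp add: sum_distrib_left sum.distrib[symmetric] del: sum.atMost_Suc of_nat_Suc of_nat_add power_Suc)
qed

text \<open>Dehomogenisation. With \<open>u = 1/x\<close> and \<open>z = y/x\<close> this is the equation
  \<open>u\<^sup>m\<^sup>+\<^sup>1 = H\<^sub>1(z)\<close> of the energy level \<open>1\<close>; the next lemma does the same for
  \<open>H\<^sub>y\<close>, whose value \<open>ham_dy m h 1 z\<close> is \<open>H\<^sub>1'(z)\<close>.\<close>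

lemma ham_eq_ham1:
  assumes "x \<noteq> 0" shows "ham m h x y = x ^ (m + 1) * ham1 m h (y / x)"
  unfolding ham1_def ham_def sum_distrib_left
proof (rule sum.cong[OF refl])
  fix j assume "j \<in> {..m + 1}"
  then have "x ^ (m + 1) = x ^ j * x ^ (m + 1 - j)" by (simp flip: power_add)
  then show "h j * x ^ j * y ^ (m + 1 - j) = x ^ (m + 1) * (h j * 1 ^ j * (y / x) ^ (m + 1 - j))"
    using assms by (simp add: power_divide del: power_Suc)
qed

lemma ham_dy_eq_ham1:
  assumes "x \<noteq> 0" shows "ham_dy m h x y = x ^ m * ham_dy m h 1 (y / x)"
  unfolding ham_dy_def sum_distrib_left
proof (rule sum.cong[OF refl])
  fix j assume "j \<in> {..m + 1}"
  show "of_nat (m + 1 - j) * h j * x ^ j * y ^ (m - j)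
    = x ^ m * (of_nat (m + 1 - j) * h j * 1 ^ j * (y / x) ^ (m - j))"
  proof (cases "j \<le> m")
    case True
    then have "x ^ m = x ^ j * x ^ (m - j)" by (simp flip: power_add)
    then show ?thesis using assms by (simp add: power_divide del: power_Suc)
  next
    case False
    then show ?thesis by simp
  qed
qed

section \<open>Uniqueness and continuation of solutions\<close>

text \<open>Boundedness and the Lipschitz estimate are put into one predicate because only both
  together are stable under products, which makes the polynomial case an induction.\<close>

definition bounded_lipschitz :: "real \<Rightarrow> (complex \<Rightarrow> complex \<Rightarrow> complex) \<Rightarrow> bool" where
  "bounded_lipschitz B f \<longleftrightarrow> (\<exists>K\<ge>0. \<forall>x y x' y'. norm x \<le> B \<longrightarrow> norm y \<le> B \<longrightarrow> norm x' \<le> B \<longrightarrow> norm y' \<le> B \<longrightarrow>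
     norm (f x y) \<le> K \<and> norm (f x y - f x' y') \<le> K * (norm (x - x') + norm (y - y')))"

lemma bounded_lipschitz_const: "bounded_lipschitz B (\<lambda>x y. c)"
  unfolding bounded_lipschitz_def by (rule exI[of _ "norm c"]) auto

lemma bounded_lipschitz_fst: "bounded_lipschitz B (\<lambda>x y. x)"
  unfolding bounded_lipschitz_def
  by (rule exI[of _ "max 1 \<bar>B\<bar>"]) (auto intro: order_trans[OF _ mult_right_mono[of 1]])

lemma bounded_lipschitz_snd: "bounded_lipschitz B (\<lambda>x y. y)"
  unfolding bounded_lipschitz_def
  by (rule exI[of _ "max 1 \<bar>B\<bar>"]) (auto intro: order_trans[OF _ mult_right_mono[of 1]])

lemma bounded_lipschitz_add:
  assumes "bounded_lipschitz B f" "bounded_lipschitz B g"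
  shows "bounded_lipschitz B (\<lambda>x y. f x y + g x y)"
proof -
  obtain K K' where K: "K \<ge> 0" "\<And>x y x' y'. norm x \<le> B \<Longrightarrow> norm y \<le> B \<Longrightarrow> norm x' \<le> B \<Longrightarrow> norm y' \<le> B \<Longrightarrow>
     norm (f x y) \<le> K \<and> norm (f x y - f x' y') \<le> K * (norm (x - x') + norm (y - y'))"
   and K': "K' \<ge> 0" "\<And>x y x' y'. norm x \<le> B \<Longrightarrow> norm y \<le> B \<Longrightarrow> norm x' \<le> B \<Longrightarrow> norm y' \<le> B \<Longrightarrow>
     norm (g x y) \<le> K' \<and> norm (g x y - g x' y') \<le> K' * (norm (x - x') + norm (y - y'))"
    using assms unfolding bounded_lipschitz_def by metis
  show ?thesis unfolding bounded_lipschitz_def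
  proof (intro exI[of _ "K + K'"] conjI allI impI)
    fix x y x' y' :: complex assume a: "norm x \<le> B" "norm y \<le> B" "norm x' \<le> B" "norm y' \<le> B"
    show "norm (f x y + g x y) \<le> K + K'"
      using K(2)[OF a] K'(2)[OF a] norm_triangle_ineq[of "f x y" "g x y"] by linarith
    have "norm (f x y + g x y - (f x' y' + g x' y')) \<le> norm (f x y - f x' y') + norm (g x y - g x' y')"
      by (metis add_diff_add norm_triangle_ineq)
    then show "norm (f x y + g x y - (f x' y' + g x' y')) \<le> (K + K') * (norm (x - x') + norm (y - y'))"
      using K(2)[OF a] K'(2)[OF a] unfolding distrib_right[of K K'] by linarith
  qed (use K K' in auto)
qed

lemma bounded_lipschitz_mult:
  assumes "bounded_lipschitz B f" "bounded_lipschitz B g"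
  shows "bounded_lipschitz B (\<lambda>x y. f x y * g x y)"
proof -
  obtain K K' where K: "K \<ge> 0" "\<And>x y x' y'. norm x \<le> B \<Longrightarrow> norm y \<le> B \<Longrightarrow> norm x' \<le> B \<Longrightarrow> norm y' \<le> B \<Longrightarrow>
     norm (f x y) \<le> K \<and> norm (f x y - f x' y') \<le> K * (norm (x - x') + norm (y - y'))"
   and K': "K' \<ge> 0" "\<And>x y x' y'. norm x \<le> B \<Longrightarrow> norm y \<le> B \<Longrightarrow> norm x' \<le> B \<Longrightarrow> norm y' \<le> B \<Longrightarrow>
     norm (g x y) \<le> K' \<and> norm (g x y - g x' y') \<le> K' * (norm (x - x') + norm (y - y'))"
    using assms unfolding bounded_lipschitz_def by metis
  show ?thesis unfolding bounded_lipschitz_def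
  proof (intro exI[of _ "2 * (K * K')"] conjI allI impI)
    fix x y x' y' :: complex assume a: "norm x \<le> B" "norm y \<le> B" "norm x' \<le> B" "norm y' \<le> B"
    have "norm (f x y * g x y) \<le> K * K'"
      unfolding norm_mult using K(2)[OF a] K'(2)[OF a] K(1) by (intro mult_mono) auto
    then show "norm (f x y * g x y) \<le> 2 * (K * K')" using K(1) K'(1) mult_nonneg_nonneg[of K K'] by linarith
    define D where "D = norm (x - x') + norm (y - y')"
    have "f x y * g x y - f x' y' * g x' y' = f x y * (g x y - g x' y') + (f x y - f x' y') * g x' y'"
      by (simp add: algebra_simps)
    also have "norm \<dots> \<le> norm (f x y) * norm (g x y - g x' y') + norm (f x y - f x' y') * norm (g x' y')"
      by (metis norm_mult norm_triangle_ineq)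
    also have "\<dots> \<le> K * (K' * D) + (K * D) * K'"
      using K(2)[OF a] K'(2)[OF a] K(1) K'(1) K'(2)[OF a(3,4) a(1,2)]
      by (intro add_mono mult_mono) (auto simp: D_def)
    finally show "norm (f x y * g x y - f x' y' * g x' y') \<le> 2 * (K * K') * D"
      by (simp add: algebra_simps)
  qed (use K K' in auto)
qed

lemma bounded_lipschitz_power: "bounded_lipschitz B f \<Longrightarrow> bounded_lipschitz B (\<lambda>x y. f x y ^ n)"
  by (induction n) (auto intro: bounded_lipschitz_mult bounded_lipschitz_const)

lemma bounded_lipschitz_sum:
  "(\<And>i. i \<in> A \<Longrightarrow> bounded_lipschitz B (f i)) \<Longrightarrow> bounded_lipschitz B (\<lambda>x y. \<Sum>i\<in>A. f i x y)"
  by (induction A rule: infinite_finite_induct) (auto intro: bounded_lipschitz_add bounded_lipschitz_const)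

lemma bounded_lipschitz_ham_derivatives:
  "bounded_lipschitz B (ham_dx m h)" "bounded_lipschitz B (ham_dy m h)"
  unfolding ham_dx_def[abs_def] ham_dy_def[abs_def]
  by (intro bounded_lipschitz_sum bounded_lipschitz_mult bounded_lipschitz_power bounded_lipschitz_const
      bounded_lipschitz_fst bounded_lipschitz_snd)+

lemma ham_field_Lipschitz:
  obtains K where "K \<ge> 0" "\<And>p q. norm p \<le> B \<Longrightarrow> norm q \<le> B \<Longrightarrow>
     norm (fst (ham_field m h p) - fst (ham_field m h q)) \<le> K * (norm (fst p - fst q) + norm (snd p - snd q)) \<and>
     norm (snd (ham_field m h p) - snd (ham_field m h q)) \<le> K * (norm (fst p - fst q) + norm (snd p - snd q))"
proof -
  obtain K K' where K: "K \<ge> 0" "\<And>x y x' y'. norm x \<le> B \<Longrightarrow> norm y \<le> B \<Longrightarrow> norm x' \<le> B \<Longrightarrow> norm y' \<le> B \<Longrightarrow>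
     norm (ham_dx m h x y - ham_dx m h x' y') \<le> K * (norm (x - x') + norm (y - y'))"
   and K': "K' \<ge> 0" "\<And>x y x' y'. norm x \<le> B \<Longrightarrow> norm y \<le> B \<Longrightarrow> norm x' \<le> B \<Longrightarrow> norm y' \<le> B \<Longrightarrow>
     norm (ham_dy m h x y - ham_dy m h x' y') \<le> K' * (norm (x - x') + norm (y - y'))"
    using bounded_lipschitz_ham_derivatives[of B m h] unfolding bounded_lipschitz_def by metis
  show thesis
  proof (rule that[of "max K K'"])
    fix p q :: "complex \<times> complex" assume a: "norm p \<le> B" "norm q \<le> B"
    let ?D = "norm (fst p - fst q) + norm (snd p - snd q)"
    have b: "norm (fst p) \<le> B" "norm (snd p) \<le> B" "norm (fst q) \<le> B" "norm (snd q) \<le> B"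
      using a norm_fst_le[of "fst p" "snd p"] norm_snd_le[of "snd p" "fst p"]
        norm_fst_le[of "fst q" "snd q"] norm_snd_le[of "snd q" "fst q"] by auto
    have "K * ?D \<le> max K K' * ?D" "K' * ?D \<le> max K K' * ?D" by (auto intro!: mult_right_mono)
    then show "norm (fst (ham_field m h p) - fst (ham_field m h q)) \<le> max K K' * ?D \<and>
      norm (snd (ham_field m h p) - snd (ham_field m h q)) \<le> max K K' * ?D"
      using K(2)[OF b] K'(2)[OF b] by (simp add: ham_field_eq norm_minus_commute)
  qed (use K in auto)
qed

lemma complex_solution_continuous:
  assumes "complex_solution m h D \<Phi>" shows "continuous_on D \<Phi>"
proof -
  have "continuous_on D (\<lambda>t. (fst (\<Phi> t), snd (\<Phi> t)))"
    using assms unfolding complex_solution_def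
    by (intro continuous_on_Pair continuous_at_imp_continuous_on ballI) (blast intro: DERIV_isCont)+
  then show ?thesis by simp
qed

text \<open>Uniqueness by contraction: on a disk of radius \<open>\<rho>\<close> so small that \<open>K \<rho> \<le> 1/8\<close> for the
  Lipschitz constant \<open>K\<close> of the field, two solutions that agree somewhere have a difference
  bounded by half of its own maximum. The base point \<open>b\<close> is arbitrary in the disk, which is
  what an argument by connectedness along a path requires.\<close>

lemma complex_solution_unique:
  assumes sol: "complex_solution m h D1 \<Phi>1" "complex_solution m h D2 \<Phi>2"
    and D: "open D1" "open D2" "a \<in> D1" "a \<in> D2"
  obtains \<rho> where "\<rho> > 0" "cball a \<rho> \<subseteq> D1 \<inter> D2"
    "\<And>b t. b \<in> cball a \<rho> \<Longrightarrow> t \<in> cball a \<rho> \<Longrightarrow> \<Phi>1 b = \<Phi>2 b \<Longrightarrow> \<Phi>1 t = \<Phi>2 t"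
proof -
  obtain r where r: "r > 0" "cball a r \<subseteq> D1 \<inter> D2"
    using D open_contains_cball[of "D1 \<inter> D2"] open_Int[OF D(1,2)] by blast
  have cont: "continuous_on (cball a r) \<Phi>1" "continuous_on (cball a r) \<Phi>2"
    using r complex_solution_continuous[OF sol(1)] complex_solution_continuous[OF sol(2)]
    by (auto intro: continuous_on_subset)
  obtain B1 B2 where "\<And>t. t \<in> cball a r \<Longrightarrow> norm (\<Phi>1 t) \<le> B1" "\<And>t. t \<in> cball a r \<Longrightarrow> norm (\<Phi>2 t) \<le> B2"
    using compact_imp_bounded[OF compact_continuous_image[OF cont(1) compact_cball]]
      compact_imp_bounded[OF compact_continuous_image[OF cont(2) compact_cball]]
    unfolding bounded_iff by (metis imageI)
  then have B: "norm (\<Phi>1 t) \<le> max B1 B2" "norm (\<Phi>2 t) \<le> max B1 B2" if "t \<in> cball a r" for t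
    using that by (meson max.coboundedI1 max.coboundedI2)+
  obtain K where K: "K \<ge> 0" "\<And>p q. norm p \<le> max B1 B2 \<Longrightarrow> norm q \<le> max B1 B2 \<Longrightarrow>
     norm (fst (ham_field m h p) - fst (ham_field m h q)) \<le> K * (norm (fst p - fst q) + norm (snd p - snd q)) \<and>
     norm (snd (ham_field m h p) - snd (ham_field m h q)) \<le> K * (norm (fst p - fst q) + norm (snd p - snd q))"
    using ham_field_Lipschitz[of "max B1 B2" m h] by metis
  define \<rho> where "\<rho> = min r (1 / (8 * (K + 1)))"
  have \<rho>: "\<rho> > 0" "\<rho> \<le> r" using r K(1) by (auto simp: \<rho>_def)
  have "K * \<rho> \<le> K * (1 / (8 * (K + 1)))" using K(1) by (intro mult_left_mono) (auto simp: \<rho>_def)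
  also have "\<dots> \<le> 1 / 8" using K(1) by (simp add: field_simps)
  finally have K\<rho>: "K * \<rho> \<le> 1 / 8" .
  have sub: "cball a \<rho> \<subseteq> cball a r" using \<rho> by auto
  show thesis
  proof (rule that[OF \<rho>(1)])
    show "cball a \<rho> \<subseteq> D1 \<inter> D2" using sub r by blast
    fix b t assume b: "b \<in> cball a \<rho>" and t: "t \<in> cball a \<rho>" and eq: "\<Phi>1 b = \<Phi>2 b"
    define d where "d t = norm (fst (\<Phi>1 t) - fst (\<Phi>2 t)) + norm (snd (\<Phi>1 t) - snd (\<Phi>2 t))" for t
    have "continuous_on (cball a \<rho>) d"
      unfolding d_def using cont sub by (intro continuous_intros) (auto intro: continuous_on_subset)
    then obtain t0 where t0: "t0 \<in> cball a \<rho>" "\<And>t. t \<in> cball a \<rho> \<Longrightarrow> d t \<le> d t0"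
      using continuous_attains_sup[of "cball a \<rho>" d] \<rho>(1) by auto
    have near: "norm (t0 - b) \<le> 2 * \<rho>"
      using t0(1) b dist_triangle[of t0 b a] by (auto simp: dist_norm norm_minus_commute)
    have s: "z \<in> D1 \<and> z \<in> D2 \<and> z \<in> cball a r" if "z \<in> cball a \<rho>" for z using that sub r by auto
    have 1: "norm ((fst (\<Phi>1 t0) - fst (\<Phi>2 t0)) - (fst (\<Phi>1 b) - fst (\<Phi>2 b))) \<le> K * d t0 * norm (t0 - b)"
    proof (rule field_differentiable_bound[where S = "cball a \<rho>"])
      fix z assume z: "z \<in> cball a \<rho>"
      show "((\<lambda>t. fst (\<Phi>1 t) - fst (\<Phi>2 t)) has_field_derivative
         (fst (ham_field m h (\<Phi>1 z)) - fst (ham_field m h (\<Phi>2 z)))) (at z within cball a \<rho>)"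
        using sol s[OF z] unfolding complex_solution_def
        by (intro DERIV_diff) (auto intro: has_field_derivative_at_within)
      have "norm (fst (ham_field m h (\<Phi>1 z)) - fst (ham_field m h (\<Phi>2 z))) \<le> K * d z"
        using K(2)[OF B[of z]] s[OF z] unfolding d_def by blast
      also have "\<dots> \<le> K * d t0" using t0(2)[OF z] K(1) by (intro mult_left_mono)
      finally show "norm (fst (ham_field m h (\<Phi>1 z)) - fst (ham_field m h (\<Phi>2 z))) \<le> K * d t0" .
    qed (use b t0 in auto)
    have 2: "norm ((snd (\<Phi>1 t0) - snd (\<Phi>2 t0)) - (snd (\<Phi>1 b) - snd (\<Phi>2 b))) \<le> K * d t0 * norm (t0 - b)"
    proof (rule field_differentiable_bound[where S = "cball a \<rho>"])
      fix z assume z: "z \<in> cball a \<rho>"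
      show "((\<lambda>t. snd (\<Phi>1 t) - snd (\<Phi>2 t)) has_field_derivative
         (snd (ham_field m h (\<Phi>1 z)) - snd (ham_field m h (\<Phi>2 z)))) (at z within cball a \<rho>)"
        using sol s[OF z] unfolding complex_solution_def
        by (intro DERIV_diff) (auto intro: has_field_derivative_at_within)
      have "norm (snd (ham_field m h (\<Phi>1 z)) - snd (ham_field m h (\<Phi>2 z))) \<le> K * d z"
        using K(2)[OF B[of z]] s[OF z] unfolding d_def by blast
      also have "\<dots> \<le> K * d t0" using t0(2)[OF z] K(1) by (intro mult_left_mono)
      finally show "norm (snd (ham_field m h (\<Phi>1 z)) - snd (ham_field m h (\<Phi>2 z))) \<le> K * d t0" .
    qed (use b t0 in auto)
    have d0: "d t0 \<ge> 0" by (simp add: d_def)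
    (* each of the two components contributes K * d t0 * norm (t0 - b) *)
    have "d t0 \<le> 2 * (K * d t0 * norm (t0 - b))" using 1 2 eq by (simp add: d_def)
    also have "\<dots> \<le> 2 * (K * d t0 * (2 * \<rho>))" using near K(1) d0 by (intro mult_left_mono) auto
    also have "\<dots> = 4 * (K * \<rho>) * d t0" by simp
    also have "\<dots> \<le> 4 * (1 / 8) * d t0" using K\<rho> d0 by (intro mult_right_mono) auto
    finally have "d t0 = 0" using d0 by simp
    then have "d t = 0" using t0(2)[OF t] by (simp add: d_def antisym add_nonneg_nonneg)
    then show "\<Phi>1 t = \<Phi>2 t" by (simp add: d_def prod_eq_iff add_nonneg_eq_0_iff)
  qed
qed

text \<open>By the preceding lemma, agreement at one parameter spreads to all nearby parameters in
  either direction; the interval is connected.\<close>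

lemma continued_along_unique:
  assumes c1: "continued_along m h g Y1" and c2: "continued_along m h g Y2"
    and 0: "Y1 0 = Y2 0" and s: "s \<in> {0..1}"
  shows "Y1 s = Y2 s"
proof (rule connected_induction_simple[where S = "{0..1::real}" and a = 0 and P = "\<lambda>s. Y1 s = Y2 s"])
  fix s :: real assume s: "s \<in> {0..1}"
  obtain D1 \<Phi>1 \<delta>1 where 1: "open D1" "complex_solution m h D1 \<Phi>1" "\<delta>1 > 0"
    "\<forall>s'\<in>{0..1}. \<bar>s' - s\<bar> < \<delta>1 \<longrightarrow> g s' \<in> D1 \<and> Y1 s' = \<Phi>1 (g s')"
    using c1 s unfolding continued_along_def by meson
  obtain D2 \<Phi>2 \<delta>2 where 2: "open D2" "complex_solution m h D2 \<Phi>2" "\<delta>2 > 0"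
    "\<forall>s'\<in>{0..1}. \<bar>s' - s\<bar> < \<delta>2 \<longrightarrow> g s' \<in> D2 \<and> Y2 s' = \<Phi>2 (g s')"
    using c2 s unfolding continued_along_def by meson
  have "g s \<in> D1" "g s \<in> D2" using 1 2 s by auto
  then obtain \<rho> where \<rho>: "\<rho> > 0"
    "\<And>b t. b \<in> cball (g s) \<rho> \<Longrightarrow> t \<in> cball (g s) \<rho> \<Longrightarrow> \<Phi>1 b = \<Phi>2 b \<Longrightarrow> \<Phi>1 t = \<Phi>2 t"
    using complex_solution_unique[OF 1(2) 2(2) 1(1) 2(1)] by metis
  have "continuous_on {0..1} g" using c1 by (simp add: continued_along_def path_def)
  then obtain \<delta>3 where 3: "\<delta>3 > 0" "\<forall>s'\<in>{0..1}. \<bar>s' - s\<bar> < \<delta>3 \<longrightarrow> g s' \<in> cball (g s) \<rho>"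
    using s \<rho>(1) unfolding continuous_on_iff
    by (metis dist_real_def dist_commute less_imp_le mem_cball)
  let ?T = "{0..1} \<inter> ball s (min \<delta>1 (min \<delta>2 \<delta>3))"
  have *: "x \<in> {0..1}" "\<bar>x - s\<bar> < \<delta>1" "\<bar>x - s\<bar> < \<delta>2" "\<bar>x - s\<bar> < \<delta>3" if "x \<in> ?T" for x
    using that by (auto simp: dist_real_def)
  show "\<exists>T. openin (top_of_set {0..1}) T \<and> s \<in> T \<and> (\<forall>x\<in>T. \<forall>y\<in>T. Y1 x = Y2 x \<longrightarrow> Y1 y = Y2 y)"
  proof (intro exI[of _ ?T] conjI ballI impI)
    fix x y assume "x \<in> ?T" "y \<in> ?T" "Y1 x = Y2 x"
    then show "Y1 y = Y2 y" using *[of x] *[of y] 1(4) 2(4) 3(2) \<rho>(2)[of "g x" "g y"] by metis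
  qed (use s 1 2 3 in \<open>auto intro: openin_open_Int\<close>)
qed (use s 0 in auto)

text \<open>The equation is autonomous. Time shifts are needed because the path reaching a point
  of an orbit may end at a time different from the one at which the next path starts.\<close>

lemma continued_along_shift:
  assumes "continued_along m h g Y" shows "continued_along m h (\<lambda>s. g s + c) Y"
  unfolding continued_along_def
proof (intro conjI ballI)
  show "path (\<lambda>s. g s + c)"
    using assms unfolding continued_along_def path_def by (intro continuous_intros) auto
  fix s :: real assume "s \<in> {0..1}"
  then obtain D \<Phi> \<delta> where 1: "open D" "complex_solution m h D \<Phi>" "\<delta> > 0"
    "\<forall>s'\<in>{0..1}. \<bar>s' - s\<bar> < \<delta> \<longrightarrow> g s' \<in> D \<and> Y s' = \<Phi> (g s')"
    using assms unfolding continued_along_def by meson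
  have "complex_solution m h ((\<lambda>t. t + c) ` D) (\<lambda>t. \<Phi> (t - c))"
    unfolding complex_solution_def
  proof (intro ballI conjI)
    fix t assume "t \<in> (\<lambda>t. t + c) ` D"
    then have "t - c \<in> D" by auto
    then have *: "((\<lambda>t. fst (\<Phi> t)) has_field_derivative fst (ham_field m h (\<Phi> (t - c)))) (at (t - c))"
      "((\<lambda>t. snd (\<Phi> t)) has_field_derivative snd (ham_field m h (\<Phi> (t - c)))) (at (t - c))"
      using 1(2) unfolding complex_solution_def by auto
    show "((\<lambda>t. fst (\<Phi> (t - c))) has_field_derivative fst (ham_field m h (\<Phi> (t - c)))) (at t)"
      "((\<lambda>t. snd (\<Phi> (t - c))) has_field_derivative snd (ham_field m h (\<Phi> (t - c)))) (at t)"
      using DERIV_shift[of _ _ t "- c"] * by (auto simp: )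
  qed
  moreover have "open ((\<lambda>t. t + c) ` D)"
    using open_translation[OF 1(1), of c] by (simp add: add.commute)
  ultimately show "\<exists>D \<Phi> \<delta>. open D \<and> complex_solution m h D \<Phi> \<and> \<delta> > 0 \<and>
        (\<forall>s'\<in>{0..1}. \<bar>s' - s\<bar> < \<delta> \<longrightarrow> g s' + c \<in> D \<and> Y s' = \<Phi> (g s' + c))"
    using 1(3,4) by (intro exI[of _ "(\<lambda>t. t + c) ` D"] exI[of _ "\<lambda>t. \<Phi> (t - c)"] exI[of _ \<delta>]) auto
qed

text \<open>The only nontrivial point is the junction: two local solutions meet there with the
  same value, and uniqueness makes them one solution on a small disk.\<close>

lemma continued_along_join:
  assumes c1: "continued_along m h g1 Y1" and c2: "continued_along m h g2 Y2"
    and eq: "g1 1 = g2 0" "Y1 1 = Y2 0"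
  shows "continued_along m h (g1 +++ g2) (Y1 +++ Y2)"
  unfolding continued_along_def
proof (intro conjI ballI)
  show "path (g1 +++ g2)"
    using c1 c2 eq by (auto simp: continued_along_def pathstart_def pathfinish_def)
  fix s :: real assume s: "s \<in> {0..1}"
  note j = joinpaths_def
  let ?goal = "\<exists>D \<Phi> \<delta>. open D \<and> complex_solution m h D \<Phi> \<and> \<delta> > 0 \<and>
        (\<forall>s'\<in>{0..1}. \<bar>s' - s\<bar> < \<delta> \<longrightarrow> (g1 +++ g2) s' \<in> D \<and> (Y1 +++ Y2) s' = \<Phi> ((g1 +++ g2) s'))"
  have left: "\<exists>D \<Phi> \<delta>. open D \<and> complex_solution m h D \<Phi> \<and> \<delta> > 0 \<and>
        (\<forall>s'\<in>{0..1/2}. \<bar>s' - s\<bar> < \<delta> \<longrightarrow> g1 (2 * s') \<in> D \<and> Y1 (2 * s') = \<Phi> (g1 (2 * s')))" if "s \<le> 1/2"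
  proof -
    have "2 * s \<in> {0..1}" using that s by auto
    then obtain D \<Phi> \<delta> where 1: "open D" "complex_solution m h D \<Phi>" "\<delta> > 0"
      "\<forall>s'\<in>{0..1}. \<bar>s' - 2 * s\<bar> < \<delta> \<longrightarrow> g1 s' \<in> D \<and> Y1 s' = \<Phi> (g1 s')"
      using c1 unfolding continued_along_def by meson
    have "g1 (2 * s') \<in> D \<and> Y1 (2 * s') = \<Phi> (g1 (2 * s'))" if "s' \<in> {0..1/2}" "\<bar>s' - s\<bar> < \<delta> / 2" for s'
      by (rule bspec[OF 1(4), THEN mp]) (use that in \<open>auto simp: abs_if split: if_splits\<close>)
    then show ?thesis using 1 by (intro exI[of _ D] exI[of _ \<Phi>] exI[of _ "\<delta> / 2"]) auto
  qed
  have right: "\<exists>D \<Phi> \<delta>. open D \<and> complex_solution m h D \<Phi> \<and> \<delta> > 0 \<and>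
        (\<forall>s'\<in>{1/2..1}. \<bar>s' - s\<bar> < \<delta> \<longrightarrow> g2 (2 * s' - 1) \<in> D \<and> Y2 (2 * s' - 1) = \<Phi> (g2 (2 * s' - 1)))" if "s \<ge> 1/2"
  proof -
    have "2 * s - 1 \<in> {0..1}" using that s by auto
    then obtain D \<Phi> \<delta> where 1: "open D" "complex_solution m h D \<Phi>" "\<delta> > 0"
      "\<forall>s'\<in>{0..1}. \<bar>s' - (2 * s - 1)\<bar> < \<delta> \<longrightarrow> g2 s' \<in> D \<and> Y2 s' = \<Phi> (g2 s')"
      using c2 unfolding continued_along_def by meson
    have "g2 (2 * s' - 1) \<in> D \<and> Y2 (2 * s' - 1) = \<Phi> (g2 (2 * s' - 1))"
      if "s' \<in> {1/2..1}" "\<bar>s' - s\<bar> < \<delta> / 2" for s'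
      by (rule bspec[OF 1(4), THEN mp]) (use that in \<open>auto simp: abs_if split: if_splits\<close>)
    then show ?thesis using 1 by (intro exI[of _ D] exI[of _ \<Phi>] exI[of _ "\<delta> / 2"]) auto
  qed
  consider "s < 1/2" | "s > 1/2" | "s = 1/2" by linarith
  then show ?goal
  proof cases
    case 1
    then obtain D \<Phi> \<delta> where *: "open D" "complex_solution m h D \<Phi>" "\<delta> > 0"
        "(\<forall>s'\<in>{0..1/2}. \<bar>s' - s\<bar> < \<delta> \<longrightarrow> g1 (2 * s') \<in> D \<and> Y1 (2 * s') = \<Phi> (g1 (2 * s')))"
      using left by auto
    show ?thesis
      by (rule exI[of _ D], rule exI[of _ \<Phi>], rule exI[of _ "min \<delta> (1/2 - s)"])
         (use * 1 in \<open>auto simp: j\<close>)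
  next
    case 2
    then obtain D \<Phi> \<delta> where *: "open D" "complex_solution m h D \<Phi>" "\<delta> > 0"
        "(\<forall>s'\<in>{1/2..1}. \<bar>s' - s\<bar> < \<delta> \<longrightarrow> g2 (2 * s' - 1) \<in> D \<and> Y2 (2 * s' - 1) = \<Phi> (g2 (2 * s' - 1)))"
      using right by auto
    show ?thesis
      by (rule exI[of _ D], rule exI[of _ \<Phi>], rule exI[of _ "min \<delta> (s - 1/2)"])
         (use * 2 in \<open>auto simp: j\<close>)
  next
    case 3
    obtain D1 \<Phi>1 \<delta>1 where 1: "open D1" "complex_solution m h D1 \<Phi>1" "\<delta>1 > 0"
        "(\<forall>s'\<in>{0..1/2}. \<bar>s' - s\<bar> < \<delta>1 \<longrightarrow> g1 (2 * s') \<in> D1 \<and> Y1 (2 * s') = \<Phi>1 (g1 (2 * s')))"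
      using left 3 by auto
    obtain D2 \<Phi>2 \<delta>2 where 2: "open D2" "complex_solution m h D2 \<Phi>2" "\<delta>2 > 0"
        "(\<forall>s'\<in>{1/2..1}. \<bar>s' - s\<bar> < \<delta>2 \<longrightarrow> g2 (2 * s' - 1) \<in> D2 \<and> Y2 (2 * s' - 1) = \<Phi>2 (g2 (2 * s' - 1)))"
      using right 3 by auto
    have a: "g1 1 \<in> D1" "Y1 1 = \<Phi>1 (g1 1)" "g1 1 \<in> D2" "Y1 1 = \<Phi>2 (g1 1)"
      using bspec[OF 1(4), of "1/2"] bspec[OF 2(4), of "1/2"] 3 1(3) 2(3) eq by auto
    obtain \<rho> where \<rho>: "\<rho> > 0" "cball (g1 1) \<rho> \<subseteq> D1 \<inter> D2"
      "\<And>b t. b \<in> cball (g1 1) \<rho> \<Longrightarrow> t \<in> cball (g1 1) \<rho> \<Longrightarrow> \<Phi>1 b = \<Phi>2 b \<Longrightarrow> \<Phi>1 t = \<Phi>2 t"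
      using complex_solution_unique[OF 1(2) 2(2) 1(1) 2(1) a(1,3)] by metis
    have agree: "\<Phi>1 t = \<Phi>2 t" if "t \<in> ball (g1 1) \<rho>" for t
      using \<rho>(3)[of "g1 1" t] \<rho>(1) a that by auto
    have "continuous_on {0..1} (g1 +++ g2)" using \<open>path (g1 +++ g2)\<close> by (simp add: path_def)
    moreover have "(g1 +++ g2) s = g1 1" unfolding 3 by (simp add: j)
    ultimately obtain \<delta>3 where \<delta>3: "\<delta>3 > 0"
      "\<forall>s'\<in>{0..1}. \<bar>s' - s\<bar> < \<delta>3 \<longrightarrow> (g1 +++ g2) s' \<in> ball (g1 1) \<rho>"
      using s \<rho>(1) unfolding continuous_on_iff
      by (metis dist_real_def dist_commute mem_ball)
    show ?thesis
    proof (rule exI[of _ "ball (g1 1) \<rho>"], rule exI[of _ \<Phi>1], rule exI[of _ "min \<delta>1 (min \<delta>2 \<delta>3)"],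
        intro conjI ballI impI)
      show "complex_solution m h (ball (g1 1) \<rho>) \<Phi>1"
        using 1(2) \<rho>(2) ball_subset_cball[of "g1 1" \<rho>] unfolding complex_solution_def by blast
      fix s' :: real assume s': "s' \<in> {0..1}" "\<bar>s' - s\<bar> < min \<delta>1 (min \<delta>2 \<delta>3)"
      show in': "(g1 +++ g2) s' \<in> ball (g1 1) \<rho>" using \<delta>3 s' by auto
      show "(Y1 +++ Y2) s' = \<Phi>1 ((g1 +++ g2) s')"
      proof (cases "s' \<le> 1/2")
        case True then show ?thesis using 1(4) s' by (auto simp: j)
      next
        case False then show ?thesis using 2(4) s' agree[OF in'] by (auto simp: j)
      qed
    qed (use 1 2 \<delta>3 in auto)
  qed
qed

lemma orbit_trans:
  assumes "q \<in> orbit m h p" "continued_along m h g Y" "Y 0 = q"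
  shows "Y 1 \<in> orbit m h p"
proof -
  obtain g1 Y1 where 1: "continued_along m h g1 Y1" "Y1 0 = p" "Y1 1 = q"
    using assms(1) unfolding orbit_def by auto
  have "continued_along m h (\<lambda>s. g1 s + (g 0 - g1 1)) Y1" by (rule continued_along_shift[OF 1(1)])
  then have "continued_along m h ((\<lambda>s. g1 s + (g 0 - g1 1)) +++ g) (Y1 +++ Y)"
    by (rule continued_along_join[OF _ assms(2)]) (use assms 1 in auto)
  then show ?thesis
    unfolding orbit_def using 1 by (auto intro!: exI simp: joinpaths_def)
qed

section \<open>Unbounded solutions tend to a zero of the dehomogenised Hamiltonian\<close>

text \<open>Allows blow-up and blow-down to be treated at once, replacing either one-sided filter
  by an open interval with endpoint \<open>T\<close>.\<close>

lemma one_sided_interval: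
  fixes T :: real
  assumes F: "F = at_left T \<or> F = at_right T" and ev: "eventually P F"
  obtains I where "convex I" "open I" "\<And>t. t \<in> I \<Longrightarrow> P t" "F = at T within I" "T \<in> closure I"
    "F \<noteq> bot" "\<forall>\<^sub>F t in F. t \<in> I"
proof -
  have nb: "F \<noteq> bot" using F by (metis trivial_limit_at_left_real trivial_limit_at_right_real)
  from F show thesis
  proof
    assume 1: "F = at_left T"
    then obtain b where b: "b < T" "\<And>y. y > b \<Longrightarrow> y < T \<Longrightarrow> P y"
      using ev unfolding 1 eventually_at_left_field by metis
    have "F = at T within {b<..<T}" unfolding 1
      by (rule at_within_nhd[of _ "{b<..}"]) (use b in auto)
    moreover have "\<forall>\<^sub>F t in F. t \<in> {b<..<T}" unfolding 1
      using b by (intro eventually_at_leftI[of b]) auto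
    ultimately show thesis using b nb by (intro that[of "{b<..<T}"]) auto
  next
    assume 1: "F = at_right T"
    then obtain b where b: "b > T" "\<And>y. y > T \<Longrightarrow> y < b \<Longrightarrow> P y"
      using ev unfolding 1 eventually_at_right_field by metis
    have "F = at T within {T<..<b}" unfolding 1
      by (rule at_within_nhd[of _ "{..<b}"]) (use b in auto)
    moreover have "\<forall>\<^sub>F t in F. t \<in> {T<..<b}" unfolding 1
      using b by (intro eventually_at_rightI[of _ b]) auto
    ultimately show thesis using b nb by (intro that[of "{T<..<b}"]) auto
  qed
qed

lemma le_one_plus_square: "x \<le> 1 + x\<^sup>2" for x :: real
proof -
  have "0 \<le> (x - 1 / 2)\<^sup>2" by simp
  then show ?thesis by (simp add: power2_diff power_divide)
qed

text \<open>The components of the field are homogeneous of degree \<open>m\<close>, and both \<open>|x|\<close> and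
  \<open>|y|\<close> are at most \<open>1 + |p|\<^sup>2\<close>.\<close>

lemma ham_field_growth:
  obtains C where "C \<ge> 0" "\<And>p. norm (ham_field m h p) \<le> C * (1 + (norm p)\<^sup>2) ^ m"
proof (rule that[of "(\<Sum>j\<le>m + 1. of_nat (m + 1 - j) * norm (h j)) + (\<Sum>j\<le>m + 1. of_nat j * norm (h j))"])
  fix p :: "complex \<times> complex"
  obtain x y where p: "p = (x, y)" by (cases p)
  define A where "A = 1 + (norm p)\<^sup>2"
  have A1: "1 \<le> A" by (simp add: A_def)
  have "norm p \<le> A" unfolding A_def by (rule le_one_plus_square)
  then have xy: "norm x \<le> A" "norm y \<le> A"
    using norm_fst_le[of x y] norm_snd_le[of y x] p by auto
  have pw: "norm x ^ a * norm y ^ b \<le> A ^ m" if "a + b = m" for a b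
  proof -
    have "norm x ^ a * norm y ^ b \<le> A ^ a * A ^ b"
      using xy A1 by (intro mult_mono power_mono) auto
    then show ?thesis using that by (metis power_add)
  qed
  have 1: "norm (ham_dy m h x y) \<le> (\<Sum>j\<le>m + 1. of_nat (m + 1 - j) * norm (h j)) * A ^ m"
    unfolding ham_dy_def sum_distrib_right
  proof (rule sum_norm_le)
    fix j assume "j \<in> {..m + 1}"
    show "norm (of_nat (m + 1 - j) * h j * x ^ j * y ^ (m - j)) \<le> of_nat (m + 1 - j) * norm (h j) * A ^ m"
    proof (cases "j \<le> m")
      case True
      have "norm (of_nat (m + 1 - j) * h j * x ^ j * y ^ (m - j)) = of_nat (m + 1 - j) * norm (h j) * (norm x ^ j * norm y ^ (m - j))"
        unfolding norm_mult norm_power norm_of_nat by (simp add: mult_ac)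
      also have "\<dots> \<le> of_nat (m + 1 - j) * norm (h j) * A ^ m"
        using True by (intro mult_left_mono pw) auto
      finally show ?thesis .
    qed (use A1 in auto)
  qed
  have 2: "norm (ham_dx m h x y) \<le> (\<Sum>j\<le>m + 1. of_nat j * norm (h j)) * A ^ m"
    unfolding ham_dx_def sum_distrib_right
  proof (rule sum_norm_le)
    fix j assume "j \<in> {..m + 1}"
    then have j: "j = 0 \<or> (j - 1) + (m + 1 - j) = m" by auto
    show "norm (of_nat j * h j * x ^ (j - 1) * y ^ (m + 1 - j)) \<le> of_nat j * norm (h j) * A ^ m"
    proof (cases "j = 0")
      case False
      have "norm (of_nat j * h j * x ^ (j - 1) * y ^ (m + 1 - j)) = of_nat j * norm (h j) * (norm x ^ (j - 1) * norm y ^ (m + 1 - j))"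
        unfolding norm_mult norm_power norm_of_nat by (simp add: mult_ac)
      also have "\<dots> \<le> of_nat j * norm (h j) * A ^ m"
        using False j by (intro mult_left_mono pw) auto
      finally show ?thesis .
    qed auto
  qed
  have "norm (ham_field m h p) \<le> norm (ham_dy m h x y) + norm (ham_dx m h x y)"
    unfolding ham_field_eq p using norm_Pair_le[of "ham_dy m h x y" "- ham_dx m h x y"] by simp
  also have "\<dots> \<le> (\<Sum>j\<le>m + 1. of_nat (m + 1 - j) * norm (h j)) * A ^ m + (\<Sum>j\<le>m + 1. of_nat j * norm (h j)) * A ^ m"
    using 1 2 by linarith
  finally show "norm (ham_field m h p) \<le> ((\<Sum>j\<le>m + 1. of_nat (m + 1 - j) * norm (h j)) + (\<Sum>j\<le>m + 1. of_nat j * norm (h j))) * (1 + (norm p)\<^sup>2) ^ m"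
    unfolding A_def by (simp add: distrib_right)
qed (auto intro!: add_nonneg_nonneg sum_nonneg simp del: sum.atMost_Suc)

text \<open>With \<open>v = 1 / (1 + |X|\<^sup>2)\<^sup>m\<close> the growth bound gives \<open>|v'| \<le> K\<close>. As \<open>v\<close> comes
  arbitrarily close to \<open>0\<close> near \<open>T\<close>, it satisfies \<open>v t \<le> K |t - T|\<close>. So \<open>v\<close> tends
  to \<open>0\<close>, and being unbounded improves to tending to infinity.\<close>

lemma blows_norm_diverges:
  assumes F: "F = at_left T \<or> F = at_right T" and b: "blows m h L F X" and m: "1 \<le> m"
  shows "\<forall>\<^sub>F t in F. B < norm (X t)"
proof -
  have "\<forall>\<^sub>F t in F. real_solution m h L t X" using b by (simp add: blows_def)
  then obtain I where I: "convex I" "open I" "\<And>t. t \<in> I \<Longrightarrow> real_solution m h L t X"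
    "F = at T within I" "\<forall>\<^sub>F t in F. t \<in> I"
    using one_sided_interval[OF F] by metis
  obtain C where C: "C \<ge> 0" "\<And>p. norm (ham_field m h p) \<le> C * (1 + (norm p)\<^sup>2) ^ m"
    using ham_field_growth[of m h] by metis
  define v where "v t = inverse (1 + X t \<bullet> X t) ^ m" for t
  define K where "K = real m * (2 * C)"
  have K0: "K \<ge> 0" using C by (simp add: K_def)
  have lip: "\<bar>v s - v t\<bar> \<le> K * \<bar>s - t\<bar>" if st: "s \<in> I" "t \<in> I" for s t
  proof -
    define v' where "v' t = real m * inverse (1 + X t \<bullet> X t) ^ (m - 1) *
        (- (inverse (1 + X t \<bullet> X t) * (2 * (X t \<bullet> ham_field m h (X t))) * inverse (1 + X t \<bullet> X t)))" for t
    have "norm (v s - v t) \<le> K * norm (s - t)"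
    proof (rule field_differentiable_bound[OF I(1), where f' = v'])
      fix t assume t: "t \<in> I"
      have d: "(X has_derivative (\<lambda>x. x *\<^sub>R ham_field m h (X t))) (at t)"
        using I(3)[OF t] by (simp add: real_solution_def has_vector_derivative_def)
      have "((\<lambda>t. X t \<bullet> X t) has_derivative (\<lambda>x. X t \<bullet> (x *\<^sub>R ham_field m h (X t)) + (x *\<^sub>R ham_field m h (X t)) \<bullet> X t)) (at t)"
        by (rule has_derivative_inner[OF d d])
      then have "((\<lambda>t. X t \<bullet> X t) has_field_derivative 2 * (X t \<bullet> ham_field m h (X t))) (at t)"
        unfolding has_field_derivative_def by (rule has_derivative_eq_rhs) (auto simp: fun_eq_iff inner_commute)
      then have "(v has_field_derivative v' t) (at t)"
        unfolding v_def v'_def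
        by (auto intro!: derivative_eq_intros) (auto simp: add_nonneg_eq_0_iff)
      then show "(v has_field_derivative v' t) (at t within I)" by (rule has_field_derivative_at_within)
      define A where "A = 1 + X t \<bullet> X t"
      have A: "A \<ge> 1" "A = 1 + (norm (X t))\<^sup>2" by (auto simp: A_def power2_norm_eq_inner)
      have nA: "norm (X t) \<le> A" unfolding A by (rule le_one_plus_square)
      have "\<bar>X t \<bullet> ham_field m h (X t)\<bar> \<le> norm (X t) * norm (ham_field m h (X t))"
        by (rule Cauchy_Schwarz_ineq2)
      also have "\<dots> \<le> A * (C * A ^ m)"
        using nA C(2)[of "X t"] A by (intro mult_mono) auto
      finally have i: "\<bar>X t \<bullet> ham_field m h (X t)\<bar> \<le> C * A ^ (m + 1)" by (simp add: mult_ac)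
      show "norm (v' t) \<le> K"
      proof (cases "m = 0")
        case False
        have "norm (v' t) = real m * inverse A ^ (m - 1) * (inverse A * (2 * \<bar>X t \<bullet> ham_field m h (X t)\<bar>) * inverse A)"
          unfolding v'_def A_def[symmetric] using A(1) by (simp add: abs_mult)
        also have "\<dots> \<le> real m * inverse A ^ (m - 1) * (inverse A * (2 * (C * A ^ (m + 1))) * inverse A)"
          using i A(1) by (intro mult_left_mono mult_right_mono) auto
        also have "\<dots> = real m * (2 * C) * (inverse A ^ (m - 1 + 2) * A ^ (m + 1))"
          by (simp add: power_add power2_eq_square mult_ac)
        also have "m - 1 + 2 = m + 1" using False by simp
        also have "inverse A ^ (m + 1) * A ^ (m + 1) = 1" by (subst power_mult_distrib[symmetric]) (use A(1) in simp)
        finally show ?thesis by (simp add: K_def)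
      qed (simp add: v'_def K0)
    qed (use st in auto)
    then show ?thesis by simp
  qed
  have vle: "v t \<le> K * \<bar>t - T\<bar>" if t: "t \<in> I" for t
  proof (rule ccontr)
    assume neg: "\<not> v t \<le> K * \<bar>t - T\<bar>"
    (* near T there is s with v s < \<gamma> / 2, so the Lipschitz bound makes v t smaller than it is *)
    define \<gamma> where "\<gamma> = v t - K * \<bar>t - T\<bar>"
    have g: "\<gamma> > 0" using neg by (simp add: \<gamma>_def)
    have "((\<lambda>s. K * \<bar>s - T\<bar>) \<longlongrightarrow> K * \<bar>T - T\<bar>) F"
      unfolding I(4) by (intro tendsto_intros)
    then have "\<forall>\<^sub>F s in F. K * \<bar>s - T\<bar> < \<gamma> / 2" using g by (intro order_tendstoD) auto
    moreover have "\<exists>\<^sub>F s in F. norm (X s) > max 1 (2 / \<gamma>)" using b unfolding blows_def by blast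
    ultimately have "\<exists>\<^sub>F s in F. norm (X s) > max 1 (2 / \<gamma>) \<and> (K * \<bar>s - T\<bar> < \<gamma> / 2 \<and> s \<in> I)"
      using I(5) by (intro frequently_eventually_frequently eventually_conj)
    then obtain s where s: "norm (X s) > 1" "norm (X s) > 2 / \<gamma>" "K * \<bar>s - T\<bar> < \<gamma> / 2" "s \<in> I"
      using frequently_ex by fastforce
    have "norm (X s) \<le> norm (X s) * norm (X s)"
      using mult_left_mono[of 1 "norm (X s)" "norm (X s)"] s(1) by simp
    then have big: "1 + X s \<bullet> X s > 2 / \<gamma>" "1 + X s \<bullet> X s \<ge> 1"
      using s(2) by (auto simp: dot_square_norm power2_eq_square)
    have "v s \<le> inverse (1 + X s \<bullet> X s) ^ 1"
      unfolding v_def using m big(2) by (intro power_decreasing) (auto simp: inverse_le_1_iff)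
    also have "\<dots> < \<gamma> / 2"
      using less_imp_inverse_less[OF big(1)] g by (simp add: field_simps)
    finally have "v s < \<gamma> / 2" .
    moreover have "v t - v s \<le> K * \<bar>t - s\<bar>" using lip[OF t s(4)] by linarith
    moreover have "K * \<bar>t - s\<bar> \<le> K * (\<bar>t - T\<bar> + \<bar>s - T\<bar>)" using K0 by (intro mult_left_mono) auto
    ultimately have "v t < \<gamma> / 2 + (K * \<bar>t - T\<bar> + \<gamma> / 2)" using s(3) unfolding distrib_left by linarith
    then show False by (simp add: \<gamma>_def)
  qed
  have "((\<lambda>s. K * \<bar>s - T\<bar>) \<longlongrightarrow> K * \<bar>T - T\<bar>) F"
    unfolding I(4) by (intro tendsto_intros)
  moreover have "inverse (1 + (max B 0)\<^sup>2) ^ m > 0"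
    by (intro zero_less_power positive_imp_inverse_positive) (simp add: add_pos_nonneg)
  ultimately have "\<forall>\<^sub>F s in F. K * \<bar>s - T\<bar> < inverse (1 + (max B 0)\<^sup>2) ^ m"
    by (intro order_tendstoD) auto
  with I(5) show ?thesis
  proof eventually_elim
    case (elim t)
    then have "inverse (1 + X t \<bullet> X t) ^ m < inverse (1 + (max B 0)\<^sup>2) ^ m"
      using vle[of t] by (simp add: v_def)
    then have "inverse (1 + X t \<bullet> X t) < inverse (1 + (max B 0)\<^sup>2)"
      by (rule power_less_imp_less_base) simp
    then have "1 + (max B 0)\<^sup>2 < 1 + X t \<bullet> X t"
      by (rule inverse_less_imp_less) (simp add: add_pos_nonneg)
    then have "(max B 0)\<^sup>2 < (norm (X t))\<^sup>2" by (simp add: dot_square_norm)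
    then have "max B 0 < norm (X t)" by (rule power_less_imp_less_base) simp
    then show ?case by simp
  qed
qed

text \<open>On a level set, \<open>h 0 * y\<^sup>m\<^sup>+\<^sup>1\<close> equals a polynomial of degree at most \<open>m\<close> in \<open>y\<close>
  whose coefficients are controlled by \<open>x\<close>.\<close>

lemma ham_level_bounded:
  assumes "h 0 \<noteq> 0"
  obtains A where "\<And>x y. ham m h x y = c \<Longrightarrow> norm x \<le> a \<Longrightarrow> norm y \<le> A"
proof (rule that)
  let ?S = "\<Sum>j\<in>{1..m + 1}. norm (h j) * \<bar>a\<bar> ^ j"
  fix x y assume H: "ham m h x y = c" and x: "norm x \<le> a"
  show "norm y \<le> max 1 ((norm c + ?S) / norm (h 0))"
  proof (cases "norm y \<le> 1")
    case False
    then have y1: "norm y \<ge> 1" by simp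
    have "{..m + 1} = insert 0 {1..m + 1}" by auto
    then have "h 0 * y ^ (m + 1) = c - (\<Sum>j\<in>{1..m + 1}. h j * x ^ j * y ^ (m + 1 - j))"
      using H unfolding ham_def by (simp add: algebra_simps del: power_Suc sum.cl_ivl_Suc)
    then have "norm (h 0) * norm y ^ (m + 1) \<le> norm c + norm (\<Sum>j\<in>{1..m + 1}. h j * x ^ j * y ^ (m + 1 - j))"
      by (metis norm_mult norm_power norm_triangle_ineq4)
    also have "norm (\<Sum>j\<in>{1..m + 1}. h j * x ^ j * y ^ (m + 1 - j)) \<le> (\<Sum>j\<in>{1..m + 1}. norm (h j) * \<bar>a\<bar> ^ j * norm y ^ m)"
      unfolding norm_mult norm_power
      using x y1 by (intro sum_norm_le) (auto simp: norm_mult norm_power intro!: mult_mono power_mono power_increasing)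
    also have "\<dots> = ?S * norm y ^ m" by (rule sum_distrib_right[symmetric])
    also have "norm c \<le> norm c * norm y ^ m" using y1 by (simp add: mult_le_cancel_left1)
    finally have "norm (h 0) * norm y ^ (m + 1) \<le> (norm c + ?S) * norm y ^ m"
      unfolding distrib_right by simp
    then have "norm (h 0) * norm y * norm y ^ m \<le> (norm c + ?S) * norm y ^ m"
      unfolding power_add power_one_right by (simp only: mult_ac)
    then have "norm (h 0) * norm y \<le> norm c + ?S" using y1 zero_less_power[of "norm y" m] by (subst (asm) mult_le_cancel_right) linarith
    then show ?thesis using assms by (simp add: field_simps le_max_iff_disj)
  qed auto
qed

text \<open>Once \<open>|x|\<close> tends to infinity, \<open>z = y/x\<close> has the derivative
  \<open>- (m + 1) u\<^sup>2\<close> by Euler's identity. It is therefore uniformly continuous up to \<open>T\<close> and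
  converges to a single point, although \<open>H\<^sub>1\<close> may have several zeros.\<close>

lemma blows_limit:
  assumes F: "F = at_left T \<or> F = at_right T" and b: "blows m h L F X" and m: "1 \<le> m"
    and h0: "h 0 \<noteq> 0" and L: "L \<subseteq> energy_level m h 1"
  obtains e where "ham1 m h e = 0" "\<forall>\<^sub>F t in F. fst (X t) \<noteq> 0" "((\<lambda>t. uz (X t)) \<longlongrightarrow> (0, e)) F"
proof -
  have sol: "\<forall>\<^sub>F t in F. real_solution m h L t X" using b by (simp add: blows_def)
  have x_large: "\<forall>\<^sub>F t in F. a < norm (fst (X t))" for a
  proof -
    obtain A where A: "\<And>x y. ham m h x y = 1 \<Longrightarrow> norm x \<le> a \<Longrightarrow> norm y \<le> A"
      using ham_level_bounded[of h m 1 a] h0 by metis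
    from sol blows_norm_diverges[OF F b m, of "a + A"] show ?thesis
    proof eventually_elim
      case (elim t)
      then have "ham m h (fst (X t)) (snd (X t)) = 1"
        using L by (auto simp: real_solution_def energy_level_def)
      then show ?case using A elim norm_Pair_le[of "fst (X t)" "snd (X t)"] by fastforce
    qed
  qed
  then have "filterlim (\<lambda>t. fst (X t)) at_infinity F"
    by (subst filterlim_at_infinity[OF order_refl]) (auto intro: eventually_mono less_imp_le)
  then have u0: "((\<lambda>t. 1 / fst (X t)) \<longlongrightarrow> 0) F"
    by (intro tendsto_divide_0[OF tendsto_const])
  obtain I where I: "convex I" "open I" "\<And>t. t \<in> I \<Longrightarrow> real_solution m h L t X \<and> 1 < norm (fst (X t))"
    "F = at T within I" "T \<in> closure I" "F \<noteq> bot" "\<forall>\<^sub>F t in F. t \<in> I"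
    using one_sided_interval[OF F eventually_conj[OF sol x_large[of 1]]] by metis
  have E: "ham m h (fst (X t)) (snd (X t)) = 1" "fst (X t) \<noteq> 0" if "t \<in> I" for t
    using I(3)[OF that] L by (auto simp: real_solution_def energy_level_def)
  define z where "z t = snd (X t) / fst (X t)" for t
  have H1: "ham1 m h (z t) = (1 / fst (X t)) ^ (m + 1)" if "t \<in> I" for t
    using ham_eq_ham1[OF E(2)[OF that], of m h "snd (X t)"] E[OF that]
    unfolding z_def power_divide by (simp add: field_simps)
  have lip: "norm (z s - z t) \<le> real (m + 1) * norm (s - t)" if "s \<in> I" "t \<in> I" for s t
  proof (rule differentiable_bound[OF I(1), where f' = "\<lambda>t x. x *\<^sub>R (- of_nat (m + 1) / (fst (X t))\<^sup>2)"])
    fix t assume t: "t \<in> I"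
    have d: "(X has_vector_derivative ham_field m h (X t)) (at t)"
      using I(3)[OF t] by (simp add: real_solution_def)
    have dx: "((\<lambda>t. fst (X t)) has_vector_derivative fst (ham_field m h (X t))) (at t)"
      and dy: "((\<lambda>t. snd (X t)) has_vector_derivative snd (ham_field m h (X t))) (at t)"
      using bounded_linear.has_vector_derivative[OF bounded_linear_fst d]
        bounded_linear.has_vector_derivative[OF bounded_linear_snd d] by auto
    have "((\<lambda>t. snd (X t) * inverse (fst (X t))) has_vector_derivative
        snd (X t) * (fst (ham_field m h (X t)) * (- (inverse (fst (X t)) ^ Suc (Suc 0))))
        + snd (ham_field m h (X t)) * inverse (fst (X t))) (at t)"
      by (rule has_vector_derivative_mult[OF dy field_vector_diff_chain_at[OF dx DERIV_inverse, unfolded o_def]])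
         (rule E(2)[OF t])
    also have "snd (X t) * (fst (ham_field m h (X t)) * (- (inverse (fst (X t)) ^ Suc (Suc 0))))
        + snd (ham_field m h (X t)) * inverse (fst (X t))
        = - (fst (X t) * ham_dx m h (fst (X t)) (snd (X t)) + snd (X t) * ham_dy m h (fst (X t)) (snd (X t))) / (fst (X t))\<^sup>2"
      using E(2)[OF t] by (simp add: ham_field_eq field_simps power2_eq_square)
    also have "\<dots> = - of_nat (m + 1) / (fst (X t))\<^sup>2"
      unfolding Euler_homogeneous using E(1)[OF t] by simp
    finally show "(z has_derivative (\<lambda>x. x *\<^sub>R (- of_nat (m + 1) / (fst (X t))\<^sup>2))) (at t within I)"
      unfolding z_def divide_inverse[of "snd _"] has_vector_derivative_def by (rule has_derivative_at_withinI)
    show "onorm (\<lambda>x. x *\<^sub>R (- of_nat (m + 1) / (fst (X t))\<^sup>2)) \<le> real (m + 1)"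
    proof (rule onorm_le)
      fix x :: real
      have "1 \<le> norm (fst (X t)) ^ 2" using I(3)[OF t] by (intro one_le_power) auto
      then have "norm (- of_nat (m + 1) / (fst (X t))\<^sup>2) \<le> real (m + 1)"
        unfolding norm_divide norm_minus_cancel norm_of_nat norm_power
        using frac_le[of "real (m + 1)" "real (m + 1)" 1] by simp
      then show "norm (x *\<^sub>R (- of_nat (m + 1) / (fst (X t))\<^sup>2)) \<le> real (m + 1) * norm x"
        by (simp add: mult_left_mono mult.commute del: of_nat_add of_nat_Suc)
    qed
  qed (use that in auto)
  have "uniformly_continuous_on I z"
    unfolding uniformly_continuous_on_def
  proof (intro allI impI)
    fix \<epsilon> :: real assume "\<epsilon> > 0"
    then have "dist (z s) (z t) < \<epsilon>" if "s \<in> I" "t \<in> I" "dist s t < \<epsilon> / real (m + 1)" for s t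
      using lip[OF that(1,2)] that(3) by (simp add: dist_norm field_simps)
    then show "\<exists>d>0. \<forall>x\<in>I. \<forall>x'\<in>I. dist x' x < d \<longrightarrow> dist (z x') (z x) < \<epsilon>"
      using \<open>\<epsilon> > 0\<close> by (intro exI[of _ "\<epsilon> / real (m + 1)"]) auto
  qed
  then obtain e where e: "(z \<longlongrightarrow> e) F"
    using uniformly_continuous_on_extension_at_closure[OF _ I(5)] I(4) by metis
  have "((\<lambda>t. ham1 m h (z t)) \<longlongrightarrow> ham1 m h e) F"
    by (rule isCont_tendsto_compose[OF DERIV_isCont[OF DERIV_ham1] e])
  moreover have "((\<lambda>t. ham1 m h (z t)) \<longlongrightarrow> 0) F"
  proof (rule Lim_transform_eventually)
    show "((\<lambda>t. (1 / fst (X t)) ^ (m + 1)) \<longlongrightarrow> 0) F"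
      using tendsto_power[OF u0, of "m + 1"] by simp
    show "\<forall>\<^sub>F t in F. (1 / fst (X t)) ^ (m + 1) = ham1 m h (z t)"
      using I(7) by eventually_elim (simp add: H1)
  qed
  ultimately have "ham1 m h e = 0" using tendsto_unique[OF I(6)] by blast
  moreover have "\<forall>\<^sub>F t in F. fst (X t) \<noteq> 0" using I(7) by eventually_elim (simp add: E)
  moreover have "((\<lambda>t. uz (X t)) \<longlongrightarrow> (0, e)) F"
    unfolding uz_def using tendsto_Pair[OF u0 e] by (simp add: z_def)
  ultimately show thesis by (rule that)
qed

section \<open>A coordinate in which time is a power\<close>

lemma holomorphic_log_ball:
  assumes "f holomorphic_on ball a r" "\<And>z. z \<in> ball a r \<Longrightarrow> f z \<noteq> 0"
  obtains g where "g holomorphic_on ball a r" "\<And>z. z \<in> ball a r \<Longrightarrow> f z = exp (g z)"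
  using contractible_imp_holomorphic_log[OF assms(1) convex_imp_contractible[OF convex_ball] assms(2)] by metis

text \<open>Factor \<open>f = z\<^sup>n g\<close> with \<open>g\<close> free of zeros. Differentiating gives
  \<open>f' = z\<^sup>n\<^sup>-\<^sup>1 (n g + z g')\<close>, where the bracket does not vanish at \<open>0\<close>; comparison with the
  given derivative yields \<open>n - 1 = k\<close>.\<close>

lemma order_of_zero_from_derivative:
  assumes r: "r > 0" and \<kappa>: "\<kappa> holomorphic_on ball 0 r" "\<kappa> 0 \<noteq> 0" and f0: "f 0 = 0"
    and f': "\<And>z. z \<in> ball 0 r \<Longrightarrow> (f has_field_derivative z ^ k * \<kappa> z) (at z)"
  obtains s g where "0 < s" "s \<le> r" "g holomorphic_on ball 0 s"
    "\<And>z. z \<in> ball 0 s \<Longrightarrow> f z = z ^ Suc k * g z" "\<And>z. z \<in> ball 0 s \<Longrightarrow> g z \<noteq> 0"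
proof -
  have hf: "f holomorphic_on ball 0 r"
    using f' unfolding holomorphic_on_open[OF open_ball] by blast
  have "continuous_on (ball 0 r) \<kappa>" using \<kappa>(1) by (rule holomorphic_on_imp_continuous_on)
  then obtain r1 where r1: "r1 > 0" "r1 \<le> r" "\<And>z. z \<in> ball 0 r1 \<Longrightarrow> \<kappa> z \<noteq> 0"
  proof -
    have "isCont \<kappa> 0" using \<open>continuous_on (ball 0 r) \<kappa>\<close> r by (simp add: continuous_on_eq_continuous_at)
    then obtain d where "d > 0" "\<forall>y. dist 0 y < d \<longrightarrow> \<kappa> y \<noteq> 0"
      using continuous_at_avoid[of 0 \<kappa> 0] \<kappa>(2) by auto
    then show thesis using r by (intro that[of "min d r"]) auto
  qed
  have "\<not> f constant_on ball 0 r"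
  proof
    assume "f constant_on ball 0 r"
    then obtain c where c: "\<And>z. z \<in> ball 0 r \<Longrightarrow> f z = c" unfolding constant_on_def by auto
    define z where "z = complex_of_real (r1 / 2)"
    have z: "z \<in> ball 0 r" "z \<noteq> 0" "z \<in> ball 0 r1" using r1 by (auto simp: z_def)
    have "((\<lambda>_. c) has_field_derivative z ^ k * \<kappa> z) (at z)"
      by (rule has_field_derivative_transform_within_open[OF f'[OF z(1)] open_ball z(1)]) (rule c)
    then have "z ^ k * \<kappa> z = 0" using DERIV_unique DERIV_const by blast
    then show False using z r1(3) by auto
  qed
  then obtain g s n where g: "0 < n" "0 < s" "ball 0 s \<subseteq> ball (0::complex) r" "g holomorphic_on ball 0 s"
    "\<And>w. w \<in> ball 0 s \<Longrightarrow> f w = (w - 0) ^ n * g w" "\<And>w. w \<in> ball 0 s \<Longrightarrow> g w \<noteq> 0"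
    using holomorphic_factor_zero_nonconstant[OF hf open_ball connected_ball _ f0] r by (metis centre_in_ball)
  define k1 where "k1 w = of_nat n * g w + w * deriv g w" for w
  have dg: "(g has_field_derivative deriv g w) (at w)" if "w \<in> ball 0 s" for w
    using g(4) that by (simp add: holomorphic_derivI)
  have eq: "w ^ k * \<kappa> w = w ^ (n - 1) * k1 w" if w: "w \<in> ball 0 s" for w
  proof -
    have "((\<lambda>w. w ^ n * g w) has_field_derivative w ^ (n - 1) * k1 w) (at w)"
    proof -
      have "w ^ n = w ^ (n - 1) * w" using g(1) by (metis power_minus_mult)
      then show ?thesis
        using DERIV_mult[OF DERIV_power[OF DERIV_ident, of n w UNIV] dg[OF w]]
        by (elim DERIV_cong) (simp add: k1_def algebra_simps)
    qed
    moreover have "((\<lambda>w. w ^ n * g w) has_field_derivative w ^ k * \<kappa> w) (at w)"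
      by (rule has_field_derivative_transform_within_open[OF f' open_ball w]) (use w g in auto)
    ultimately show ?thesis using DERIV_unique by blast
  qed
  have k1h: "k1 holomorphic_on ball 0 s"
    unfolding k1_def using g(4) by (intro holomorphic_intros) auto
  have "isCont k1 0"
    using holomorphic_on_imp_continuous_on[OF k1h] g(2) by (simp add: continuous_on_eq_continuous_at)
  moreover have k10: "k1 0 \<noteq> 0" using g(1,2) g(6)[of 0] by (simp add: k1_def)
  ultimately obtain d where d: "d > 0" "\<forall>y. dist 0 y < d \<longrightarrow> k1 y \<noteq> 0"
    using continuous_at_avoid[of 0 k1 0] by auto
  define \<rho> where "\<rho> = min (min d s) r1"
  have \<rho>: "\<rho> > 0" "\<rho> \<le> d" "\<rho> \<le> s" "\<rho> \<le> r1" using d g r1 by (auto simp: \<rho>_def)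
  have "int k = int (n - 1)"
  proof (rule holomorphic_factor_unique[where r = \<rho> and z = 0 and f = "\<lambda>w. w ^ k * \<kappa> w" and g = \<kappa> and h = k1])
    show "\<forall>w\<in>ball 0 \<rho> - {0}. w ^ k * \<kappa> w = \<kappa> w * (w - 0) powi int k \<and> \<kappa> w \<noteq> 0 \<and>
        w ^ k * \<kappa> w = k1 w * (w - 0) powi int (n - 1) \<and> k1 w \<noteq> 0"
    proof (intro ballI conjI)
      fix w :: complex assume w: "w \<in> ball 0 \<rho> - {0}"
      show "w ^ k * \<kappa> w = \<kappa> w * (w - 0) powi int k" by simp
      show "w ^ k * \<kappa> w = k1 w * (w - 0) powi int (n - 1)"
        using eq[of w] w \<rho> unfolding power_int_of_nat by simp
      show "\<kappa> w \<noteq> 0" "k1 w \<noteq> 0" using w \<rho> d(2) r1(3) by auto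
    qed
    show "\<kappa> holomorphic_on ball 0 \<rho>" "k1 holomorphic_on ball 0 \<rho>"
      using \<kappa>(1) k1h \<rho> r1 by (auto elim!: holomorphic_on_subset)
  qed (use \<rho> \<kappa> k10 in auto)
  then have "n = Suc k" using g(1) by simp
  then show thesis
    using g(2-) by (intro that[of s g]) (auto simp: ball_subset_ball_iff)
qed

definition chart_point :: "(complex \<Rightarrow> complex) \<Rightarrow> (complex \<Rightarrow> complex) \<Rightarrow> complex \<Rightarrow> complex \<times> complex" where
  "chart_point U \<zeta> q = (1 / U q, \<zeta> q / U q)"

text \<open>The coordinate \<open>q\<close> on the curve \<open>u\<^sup>m\<^sup>+\<^sup>1 = H\<^sub>1(z)\<close> near \<open>(0, e)\<close>: the point with
  parameter \<open>q\<close> is \<open>(u, z) = (U q, \<zeta> q)\<close>, and \<open>Q\<close> recovers \<open>q\<close> from \<open>u\<close>. The factor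
  \<open>(m - 1) q\<^sup>m\<^sup>-\<^sup>2\<close> in the derivatives is \<open>dt/dq\<close> for \<open>t = q\<^sup>m\<^sup>-\<^sup>1\<close>, so they say that
  \<open>t \<mapsto> chart_point U \<zeta> q\<close> solves the Hamiltonian equation. Writing the units as
  exponentials is what makes the winding numbers computable. By the last assumption the
  parametrisation covers the level \<open>1\<close> near \<open>(0, e)\<close>.\<close>

locale blow_up_chart =
  fixes m :: nat and h :: "nat \<Rightarrow> complex" and e :: complex
    and R :: real and U \<zeta> Q \<alpha> \<beta> :: "complex \<Rightarrow> complex" and \<delta> :: real
  assumes m2: "m \<ge> 2" and R_pos: "R > 0" and \<delta>_pos: "\<delta> > 0"
    and U_hol: "U holomorphic_on ball 0 R" and \<alpha>_cont: "continuous_on (ball 0 R) \<alpha>" and \<beta>_cont: "continuous_on (ball 0 R) \<beta>"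
    and U_eq: "q \<in> ball 0 R \<Longrightarrow> U q = q * exp (\<alpha> q)"
    and \<zeta>_eq: "q \<in> ball 0 R \<Longrightarrow> \<zeta> q = e + q ^ (m + 1) * exp (\<beta> q)"
    and Q_hol: "Q holomorphic_on U ` ball 0 R" and Q_U: "q \<in> ball 0 R \<Longrightarrow> Q (U q) = q"
    and energy: "q \<in> ball 0 R \<Longrightarrow> q \<noteq> 0 \<Longrightarrow> ham m h (1 / U q) (\<zeta> q / U q) = 1"
    and DERIV_fst: "q \<in> ball 0 R \<Longrightarrow> q \<noteq> 0 \<Longrightarrow> ((\<lambda>q. 1 / U q) has_field_derivative
       of_nat (m - 1) * q ^ (m - 2) * fst (ham_field m h (chart_point U \<zeta> q))) (at q)"
    and DERIV_snd: "q \<in> ball 0 R \<Longrightarrow> q \<noteq> 0 \<Longrightarrow> ((\<lambda>q. \<zeta> q / U q) has_field_derivative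
       of_nat (m - 1) * q ^ (m - 2) * snd (ham_field m h (chart_point U \<zeta> q))) (at q)"
    and surj: "ham m h x y = 1 \<Longrightarrow> x \<noteq> 0 \<Longrightarrow> norm (1 / x) < \<delta> \<Longrightarrow> norm (y / x - e) < \<delta> \<Longrightarrow>
       \<exists>q\<in>ball 0 R. q \<noteq> 0 \<and> (x, y) = chart_point U \<zeta> q"

text \<open>Let \<open>g\<close> be the local inverse of \<open>H\<^sub>1\<close> at \<open>e\<close> and \<open>\<tau>\<close> the primitive of
  \<open>- u\<^sup>m\<^sup>-\<^sup>2 / H\<^sub>1'(g (u\<^sup>m\<^sup>+\<^sup>1))\<close> vanishing at \<open>0\<close>, which is time as a function of \<open>u\<close>. It has
  a zero of order \<open>m - 1\<close>, so \<open>\<tau> = Q\<^sup>m\<^sup>-\<^sup>1\<close> with \<open>Q\<close> locally invertible; \<open>U\<close> is the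
  inverse of \<open>Q\<close>, and \<open>\<zeta> = g (U\<^sup>m\<^sup>+\<^sup>1)\<close>.\<close>

lemma blow_up_chart_exists:
  assumes m2: "m \<ge> 2" and e: "ham1 m h e = 0" and e': "deriv (ham1 m h) e \<noteq> 0"
  obtains R U \<zeta> Q \<alpha> \<beta> \<delta> where "blow_up_chart m h e R U \<zeta> Q \<alpha> \<beta> \<delta>"
proof -
  let ?H = "ham1 m h"
  obtain \<epsilon>0 where \<epsilon>0: "\<epsilon>0 > 0" "inj_on ?H (ball e \<epsilon>0)"
    using has_complex_derivative_locally_invertible[OF holomorphic_ham1 UNIV_I open_UNIV e'] by metis
  (* H1 z = (z - e) K z with K free of zeros; this describes z - e as U^(m+1) times a unit *)
  obtain K \<epsilon>1 where K: "0 < \<epsilon>1" "K holomorphic_on ball e \<epsilon>1"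
    "\<And>w. w \<in> ball e \<epsilon>1 \<Longrightarrow> ?H w - ?H e = (w - e) ^ 1 * K w" "\<And>w. w \<in> ball e \<epsilon>1 \<Longrightarrow> K w \<noteq> 0"
    by (rule holomorphic_factor_order_of_zero[OF holomorphic_ham1[of m h UNIV] open_UNIV UNIV_I, of 1 e]) (use e' in auto)
  define \<epsilon> where "\<epsilon> = min \<epsilon>0 \<epsilon>1"
  have \<epsilon>: "\<epsilon> > 0" "ball e \<epsilon> \<subseteq> ball e \<epsilon>0" "ball e \<epsilon> \<subseteq> ball e \<epsilon>1" using \<epsilon>0 K by (auto simp: \<epsilon>_def)
  have inj: "inj_on ?H (ball e \<epsilon>)" using \<epsilon>0(2) \<epsilon>(2) by (rule inj_on_subset)
  obtain k where k: "k holomorphic_on ball e \<epsilon>" "\<And>z. z \<in> ball e \<epsilon> \<Longrightarrow> K z = exp (k z)"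
    using holomorphic_log_ball[of K e \<epsilon>] K \<epsilon> by (metis holomorphic_on_subset subsetD)
  define V where "V = ?H ` ball e \<epsilon>"
  have "open V" unfolding V_def by (rule open_mapping_thm3[OF holomorphic_ham1 open_ball inj])
  have "0 \<in> V" unfolding V_def using e \<epsilon>(1) by (metis centre_in_ball imageI)
  then obtain \<eta> where \<eta>: "\<eta> > 0" "ball 0 \<eta> \<subseteq> V" using \<open>open V\<close> open_contains_ball by blast
  obtain g where g: "g holomorphic_on V" "\<And>z. z \<in> ball e \<epsilon> \<Longrightarrow> deriv ?H z * deriv g (?H z) = 1"
    "\<And>z. z \<in> ball e \<epsilon> \<Longrightarrow> g (?H z) = z"
    using holomorphic_has_inverse[OF holomorphic_ham1 open_ball inj] unfolding V_def by metis
  have gV: "g v \<in> ball e \<epsilon> \<and> ?H (g v) = v \<and> deriv ?H (g v) \<noteq> 0" if "v \<in> V" for v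
    using that g(2,3) unfolding V_def by force
  (* radius at most 1, so that raising to the power m + 1 does not leave the disk of radius \<eta> *)
  define \<rho>1 where "\<rho>1 = min 1 \<eta>"
  have \<rho>1: "\<rho>1 > 0" using \<eta> by (simp add: \<rho>1_def)
  have pV: "u ^ (m + 1) \<in> V" if "u \<in> ball 0 \<rho>1" for u
  proof -
    have "norm u < 1" "norm u < \<eta>" using that by (auto simp: \<rho>1_def)
    moreover have "norm u ^ (m + 1) \<le> norm u ^ 1" using \<open>norm u < 1\<close> by (intro power_decreasing) auto
    ultimately have "norm (u ^ (m + 1)) < \<eta>" unfolding norm_power by simp
    then show ?thesis using \<eta> by (auto simp del: power_Suc)
  qed
  define \<kappa> where "\<kappa> u = - 1 / deriv ?H (g (u ^ (m + 1)))" for u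
  have gm: "(\<lambda>u. g (u ^ (m + 1))) holomorphic_on ball 0 \<rho>1"
  proof -
    have "(g \<circ> (\<lambda>u. u ^ (m + 1))) holomorphic_on ball 0 \<rho>1"
      by (rule holomorphic_on_compose_gen[OF _ g(1)]) (use pV in \<open>auto intro!: holomorphic_intros\<close>)
    then show ?thesis by (simp add: o_def)
  qed
  have "deriv ?H holomorphic_on UNIV" by (intro holomorphic_deriv holomorphic_ham1) auto
  then have "(\<lambda>u. deriv ?H (g (u ^ (m + 1)))) holomorphic_on ball 0 \<rho>1"
    using holomorphic_on_compose_gen[OF gm, of "deriv ?H" UNIV] unfolding o_def by auto
  then have \<kappa>h: "\<kappa> holomorphic_on ball 0 \<rho>1"
    unfolding \<kappa>_def using gV pV by (intro holomorphic_intros) auto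
  have "(\<lambda>u. u ^ (m - 2) * \<kappa> u) holomorphic_on ball 0 \<rho>1" using \<kappa>h by (intro holomorphic_intros)
  then obtain \<tau>0 where \<tau>0: "\<And>x. x \<in> ball 0 \<rho>1 \<Longrightarrow> (\<tau>0 has_field_derivative x ^ (m - 2) * \<kappa> x) (at x within ball 0 \<rho>1)"
    by (rule holomorphic_convex_primitive'[OF convex_ball open_ball]) blast
  define \<tau> where "\<tau> u = \<tau>0 u - \<tau>0 0" for u
  have \<tau>: "(\<tau> has_field_derivative u ^ (m - 2) * \<kappa> u) (at u)" if "u \<in> ball 0 \<rho>1" for u
    unfolding \<tau>_def using \<tau>0[OF that] that at_within_open[OF that open_ball]
    by (auto intro!: derivative_eq_intros)
  have "\<kappa> 0 \<noteq> 0" using gV[OF pV[of 0]] \<rho>1 by (simp add: \<kappa>_def)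
  then obtain \<rho>2 \<sigma> where \<sigma>: "0 < \<rho>2" "\<rho>2 \<le> \<rho>1" "\<sigma> holomorphic_on ball 0 \<rho>2"
    "\<And>z. z \<in> ball 0 \<rho>2 \<Longrightarrow> \<tau> z = z ^ Suc (m - 2) * \<sigma> z" "\<And>z. z \<in> ball 0 \<rho>2 \<Longrightarrow> \<sigma> z \<noteq> 0"
    by (rule order_of_zero_from_derivative[OF \<rho>1 \<kappa>h _ _ \<tau>]) (auto simp: \<tau>_def)
  have Sm: "Suc (m - 2) = m - 1" using m2 by simp
  obtain l where l: "l holomorphic_on ball 0 \<rho>2" "\<And>z. z \<in> ball 0 \<rho>2 \<Longrightarrow> \<sigma> z = exp (l z)"
    using holomorphic_log_ball[OF \<sigma>(3,5)] by metis
  define Q where "Q u = u * exp (l u / of_nat (m - 1))" for u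
  have w0: "of_nat (m - 1) \<noteq> (0 :: complex)" using m2 by simp
  have Q\<tau>: "Q u ^ (m - 1) = \<tau> u" if "u \<in> ball 0 \<rho>2" for u
    using \<sigma>(4)[OF that] l(2)[OF that] w0 unfolding Sm Q_def
    by (simp add: power_mult_distrib flip: exp_of_nat_mult)
  have Qh: "Q holomorphic_on ball 0 \<rho>2"
    unfolding Q_def using l(1) w0 by (intro holomorphic_intros) auto
  have Q0: "Q 0 = 0" by (simp add: Q_def)
  have dl: "(l has_field_derivative deriv l 0) (at 0)" using l(1) \<sigma>(1) by (simp add: holomorphic_derivI)
  have "(Q has_field_derivative exp (l 0 / of_nat (m - 1))) (at 0)"
    unfolding Q_def using w0 by (auto intro!: derivative_eq_intros dl)
  then have "deriv Q 0 \<noteq> 0" by (simp add: DERIV_imp_deriv)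
  then obtain \<rho> where \<rho>: "\<rho> > 0" "ball 0 \<rho> \<subseteq> ball (0 :: complex) \<rho>2" "open (Q ` ball 0 \<rho>)" "inj_on Q (ball 0 \<rho>)"
    using has_complex_derivative_locally_invertible[OF Qh, of 0] \<sigma>(1) by auto
  have Qh\<rho>: "Q holomorphic_on ball 0 \<rho>" using Qh \<rho>(2) by (rule holomorphic_on_subset)
  obtain U where U: "U holomorphic_on Q ` ball 0 \<rho>" "\<And>u. u \<in> ball 0 \<rho> \<Longrightarrow> U (Q u) = u"
    using holomorphic_has_inverse[OF Qh\<rho> open_ball \<rho>(4)] by metis
  have "0 \<in> Q ` ball 0 \<rho>" using Q0 \<rho>(1) by (metis centre_in_ball imageI)
  then obtain R where R: "R > 0" "ball 0 R \<subseteq> Q ` ball 0 \<rho>"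
    using \<rho>(3) open_contains_ball by blast
  have UQ: "U q \<in> ball 0 \<rho>" "Q (U q) = q" if "q \<in> ball 0 R" for q
    using that R(2) U(2) by force+
  have U\<rho>2: "U q \<in> ball 0 \<rho>2" "U q \<in> ball 0 \<rho>1" if "q \<in> ball 0 R" for q
    using UQ(1)[OF that] \<rho>(2) \<sigma>(2) by auto
  have Uh: "U holomorphic_on ball 0 R" using U(1) R(2) by (rule holomorphic_on_subset)
  define \<zeta> where "\<zeta> q = g (U q ^ (m + 1))" for q
  define \<alpha> where "\<alpha> q = - (l (U q) / of_nat (m - 1))" for q
  define \<beta> where "\<beta> q = of_nat (m + 1) * \<alpha> q - k (\<zeta> q)" for q
  have U_eq: "U q = q * exp (\<alpha> q)" if "q \<in> ball 0 R" for q
    using UQ(2)[OF that] unfolding Q_def[of "U q"] \<alpha>_def exp_minus by (simp add: field_simps)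
  have U0: "U q \<noteq> 0" if "q \<in> ball 0 R" "q \<noteq> 0" for q using U_eq that by simp
  have \<zeta>h: "\<zeta> holomorphic_on ball 0 R"
    using holomorphic_on_compose_gen[OF Uh gm] U\<rho>2(2) unfolding o_def \<zeta>_def by blast
  have \<zeta>: "\<zeta> q \<in> ball e \<epsilon>" "?H (\<zeta> q) = U q ^ (m + 1)" "deriv ?H (\<zeta> q) \<noteq> 0" if "q \<in> ball 0 R" for q
    using gV[OF pV[OF U\<rho>2(2)[OF that]]] unfolding \<zeta>_def by blast+
  have "(\<lambda>q. l (U q)) holomorphic_on ball 0 R"
    using holomorphic_on_compose_gen[OF Uh l(1)] U\<rho>2(1) unfolding o_def by blast
  then have \<alpha>h: "\<alpha> holomorphic_on ball 0 R" unfolding \<alpha>_def using w0 by (intro holomorphic_intros) auto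
  have "(\<lambda>q. k (\<zeta> q)) holomorphic_on ball 0 R"
    using holomorphic_on_compose_gen[OF \<zeta>h k(1)] \<zeta>(1) unfolding o_def by blast
  then have \<beta>h: "\<beta> holomorphic_on ball 0 R" unfolding \<beta>_def using \<alpha>h by (intro holomorphic_intros)
  have \<zeta>_eq: "\<zeta> q = e + q ^ (m + 1) * exp (\<beta> q)" if q: "q \<in> ball 0 R" for q
  proof -
    have "?H (\<zeta> q) - ?H e = (\<zeta> q - e) * exp (k (\<zeta> q))"
      using K(3)[of "\<zeta> q"] k(2)[OF \<zeta>(1)[OF q]] \<zeta>(1)[OF q] \<epsilon>(3) by auto
    then have "(\<zeta> q - e) * exp (k (\<zeta> q)) = (q * exp (\<alpha> q)) ^ (m + 1)"
      using \<zeta>(2)[OF q] e U_eq[OF q] by simp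
    also have "\<dots> = q ^ (m + 1) * exp (of_nat (m + 1) * \<alpha> q)"
      unfolding power_mult_distrib exp_of_nat_mult ..
    finally show ?thesis unfolding \<beta>_def exp_diff by (simp add: field_simps)
  qed
  have energy: "ham m h (1 / U q) (\<zeta> q / U q) = 1" if q: "q \<in> ball 0 R" "q \<noteq> 0" for q
    using ham_eq_ham1[of "1 / U q" m h "\<zeta> q / U q"] \<zeta>(2)[OF q(1)] U0[OF q]
    by (simp add: power_divide field_simps)
  have dU: "(U has_field_derivative deriv U q) (at q)" "(\<zeta> has_field_derivative deriv \<zeta> q) (at q)" if "q \<in> ball 0 R" for q
    using Uh \<zeta>h that by (auto intro: holomorphic_derivI)
  (* differentiate \<tau> (U q) = q^(m-1) *)
  have dU_eq: "U q ^ (m - 2) * deriv U q = - (of_nat (m - 1) * q ^ (m - 2) * deriv ?H (\<zeta> q))" if q: "q \<in> ball 0 R" for q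
  proof -
    have "((\<lambda>q. \<tau> (U q)) has_field_derivative U q ^ (m - 2) * \<kappa> (U q) * deriv U q) (at q)"
      by (rule DERIV_chain2[OF \<tau>[OF U\<rho>2(2)[OF q]] dU(1)[OF q]])
    moreover have "((\<lambda>q. \<tau> (U q)) has_field_derivative of_nat (m - 1) * q ^ (m - 2)) (at q)"
    proof (rule has_field_derivative_transform_within_open[OF _ open_ball q])
      show "((\<lambda>q. q ^ (m - 1)) has_field_derivative of_nat (m - 1) * q ^ (m - 2)) (at q)"
        by (auto intro!: derivative_eq_intros simp: numeral_2_eq_2)
      show "z ^ (m - 1) = \<tau> (U z)" if "z \<in> ball 0 R" for z using Q\<tau>[OF U\<rho>2(1)[OF that]] UQ(2)[OF that] by simp
    qed
    ultimately have "U q ^ (m - 2) * \<kappa> (U q) * deriv U q = of_nat (m - 1) * q ^ (m - 2)"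
      using DERIV_unique by blast
    moreover have "\<kappa> (U q) * deriv ?H (\<zeta> q) = - 1" using \<zeta>(3)[OF q] unfolding \<kappa>_def \<zeta>_def by simp
    moreover have "U q ^ (m - 2) * \<kappa> (U q) * deriv U q * deriv ?H (\<zeta> q)
        = U q ^ (m - 2) * deriv U q * (\<kappa> (U q) * deriv ?H (\<zeta> q))" by (simp only: mult_ac)
    ultimately show ?thesis by simp
  qed
  (* differentiate H1 (\<zeta> q) = U(q)^(m+1) *)
  have d\<zeta>_eq: "deriv ?H (\<zeta> q) * deriv \<zeta> q = of_nat (m + 1) * U q ^ m * deriv U q" if q: "q \<in> ball 0 R" for q
  proof -
    have "((\<lambda>q. ?H (\<zeta> q)) has_field_derivative deriv ?H (\<zeta> q) * deriv \<zeta> q) (at q)"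
      using DERIV_chain2[OF DERIV_ham1 dU(2)[OF q]] by (simp add: deriv_ham1)
    moreover have "((\<lambda>q. ?H (\<zeta> q)) has_field_derivative of_nat (m + 1) * U q ^ m * deriv U q) (at q)"
    proof (rule has_field_derivative_transform_within_open[OF _ open_ball q])
      show "((\<lambda>q. U q ^ (m + 1)) has_field_derivative of_nat (m + 1) * U q ^ m * deriv U q) (at q)"
        using DERIV_power[OF dU(1)[OF q], of "m + 1"] by (rule DERIV_cong) (simp add: mult_ac)
      show "U z ^ (m + 1) = ?H (\<zeta> z)" if "z \<in> ball 0 R" for z using \<zeta>(2)[OF that] by simp
    qed
    ultimately show ?thesis using DERIV_unique by blast
  qed
  define A where "A q = of_nat (m - 1) * q ^ (m - 2)" for q :: complex
  have f1: "fst (ham_field m h (chart_point U \<zeta> q)) * U q ^ m = deriv ?H (\<zeta> q)"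
    and f2: "snd (ham_field m h (chart_point U \<zeta> q)) * U q ^ m = - (of_nat (m + 1) * U q ^ (m + 1)) + \<zeta> q * deriv ?H (\<zeta> q)"
    if q: "q \<in> ball 0 R" "q \<noteq> 0" for q
  proof -
    have "ham_dy m h (1 / U q) (\<zeta> q / U q) = (1 / U q) ^ m * deriv ?H (\<zeta> q)"
      using ham_dy_eq_ham1[of "1 / U q" m h "\<zeta> q / U q"] U0[OF q] by (simp add: deriv_ham1)
    then show a: "fst (ham_field m h (chart_point U \<zeta> q)) * U q ^ m = deriv ?H (\<zeta> q)"
      using U0[OF q] by (simp add: ham_field_eq chart_point_def power_divide)
    have "(1 / U q) * ham_dx m h (1 / U q) (\<zeta> q / U q) + (\<zeta> q / U q) * ham_dy m h (1 / U q) (\<zeta> q / U q) = of_nat (m + 1)"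
      using Euler_homogeneous[of "1 / U q" m h "\<zeta> q / U q"] energy[OF q] by simp
    then have b: "ham_dx m h (1 / U q) (\<zeta> q / U q) = of_nat (m + 1) * U q - \<zeta> q * ham_dy m h (1 / U q) (\<zeta> q / U q)"
      using U0[OF q] by (simp add: field_simps del: of_nat_add of_nat_Suc)
    show "snd (ham_field m h (chart_point U \<zeta> q)) * U q ^ m = - (of_nat (m + 1) * U q ^ (m + 1)) + \<zeta> q * deriv ?H (\<zeta> q)"
      unfolding a[symmetric]
      by (simp add: ham_field_eq chart_point_def b algebra_simps)
  qed
  have Um: "U q ^ m = U q ^ (m - 2) * (U q)\<^sup>2" for q
    using power_add[of "U q" "m - 2" 2] m2 by (metis le_add_diff_inverse2)
  have cancel: "X = Y / s" if "Y * p = X * p * s" "p \<noteq> 0" "s \<noteq> 0" for X Y p s :: complex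
  proof -
    have "Y * p = X * s * p" using that(1) by (simp only: mult_ac)
    then show ?thesis using that(2,3) by (simp add: eq_divide_eq)
  qed
  have "isCont Q 0"
    using holomorphic_on_imp_continuous_on[OF Qh\<rho>] \<rho>(1) by (simp add: continuous_on_eq_continuous_at)
  then obtain d where d: "d > 0" "\<And>u. dist u 0 < d \<Longrightarrow> dist (Q u) (Q 0) < R"
    using R(1) unfolding continuous_at_eps_delta dist_norm by blast
  have "blow_up_chart m h e R U \<zeta> Q \<alpha> \<beta> (min (min d \<rho>) \<epsilon>)"
  proof (rule blow_up_chart.intro)
    show "m \<ge> 2" by fact
    show "R > 0" by fact
    show "min (min d \<rho>) \<epsilon> > 0" using d \<rho> \<epsilon> by simp
    show "U holomorphic_on ball 0 R" by fact
    show "continuous_on (ball 0 R) \<alpha>" "continuous_on (ball 0 R) \<beta>"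
      using \<alpha>h \<beta>h by (auto intro: holomorphic_on_imp_continuous_on)
    have "U ` ball 0 R \<subseteq> ball 0 \<rho>" using UQ(1) by blast
    then show "Q holomorphic_on U ` ball 0 R" by (rule holomorphic_on_subset[OF Qh\<rho>])
    show "\<exists>q\<in>ball 0 R. q \<noteq> 0 \<and> (x, y) = chart_point U \<zeta> q"
      if H: "ham m h x y = 1" and x: "x \<noteq> 0" "norm (1 / x) < min (min d \<rho>) \<epsilon>" and y: "norm (y / x - e) < min (min d \<rho>) \<epsilon>" for x y
    proof -
      let ?u = "1 / x"
      have u: "?u \<in> ball 0 \<rho>" using x by simp
      have q: "Q ?u \<in> ball 0 R" using d(2)[of ?u] x Q0 by (simp add: dist_norm norm_minus_commute)
      have Hz: "?H (y / x) = ?u ^ (m + 1)"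
        using ham_eq_ham1[OF x(1), of m h y] H x(1) unfolding power_divide by (simp add: field_simps)
      have "y / x \<in> ball e \<epsilon>" using y by (simp add: dist_norm norm_minus_commute)
      then have "\<zeta> (Q ?u) = y / x" unfolding \<zeta>_def U(2)[OF u] Hz[symmetric] by (rule g(3))
      then show ?thesis using q x U(2)[OF u] Q0
        by (intro bexI[of _ "Q ?u"]) (auto simp: chart_point_def Q_def)
    qed
    fix q :: complex assume q: "q \<in> ball 0 R"
    show "U q = q * exp (\<alpha> q)" "\<zeta> q = e + q ^ (m + 1) * exp (\<beta> q)" "Q (U q) = q"
      using U_eq \<zeta>_eq UQ(2) q by auto
    assume q0: "q \<noteq> 0"
    show "ham m h (1 / U q) (\<zeta> q / U q) = 1" by (rule energy[OF q q0])
    note dq = dU_eq[OF q, folded A_def] and fq = f1[OF q q0] f2[OF q q0] and u0 = U0[OF q q0]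
    have "- deriv U q * U q ^ m = A q * fst (ham_field m h (chart_point U \<zeta> q)) * U q ^ m * (U q)\<^sup>2"
    proof -
      have "- deriv U q * U q ^ m = - (U q ^ (m - 2) * deriv U q) * (U q)\<^sup>2"
        unfolding Um by (simp add: mult_ac)
      also have "\<dots> = A q * deriv ?H (\<zeta> q) * (U q)\<^sup>2" unfolding dq by simp
      finally show ?thesis unfolding fq(1)[symmetric] by (simp only: mult_ac)
    qed
    then have 1: "A q * fst (ham_field m h (chart_point U \<zeta> q)) = - deriv U q / (U q)\<^sup>2"
      by (rule cancel) (use u0 in auto)
    show "((\<lambda>q. 1 / U q) has_field_derivative of_nat (m - 1) * q ^ (m - 2) * fst (ham_field m h (chart_point U \<zeta> q))) (at q)"
      unfolding A_def[symmetric] 1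
      using DERIV_divide[OF DERIV_const dU(1)[OF q] u0] by (rule DERIV_cong) (simp add: power2_eq_square)
    have "deriv ?H (\<zeta> q) * (U q ^ (m - 2) * deriv \<zeta> q) = deriv ?H (\<zeta> q) * (- of_nat (m + 1) * U q ^ m * A q)"
    proof -
      have "deriv ?H (\<zeta> q) * (U q ^ (m - 2) * deriv \<zeta> q) = U q ^ (m - 2) * (deriv ?H (\<zeta> q) * deriv \<zeta> q)" by simp
      also have "\<dots> = of_nat (m + 1) * U q ^ m * (U q ^ (m - 2) * deriv U q)"
        unfolding d\<zeta>_eq[OF q] by (simp add: mult_ac del: of_nat_add)
      also have "\<dots> = deriv ?H (\<zeta> q) * (- of_nat (m + 1) * U q ^ m * A q)" unfolding dq by (simp add: algebra_simps)
      finally show ?thesis .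
    qed
    then have z: "U q ^ (m - 2) * deriv \<zeta> q = - of_nat (m + 1) * U q ^ m * A q"
      using mult_left_cancel[OF \<zeta>(3)[OF q]] by blast
    have "(deriv \<zeta> q * U q - \<zeta> q * deriv U q) * U q ^ (m - 2) = (A q * snd (ham_field m h (chart_point U \<zeta> q))) * U q ^ m"
    proof -
      have "(deriv \<zeta> q * U q - \<zeta> q * deriv U q) * U q ^ (m - 2) = U q * (U q ^ (m - 2) * deriv \<zeta> q) - \<zeta> q * (U q ^ (m - 2) * deriv U q)"
        by (simp add: algebra_simps)
      also have "\<dots> = A q * (- (of_nat (m + 1) * U q ^ (m + 1)) + \<zeta> q * deriv ?H (\<zeta> q))"
        unfolding z dq by (simp add: algebra_simps)
      also have "\<dots> = (A q * snd (ham_field m h (chart_point U \<zeta> q))) * U q ^ m"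
        unfolding fq(2)[symmetric] by (simp only: mult.assoc)
      finally show ?thesis .
    qed
    then have "(deriv \<zeta> q * U q - \<zeta> q * deriv U q) * U q ^ (m - 2)
        = (A q * snd (ham_field m h (chart_point U \<zeta> q))) * U q ^ (m - 2) * (U q)\<^sup>2"
      unfolding Um by (simp only: mult.assoc)
    then have 2: "A q * snd (ham_field m h (chart_point U \<zeta> q)) = (deriv \<zeta> q * U q - \<zeta> q * deriv U q) / (U q)\<^sup>2"
      by (rule cancel) (use u0 in auto)
    show "((\<lambda>q. \<zeta> q / U q) has_field_derivative of_nat (m - 1) * q ^ (m - 2) * snd (ham_field m h (chart_point U \<zeta> q))) (at q)"
      unfolding A_def[symmetric] 2
      using DERIV_divide[OF dU(2)[OF q] dU(1)[OF q] u0] by (rule DERIV_cong) (simp add: power2_eq_square)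
  qed
  then show thesis by (rule that)
qed

section \<open>Continuation of solutions as path lifting\<close>

lemma continued_along_cong:
  assumes c: "continued_along m h g Y" and eq: "\<And>s. s \<in> {0..1} \<Longrightarrow> g s = g' s \<and> Y s = Y' s"
  shows "continued_along m h g' Y'"
  unfolding continued_along_def
proof (intro conjI ballI)
  show "path g'"
    using c eq continuous_on_cong[of "{0..1}" "{0..1}" g g'] unfolding continued_along_def path_def by auto
  fix s :: real assume "s \<in> {0..1}"
  then show "\<exists>D \<Phi> \<delta>. open D \<and> complex_solution m h D \<Phi> \<and> \<delta> > 0 \<and>
        (\<forall>s'\<in>{0..1}. \<bar>s' - s\<bar> < \<delta> \<longrightarrow> g' s' \<in> D \<and> Y' s' = \<Phi> (g' s'))"
    using c eq unfolding continued_along_def by metis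
qed

context blow_up_chart
begin

text \<open>The logarithmic coordinate \<open>l\<close>, with \<open>q = exp l\<close>, lives on the universal cover of the
  punctured disk. There \<open>time\<close> is the elapsed time \<open>t - T\<close>, and \<open>sol\<close> is a single-valued
  parametrisation of the multi-valued solution.\<close>

definition time :: "complex \<Rightarrow> complex" where "time l = exp (of_nat (m - 1) * l)"
definition sol :: "complex \<Rightarrow> complex \<times> complex" where "sol l = chart_point U \<zeta> (exp l)"

lemma w_pos: "m - 1 > 0" "of_nat (m - 1) \<noteq> (0 :: complex)"
  using m2 by auto

lemma time_eq_power: "time l = exp l ^ (m - 1)"
  by (simp add: time_def exp_of_nat_mult)

lemma norm_time: "norm (time l) = norm (exp l) ^ (m - 1)"
  by (simp add: time_eq_power norm_power)

lemma time_nonzero: "time l \<noteq> 0" by (simp add: time_def)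

lemma norm_exp_less:
  assumes "norm (time l) < R ^ (m - 1)" shows "norm (exp l) < R"
  using assms[unfolded norm_time] by (rule power_less_imp_less_base) (use R_pos in simp)

lemma norm_time_less: "norm (exp l) < R \<Longrightarrow> norm (time l) < R ^ (m - 1)"
  unfolding norm_time using w_pos by (intro power_strict_mono norm_ge_zero)

lemma U_0: "U 0 = 0" using U_eq[of 0] R_pos by simp

lemma U_nonzero: "norm q < R \<Longrightarrow> q \<noteq> 0 \<Longrightarrow> U q \<noteq> 0"
  using U_eq[of q] by simp

lemma U_inj: "norm q < R \<Longrightarrow> norm q' < R \<Longrightarrow> U q = U q' \<Longrightarrow> q = q'"
  using Q_U[of q] Q_U[of q'] by (metis dist_0_norm mem_ball)

lemma fst_sol_nonzero: "norm (exp l) < R \<Longrightarrow> fst (sol l) \<noteq> 0"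
  using U_nonzero[of "exp l"] by (simp add: sol_def chart_point_def)

lemma uz_sol: "norm (exp l) < R \<Longrightarrow> uz (sol l) = (U (exp l), \<zeta> (exp l))"
  using U_nonzero[of "exp l"] by (simp add: sol_def chart_point_def uz_def)

lemma DERIV_sol:
  assumes "norm (exp l) < R"
  shows "((\<lambda>l. fst (sol l)) has_field_derivative of_nat (m - 1) * time l * fst (ham_field m h (sol l))) (at l)"
    and "((\<lambda>l. snd (sol l)) has_field_derivative of_nat (m - 1) * time l * snd (ham_field m h (sol l))) (at l)"
proof -
  have "m - 1 = Suc (m - 2)" using m2 by simp
  then have t: "exp l ^ (m - 2) * exp l = time l" unfolding time_eq_power by simp
  have q: "exp l \<in> ball 0 R" "exp l \<noteq> 0" using assms by auto
  have "of_nat (m - 1) * exp l ^ (m - 2) * f * exp l = of_nat (m - 1) * time l * f" for f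
    unfolding t[symmetric] by (simp only: mult_ac)
  note a = this
  show "((\<lambda>l. fst (sol l)) has_field_derivative of_nat (m - 1) * time l * fst (ham_field m h (sol l))) (at l)"
    using DERIV_chain2[OF DERIV_fst[OF q] DERIV_exp[of l]] unfolding a
    by (simp only: sol_def chart_point_def fst_conv)
  show "((\<lambda>l. snd (sol l)) has_field_derivative of_nat (m - 1) * time l * snd (ham_field m h (sol l))) (at l)"
    using DERIV_chain2[OF DERIV_snd[OF q] DERIV_exp[of l]] unfolding a
    by (simp only: sol_def chart_point_def snd_conv)
qed

lemma open_half_plane: "open {l :: complex. norm (exp l) < R}"
  by (intro open_Collect_less continuous_intros)

text \<open>Locally \<open>l = l\<^sub>0 + Ln ((t - T) / time l\<^sub>0) / (m - 1)\<close> inverts \<open>t = T + time l\<close>. Dividing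
  by \<open>time l\<^sub>0\<close> moves the argument near \<open>1\<close>, away from the branch cut of \<open>Ln\<close>.\<close>

lemma local_solution:
  assumes l0: "norm (exp l0) < R"
  obtains D where "open D" "T + time l0 \<in> D"
    "complex_solution m h D (\<lambda>t. sol (l0 + Ln ((t - T) / time l0) / of_nat (m - 1)))"
proof -
  define \<Lambda> where "\<Lambda> t = l0 + Ln ((t - T) / time l0) / of_nat (m - 1)" for t
  define D0 where "D0 = ball (T + time l0) (norm (time l0))"
  have re: "(t - T) / time l0 \<notin> \<real>\<^sub>\<le>\<^sub>0" if "t \<in> D0" for t
  proof -
    have "(t - T) / time l0 - 1 = (t - (T + time l0)) / time l0"
      using time_nonzero[of l0] by (simp add: field_simps)
    then have "norm ((t - T) / time l0 - 1) < 1"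
      using that time_nonzero[of l0] by (simp add: D0_def norm_divide dist_norm norm_minus_commute)
    then have "0 < Re ((t - T) / time l0)"
      using abs_Re_le_cmod[of "(t - T) / time l0 - 1"] by (simp add: abs_if split: if_splits)
    then show ?thesis by (auto simp: complex_nonpos_Reals_iff)
  qed
  have d\<Lambda>: "(\<Lambda> has_field_derivative 1 / (of_nat (m - 1) * (t - T))) (at t)" if "t \<in> D0" for t
  proof -
    have nz: "t - T \<noteq> 0" using re[OF that] by auto
    have "((\<lambda>t. (t - T) / time l0) has_field_derivative 1 / time l0) (at t)"
      using time_nonzero[of l0] by (auto intro!: derivative_eq_intros)
    then have "((\<lambda>t. Ln ((t - T) / time l0)) has_field_derivative inverse ((t - T) / time l0) * (1 / time l0)) (at t)"
      by (rule DERIV_chain2[where f = Ln and g = "\<lambda>t. (t - T) / time l0", OF has_field_derivative_Ln[OF re[OF that]]])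
    then have "(\<Lambda> has_field_derivative 0 + inverse ((t - T) / time l0) * (1 / time l0) / of_nat (m - 1)) (at t)"
      unfolding \<Lambda>_def by (intro DERIV_add DERIV_const DERIV_cdivide)
    then show ?thesis by (rule DERIV_cong) (use nz time_nonzero[of l0] in \<open>simp add: field_simps\<close>)
  qed
  have "continuous_on D0 \<Lambda>"
    by (intro continuous_at_imp_continuous_on ballI) (rule DERIV_isCont[OF d\<Lambda>])
  then have "open (D0 \<inter> \<Lambda> -` {l. norm (exp l) < R})"
    using open_half_plane by (intro continuous_open_preimage) (auto simp: D0_def)
  moreover have "T + time l0 \<in> D0 \<inter> \<Lambda> -` {l. norm (exp l) < R}"
    using l0 time_nonzero[of l0] by (auto simp: D0_def \<Lambda>_def)
  moreover have "complex_solution m h (D0 \<inter> \<Lambda> -` {l. norm (exp l) < R}) (\<lambda>t. sol (\<Lambda> t))"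
    unfolding complex_solution_def
  proof
    fix t assume t: "t \<in> D0 \<inter> \<Lambda> -` {l. norm (exp l) < R}"
    then have nz: "t - T \<noteq> 0" using re[of t] by auto
    have "of_nat (m - 1) * \<Lambda> t = of_nat (m - 1) * l0 + Ln ((t - T) / time l0)"
      using w_pos by (simp add: \<Lambda>_def field_simps)
    then have tm: "time (\<Lambda> t) = t - T"
      using nz time_nonzero[of l0] by (simp add: time_def exp_add)
    have c: "of_nat (m - 1) * (t - T) * f * (1 / (of_nat (m - 1) * (t - T))) = f" for f
      using nz w_pos by simp
    show "((\<lambda>t. fst (sol (\<Lambda> t))) has_field_derivative fst (ham_field m h (sol (\<Lambda> t)))) (at t) \<and>
      ((\<lambda>t. snd (sol (\<Lambda> t))) has_field_derivative snd (ham_field m h (sol (\<Lambda> t)))) (at t)"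
    proof -
      have t': "norm (exp (\<Lambda> t)) < R" "t \<in> D0" using t by auto
      show ?thesis
        using DERIV_chain2[where g = \<Lambda>, OF DERIV_sol(1)[OF t'(1)] d\<Lambda>[OF t'(2)]]
          DERIV_chain2[where g = \<Lambda>, OF DERIV_sol(2)[OF t'(1)] d\<Lambda>[OF t'(2)]]
        unfolding tm c by blast
    qed
  qed
  ultimately show thesis unfolding \<Lambda>_def by (rule that)
qed

text \<open>Near a parameter \<open>s\<close> the continuation is given by the branch of the logarithm based at
  \<open>l s\<close>, which follows the path \<open>l\<close> as long as the argument changes by less than \<open>\<pi>\<close>.\<close>

lemma continued_along_lift:
  assumes l: "path l" and R: "\<And>s. s \<in> {0..1} \<Longrightarrow> norm (exp (l s)) < R"
  shows "continued_along m h (\<lambda>s. T + time (l s)) (\<lambda>s. sol (l s))"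
  unfolding continued_along_def
proof (intro conjI ballI)
  have cl: "continuous_on {0..1} l" using l by (simp add: path_def)
  have cg: "continuous_on {0..1} (\<lambda>s. T + time (l s))" unfolding time_def by (intro continuous_intros cl)
  then show "path (\<lambda>s. T + time (l s))" by (simp add: path_def)
  fix s :: real assume s: "s \<in> {0..1}"
  obtain D where D: "open D" "T + time (l s) \<in> D"
    "complex_solution m h D (\<lambda>t. sol (l s + Ln ((t - T) / time (l s)) / of_nat (m - 1)))"
    using local_solution[OF R[OF s]] by metis
  obtain \<epsilon> where \<epsilon>: "\<epsilon> > 0" "ball (T + time (l s)) \<epsilon> \<subseteq> D" using D(1,2) open_contains_ball by blast
  obtain \<delta>1 where \<delta>1: "\<delta>1 > 0" "\<And>s'. s' \<in> {0..1} \<Longrightarrow> \<bar>s' - s\<bar> < \<delta>1 \<Longrightarrow> dist (T + time (l s')) (T + time (l s)) < \<epsilon>"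
    using cg s \<epsilon>(1) unfolding continuous_on_iff dist_real_def by metis
  (* the principal logarithm recovers (m - 1) (l s' - l s) as long as its imaginary part is below \<pi> *)
  have "pi / real (m - 1) > 0" using w_pos by simp
  then obtain \<delta>2 where \<delta>2: "\<delta>2 > 0" "\<And>s'. s' \<in> {0..1} \<Longrightarrow> \<bar>s' - s\<bar> < \<delta>2 \<Longrightarrow> dist (l s') (l s) < pi / real (m - 1)"
    using cl s unfolding continuous_on_iff dist_real_def by metis
  have "sol (l s') = sol (l s + Ln ((T + time (l s') - T) / time (l s)) / of_nat (m - 1))"
    if s': "s' \<in> {0..1}" "\<bar>s' - s\<bar> < \<delta>2" for s'
  proof -
    let ?d = "of_nat (m - 1) * (l s' - l s)"
    have "norm ?d = real (m - 1) * norm (l s' - l s)" unfolding norm_mult norm_of_nat ..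
    also have "\<dots> < pi" using \<delta>2(2)[OF s'] w_pos by (simp add: dist_norm field_simps)
    finally have "\<bar>Im ?d\<bar> < pi" using abs_Im_le_cmod[of ?d] by linarith
    then have "Ln (exp ?d) = ?d" by (intro Ln_exp) (simp_all only: abs_less_iff, linarith+)
    moreover have "(T + time (l s') - T) / time (l s) = exp ?d"
      unfolding time_def right_diff_distrib exp_diff by simp
    ultimately show ?thesis using w_pos by simp
  qed
  then show "\<exists>D \<Phi> \<delta>. open D \<and> complex_solution m h D \<Phi> \<and> \<delta> > 0 \<and>
        (\<forall>s'\<in>{0..1}. \<bar>s' - s\<bar> < \<delta> \<longrightarrow> T + time (l s') \<in> D \<and> sol (l s') = \<Phi> (T + time (l s')))"
  proof (intro exI[of _ D] exI[of _ "\<lambda>t. sol (l s + Ln ((t - T) / time (l s)) / of_nat (m - 1))"]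
      exI[of _ "min \<delta>1 \<delta>2"] conjI ballI impI)
    fix s' assume s': "s' \<in> {0..1}" "\<bar>s' - s\<bar> < min \<delta>1 \<delta>2"
    then show "T + time (l s') \<in> D" using \<delta>1(2)[of s'] \<epsilon>(2) by (auto simp: dist_commute)
  qed (use D \<delta>1 \<delta>2 in auto)
qed

text \<open>A continuous logarithm of \<open>g - T\<close>, which increases by \<open>2 \<pi> i\<close> times the winding
  number, divided by \<open>m - 1\<close> and translated so as to start at \<open>l\<^sub>0\<close>.\<close>

lemma time_path_lift:
  assumes g: "path g" "T \<notin> path_image g" and l0: "g 0 = T + time l0"
  obtains l where "path l" "l 0 = l0" "\<And>s. s \<in> {0..1} \<Longrightarrow> g s = T + time (l s)"
    "l 1 - l 0 = 2 * of_real pi * \<i> * winding_number g T / of_nat (m - 1)"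
proof -
  obtain k where k: "path k" "pathfinish k - pathstart k = 2 * of_real pi * \<i> * winding_number g T"
    "\<And>t. t \<in> {0..1} \<Longrightarrow> g t = T + exp (k t)"
    using winding_number_as_continuous_log[OF g] by metis
  define l where "l s = (k s - k 0) / of_nat (m - 1) + l0" for s
  show thesis
  proof (rule that)
    show "path l" using k(1) unfolding path_def l_def using w_pos by (intro continuous_intros) auto
    show "l 0 = l0" by (simp add: l_def)
    show "l 1 - l 0 = 2 * of_real pi * \<i> * winding_number g T / of_nat (m - 1)"
      unfolding k(2)[symmetric] by (simp add: l_def pathfinish_def pathstart_def)
    fix s :: real assume s: "s \<in> {0..1}"
    have "of_nat (m - 1) * l s = k s - k 0 + of_nat (m - 1) * l0" using w_pos by (simp add: l_def field_simps)
    then have "time (l s) = exp (k s) / exp (k 0) * time l0" by (simp add: time_def exp_add exp_diff)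
    also have "time l0 = exp (k 0)" using l0 k(3)[of 0] by simp
    finally show "g s = T + time (l s)" using k(3)[OF s] by simp
  qed
qed

lemma continued_along_imp_lift:
  assumes c: "continued_along m h g Y" and g: "path_image g \<subseteq> ball T r - {T}" and r: "r \<le> R ^ (m - 1)"
    and 0: "g 0 = T + time l0" "Y 0 = sol l0"
  obtains l where "path l" "l 0 = l0"
    "\<And>s. s \<in> {0..1} \<Longrightarrow> g s = T + time (l s) \<and> Y s = sol (l s) \<and> norm (time (l s)) < r"
    "l 1 - l 0 = 2 * of_real pi * \<i> * winding_number g T / of_nat (m - 1)"
proof -
  have "path g" "T \<notin> path_image g" using c g by (auto simp: continued_along_def)
  then obtain l where l: "path l" "l 0 = l0" "\<And>s. s \<in> {0..1} \<Longrightarrow> g s = T + time (l s)"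
    "l 1 - l 0 = 2 * of_real pi * \<i> * winding_number g T / of_nat (m - 1)"
    using time_path_lift[where g = g and T = T and ?l0.0 = l0] 0(1) by metis
  have tr: "norm (time (l s)) < r" if "s \<in> {0..1}" for s
  proof -
    have "g s \<in> ball T r" using g that unfolding path_image_def by blast
    then show ?thesis using l(3)[OF that] by (simp add: dist_norm)
  qed
  have "continued_along m h (\<lambda>s. T + time (l s)) (\<lambda>s. sol (l s))"
    by (rule continued_along_lift[OF l(1)]) (use tr r norm_exp_less in fastforce)
  then have "continued_along m h g (\<lambda>s. sol (l s))"
    by (rule continued_along_cong) (use l(3) in auto)
  then have "Y s = sol (l s)" if "s \<in> {0..1}" for s
    using continued_along_unique[OF c, of "\<lambda>s. sol (l s)" s] 0(2) l(2) that by simp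
  then show thesis using l tr by (intro that[of l]) auto
qed

end

section \<open>The local leaf is a punctured disk\<close>

locale blow_up_solution = blow_up_chart +
  fixes L :: "(complex \<times> complex) set" and X :: "real \<Rightarrow> complex \<times> complex" and T :: real and F :: "real filter"
  assumes one_sided: "F = at_left T \<or> F = at_right T"
    and leaf: "is_leaf m h L" and level: "L \<subseteq> energy_level m h 1"
    and solution: "\<forall>\<^sub>F t in F. real_solution m h L t X"
    and fst_nonzero: "\<forall>\<^sub>F t in F. fst (X t) \<noteq> 0"
    and limit: "((\<lambda>t. uz (X t)) \<longlongrightarrow> (0, e)) F"
begin

lemma F_nontrivial: "F \<noteq> bot"
  using one_sided by (metis trivial_limit_at_left_real trivial_limit_at_right_real)

lemma U_image_open: "open (U ` ball 0 R)"
proof (rule open_mapping_thm3[OF U_hol open_ball])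
  show "inj_on U (ball 0 R)" using Q_U by (metis inj_onI)
qed

text \<open>The solution enters the domain of the chart because its \<open>(u, z)\<close> tends to \<open>(0, e)\<close>.
  In the coordinate \<open>q\<close> its velocity satisfies \<open>(m - 1) q\<^sup>m\<^sup>-\<^sup>2 q' = 1\<close>, since the field does
  not vanish on the energy level. So \<open>q\<^sup>m\<^sup>-\<^sup>1 - t\<close> is constant, and the constant is
  \<open>- T\<close> as \<open>q\<close> tends to \<open>0\<close>.\<close>

lemma solution_in_chart: "\<forall>\<^sub>F t in F. \<exists>l. norm (exp l) < R \<and> X t = sol l \<and> of_real t = of_real T + time l"
proof -
  have lim: "((\<lambda>t. 1 / fst (X t)) \<longlongrightarrow> 0) F" "((\<lambda>t. snd (X t) / fst (X t)) \<longlongrightarrow> e) F"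
    using tendsto_fst[OF limit] tendsto_snd[OF limit] by (auto simp: uz_def)
  have near: "\<forall>\<^sub>F t in F. dist (1 / fst (X t)) 0 < \<delta>" "\<forall>\<^sub>F t in F. dist (snd (X t) / fst (X t)) e < \<delta>"
    using tendstoD[OF lim(1) \<delta>_pos] tendstoD[OF lim(2) \<delta>_pos] by auto
  have "\<forall>\<^sub>F t in F. real_solution m h L t X \<and> fst (X t) \<noteq> 0 \<and> dist (1 / fst (X t)) 0 < \<delta> \<and> dist (snd (X t) / fst (X t)) e < \<delta>"
    using solution fst_nonzero near by eventually_elim auto
  from one_sided_interval[OF one_sided this] obtain I where I: "convex I" "open I"
    "\<And>t. t \<in> I \<Longrightarrow> real_solution m h L t X \<and> fst (X t) \<noteq> 0 \<and> dist (1 / fst (X t)) 0 < \<delta> \<and> dist (snd (X t) / fst (X t)) e < \<delta>"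
    "F = at T within I" "\<forall>\<^sub>F t in F. t \<in> I" by metis
  define q where "q t = Q (1 / fst (X t))" for t
  have E: "ham m h (fst (X t)) (snd (X t)) = 1" if "t \<in> I" for t
    using I(3)[OF that] level by (auto simp: real_solution_def energy_level_def)
  have q: "norm (q t) < R" "q t \<noteq> 0" "X t = chart_point U \<zeta> (q t)" if t: "t \<in> I" for t
  proof -
    obtain p where p: "p \<in> ball 0 R" "p \<noteq> 0" "(fst (X t), snd (X t)) = chart_point U \<zeta> p"
      using surj[OF E[OF t]] I(3)[OF t] by (auto simp: dist_norm)
    then have "1 / fst (X t) = U p" by (simp add: chart_point_def)
    then have "q t = p" using Q_U[OF p(1)] by (simp add: q_def)
    then show "norm (q t) < R" "q t \<noteq> 0" "X t = chart_point U \<zeta> (q t)" using p by auto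
  qed
  have d: "((\<lambda>t. q t ^ (m - 1)) has_vector_derivative 1) (at t)" if t: "t \<in> I" for t
  proof -
    let ?f = "ham_field m h (X t)"
    let ?A = "of_nat (m - 1) * q t ^ (m - 2)"
    have dX: "(X has_vector_derivative ?f) (at t)" using I(3)[OF t] by (simp add: real_solution_def)
    have dx: "((\<lambda>t. fst (X t)) has_vector_derivative fst ?f) (at t)"
      and dy: "((\<lambda>t. snd (X t)) has_vector_derivative snd ?f) (at t)"
      using bounded_linear.has_vector_derivative[OF bounded_linear_fst dX]
        bounded_linear.has_vector_derivative[OF bounded_linear_snd dX] by auto
    have "1 / fst (X t) = U (q t)" using q(3)[OF t] by (simp add: chart_point_def)
    then have in': "1 / fst (X t) \<in> U ` ball 0 R" using q(1)[OF t] by auto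
    have "(Q has_field_derivative deriv Q (1 / fst (X t))) (at (1 / fst (X t)))"
      by (rule holomorphic_derivI[OF Q_hol U_image_open in'])
    moreover have "((\<lambda>x. 1 / x) has_field_derivative - (inverse (fst (X t)) ^ Suc (Suc 0))) (at (fst (X t)))"
      using DERIV_inverse[of "fst (X t)"] I(3)[OF t] by (simp add: divide_inverse)
    ultimately have "((\<lambda>x. Q (1 / x)) has_field_derivative
        deriv Q (1 / fst (X t)) * - (inverse (fst (X t)) ^ Suc (Suc 0))) (at (fst (X t)))"
      by (rule DERIV_chain2)
    from field_vector_diff_chain_at[OF dx this]
    obtain q' where q': "(q has_vector_derivative q') (at t)" unfolding q_def o_def by blast
    have qb: "q t \<in> ball 0 R" using q(1)[OF t] by simp
    have tr: "((\<lambda>t. fst (X t)) has_vector_derivative q' * (?A * fst ?f)) (at t)"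
      "((\<lambda>t. snd (X t)) has_vector_derivative q' * (?A * snd ?f)) (at t)"
      using field_vector_diff_chain_at[OF q' DERIV_fst[OF qb q(2)[OF t]]]
        field_vector_diff_chain_at[OF q' DERIV_snd[OF qb q(2)[OF t]]] q(3)
      unfolding q(3)[OF t, symmetric]
      by (auto elim!: has_vector_derivative_transform_within_open[OF _ I(2) t] simp: chart_point_def)
    have "fst ?f = q' * ?A * fst ?f" "snd ?f = q' * ?A * snd ?f"
      using vector_derivative_unique_at[OF dx tr(1)] vector_derivative_unique_at[OF dy tr(2)] by (auto simp: mult_ac)
    moreover have "fst ?f \<noteq> 0 \<or> snd ?f \<noteq> 0"
      using Euler_homogeneous[of "fst (X t)" m h "snd (X t)"] E[OF t]
      by (auto simp: ham_field_eq simp del: of_nat_Suc of_nat_add)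
    ultimately have one: "q' * ?A = 1" by auto
    have "((\<lambda>q. q ^ (m - 1)) has_field_derivative ?A) (at (q t))"
      by (auto intro!: derivative_eq_intros simp: numeral_2_eq_2)
    from field_vector_diff_chain_at[OF q' this] show ?thesis unfolding one o_def .
  qed
  have "\<exists>c. \<forall>t\<in>I. q t ^ (m - 1) - of_real t = c"
  proof (rule has_derivative_zero_constant[OF I(1)])
    fix t assume "t \<in> I"
    then have "((\<lambda>t. q t ^ (m - 1) - of_real t) has_vector_derivative 1 - 1) (at t)"
      by (intro has_vector_derivative_diff d has_vector_derivative_of_real[OF DERIV_ident, unfolded of_real_1])
    then show "((\<lambda>t. q t ^ (m - 1) - of_real t) has_derivative (\<lambda>h. 0)) (at t within I)"
      by (auto simp: has_vector_derivative_def intro: has_derivative_at_withinI)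
  qed
  then obtain c where c: "\<And>t. t \<in> I \<Longrightarrow> q t ^ (m - 1) - of_real t = c" by blast
  have "c = - of_real T"
  proof (rule tendsto_unique[OF F_nontrivial])
    show "((\<lambda>t. q t ^ (m - 1) - of_real t) \<longlongrightarrow> c) F"
      by (rule tendsto_eventually) (use I(5) c in \<open>auto elim: eventually_mono\<close>)
    have "0 \<in> U ` ball 0 R" using U_0 R_pos by (metis centre_in_ball imageI)
    then have "isCont Q 0"
      using holomorphic_on_imp_continuous_on[OF Q_hol] unfolding continuous_on_eq_continuous_at[OF U_image_open] by blast
    from isCont_tendsto_compose[OF this lim(1)] have "(q \<longlongrightarrow> Q 0) F" unfolding q_def .
    moreover have "Q 0 = 0" using Q_U[of 0] U_0 R_pos by simp
    moreover have "((\<lambda>t. of_real t :: complex) \<longlongrightarrow> of_real T) F" unfolding I(4) by (intro tendsto_intros)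
    ultimately show "((\<lambda>t. q t ^ (m - 1) - of_real t) \<longlongrightarrow> - of_real T) F"
      using tendsto_diff[OF tendsto_power[of q 0 F "m - 1"]] w_pos by (fastforce simp: power_0_left)
  qed
  from I(5) show ?thesis
  proof eventually_elim
    case (elim t)
    then show ?case using q[OF elim] c[OF elim] \<open>c = _\<close>
      by (intro exI[of _ "Ln (q t)"]) (auto simp: sol_def time_eq_power algebra_simps)
  qed
qed

text \<open>Points of the local leaf lift by uniqueness of continuation. Conversely the points
  \<open>l\<close> with \<open>|time l| < r\<close> form a half-plane, so a straight segment in it joins any of its
  points to the lift of the given solution.\<close>

lemma local_leaf_eq:
  assumes r: "0 < r" "r \<le> R ^ (m - 1)"
  shows "local_leaf m h T F X r = {(of_real T + time l, sol l) | l. norm (time l) < r}"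
proof (intro equalityI subsetI)
  fix x assume x: "x \<in> local_leaf m h T F X r"
  obtain t p where [simp]: "x = (t, p)" by (cases x)
  have "\<forall>\<^sub>F t0 in F. \<exists>g Y. continued_along m h g Y \<and> path_image g \<subseteq> ball (of_real T) r - {of_real T} \<and>
     g 0 = of_real t0 \<and> Y 0 = X t0 \<and> g 1 = t \<and> Y 1 = p"
    using x by (simp add: local_leaf_def)
  from eventually_happens'[OF F_nontrivial eventually_conj[OF this solution_in_chart]]
  obtain t0 g Y l0 where *: "continued_along m h g Y" "path_image g \<subseteq> ball (of_real T) r - {of_real T}"
     "g 0 = of_real T + time l0" "Y 0 = sol l0" "g 1 = t" "Y 1 = p" by auto
  obtain l where "\<And>s. s \<in> {0..1} \<Longrightarrow> g s = of_real T + time (l s) \<and> Y s = sol (l s) \<and> norm (time (l s)) < r"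
    using continued_along_imp_lift[OF *(1,2) r(2) *(3,4)] by metis
  from this[of 1] show "x \<in> {(of_real T + time l, sol l) | l. norm (time l) < r}" using *(5,6) by auto
next
  fix x assume "x \<in> {(of_real T + time l, sol l) | l. norm (time l) < r}"
  then obtain l where l: "x = (of_real T + time l, sol l)" "norm (time l) < r" by auto
  have "((\<lambda>t. t) \<longlongrightarrow> T) F" using one_sided by (auto intro: tendsto_ident_at)
  from tendstoD[OF this r(1)] have "\<forall>\<^sub>F t0 in F. t0 \<in> ball T r"
    by (simp add: dist_commute)
  with solution_in_chart
  have "\<forall>\<^sub>F t0 in F. \<exists>g Y. continued_along m h g Y \<and> path_image g \<subseteq> ball (of_real T) r - {of_real T} \<and>
     g 0 = of_real t0 \<and> Y 0 = X t0 \<and> g 1 = of_real T + time l \<and> Y 1 = sol l"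
  proof eventually_elim
    case (elim t0)
    then obtain l0 where l0: "norm (exp l0) < R" "X t0 = sol l0" "of_real t0 = of_real T + time l0" by auto
    have "time l0 = of_real (t0 - T)" using l0(3) by (simp add: algebra_simps)
    then have "norm (time l0) < r" using elim(2) by (simp only: norm_of_real) (simp add: dist_real_def)
    have n: "norm (time k) < r \<longleftrightarrow> Re (of_nat (m - 1) * k) < ln r" for k
      unfolding time_def norm_exp_eq_Re using r(1) by (metis exp_less_cancel_iff exp_ln)
    have "convex {k. norm (time k) < r}"
    proof -
      have "{k. norm (time k) < r} = {k. inner (of_real (real (m - 1)) :: complex) k < ln r}"
        unfolding n by (auto simp: inner_complex_def)
      then show ?thesis by (metis convex_halfspace_lt)
    qed
    then have seg: "closed_segment l0 l \<subseteq> {k. norm (time k) < r}"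
      using \<open>norm (time l0) < r\<close> l(2) by (intro closed_segment_subset) auto
    then have seg': "norm (time (linepath l0 l s)) < r" if "s \<in> {0..1}" for s
      using that linepath_image_01[of l0 l] by blast
    show ?case
    proof (intro exI conjI)
      show "continued_along m h (\<lambda>s. of_real T + time (linepath l0 l s)) (\<lambda>s. sol (linepath l0 l s))"
        by (rule continued_along_lift) (use seg' r(2) norm_exp_less in fastforce)+
      show "path_image (\<lambda>s. of_real T + time (linepath l0 l s)) \<subseteq> ball (of_real T) r - {of_real T}"
        using seg' time_nonzero by (auto simp: path_image_def dist_norm)
    qed (use l0 in \<open>auto simp: linepath_def\<close>)
  qed
  then show "x \<in> local_leaf m h T F X r" using l by (simp add: local_leaf_def)
qed

text \<open>For \<open>r = R\<^sup>m\<^sup>-\<^sup>1\<close> the local leaf contains every point of the chart, and its points are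
  reached by continuation from \<open>X\<close>, which lies in the orbit \<open>L\<close>.\<close>

lemma sol_in_leaf:
  assumes "norm (exp l) < R" shows "sol l \<in> L"
proof -
  have "(of_real T + time l, sol l) \<in> local_leaf m h T F X (R ^ (m - 1))"
    using norm_time_less[OF assms] R_pos by (subst local_leaf_eq) auto
  then have "\<forall>\<^sub>F t0 in F. \<exists>g Y. continued_along m h g Y \<and> Y 0 = X t0 \<and> Y 1 = sol l"
    unfolding local_leaf_def by (auto elim!: eventually_mono)
  from eventually_happens'[OF F_nontrivial eventually_conj[OF this solution]]
  obtain t0 g Y where "continued_along m h g Y" "Y 0 = X t0" "Y 1 = sol l" "X t0 \<in> L"
    by (auto simp: real_solution_def)
  then show ?thesis using leaf orbit_trans unfolding is_leaf_def by metis
qed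

end

section \<open>Winding numbers of closed lifts\<close>

lemma winding_number_exp_path:
  assumes "path l" and eq: "\<And>s. s \<in> {0..1} \<Longrightarrow> g s = c + exp (l s)"
  shows "winding_number g c = (l 1 - l 0) / (2 * of_real pi * \<i>)"
proof -
  have "winding_number g c = winding_number (\<lambda>s. g s - c) 0" by (rule winding_number_offset)
  also have "\<dots> = winding_number (exp \<circ> l) 0" by (rule winding_number_cong) (simp add: eq)
  also have "\<dots> = (l 1 - l 0) / (2 * of_real pi * \<i>)"
    using winding_number_compose_exp[OF assms(1)] by (simp add: pathfinish_def pathstart_def)
  finally show ?thesis .
qed

text \<open>Rotation by the fraction \<open>a\<close> of a full circle.\<close>

definition turn :: "real \<Rightarrow> complex" where "turn a = exp (2 * of_real pi * \<i> * of_real a)"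

lemma turn_add: "turn (a + b) = turn a * turn b"
  by (simp add: turn_def exp_add distrib_left)

lemma turn_power: "turn a ^ n = turn (real n * a)"
  by (simp add: turn_def mult_ac flip: exp_of_nat_mult)

lemma norm_turn: "norm (turn a) = 1"
  by (simp add: turn_def norm_exp_eq_Re)

lemma turn_eq_1_iff: "turn a = 1 \<longleftrightarrow> a \<in> \<int>"
proof -
  have "turn a = 1 \<longleftrightarrow> (\<exists>n::int. 2 * pi * a = real_of_int (2 * n) * pi)"
    unfolding turn_def exp_eq_1 by simp
  also have "\<dots> \<longleftrightarrow> (\<exists>n::int. a = of_int n)" by (auto simp: field_simps)
  finally show ?thesis by (auto simp: Ints_def)
qed

lemma turn_eq_iff: "turn a = turn b \<longleftrightarrow> a - b \<in> \<int>"
proof -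
  have "turn a = turn b * turn (a - b)" by (simp flip: turn_add)
  moreover have "turn b \<noteq> 0" by (simp add: turn_def)
  ultimately show ?thesis by (simp flip: turn_eq_1_iff)
qed

lemma turn_half_nat: "turn (real n / 2) = (- 1) ^ n"
proof -
  have "turn (1 / 2) = - 1" by (simp add: turn_def exp_pi_i')
  then show ?thesis using turn_power[of "1 / 2" n] by simp
qed

context blow_up_chart
begin

lemma U_cont: "continuous_on (ball 0 R) U" by (rule holomorphic_on_imp_continuous_on[OF U_hol])

lemma \<zeta>_cont: "continuous_on (ball 0 R) \<zeta>"
proof -
  have "continuous_on (ball 0 R) (\<lambda>q. e + q ^ (m + 1) * exp (\<beta> q))" by (intro continuous_intros \<beta>_cont)
  then show ?thesis using continuous_on_cong[of "ball 0 R" "ball 0 R" \<zeta>] \<zeta>_eq by auto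
qed

lemma sol_near_vertex:
  assumes "\<epsilon> > 0"
  obtains \<rho> where "\<rho> > 0" "\<rho> \<le> R" "\<And>l. norm (exp l) < \<rho> \<Longrightarrow> dist (uz (sol l)) (0, e) < \<epsilon>"
proof -
  have "continuous_on (ball 0 R) (\<lambda>q. (U q, \<zeta> q))" by (intro continuous_intros U_cont \<zeta>_cont)
  then have "isCont (\<lambda>q. (U q, \<zeta> q)) 0" using R_pos by (simp add: continuous_on_eq_continuous_at)
  then obtain d where d: "d > 0" "\<And>q. dist q 0 < d \<Longrightarrow> dist (U q, \<zeta> q) (U 0, \<zeta> 0) < \<epsilon>"
    using assms unfolding continuous_at_eps_delta dist_norm by blast
  have "\<zeta> 0 = e" using \<zeta>_eq[of 0] R_pos by simp
  then show thesis using d R_pos U_0 by (intro that[of "min d R"]) (auto simp: uz_sol)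
qed

text \<open>Along a lifted path, \<open>u = exp (l + \<alpha> (exp l))\<close>. If \<open>exp l\<close> closes up, the unit
  contributes nothing to the increment of the exponent. The same holds for \<open>z - e\<close>, with
  \<open>(m + 1) l\<close> in place of \<open>l\<close>.\<close>

lemma winding_number_U:
  assumes l: "path l" and R: "\<And>s. s \<in> {0..1} \<Longrightarrow> norm (exp (l s)) < R" and c: "exp (l 1) = exp (l 0)"
  shows "winding_number (\<lambda>s. U (exp (l s))) 0 = (l 1 - l 0) / (2 * of_real pi * \<i>)"
proof -
  have cl: "continuous_on {0..1} l" using l by (simp add: path_def)
  have "continuous_on {0..1} (\<lambda>s. \<alpha> (exp (l s)))"
    by (rule continuous_on_compose2[OF \<alpha>_cont]) (use R cl in \<open>auto intro!: continuous_intros\<close>)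
  then have "path (\<lambda>s. l s + \<alpha> (exp (l s)))" unfolding path_def by (intro continuous_intros cl)
  then have "winding_number (\<lambda>s. U (exp (l s))) 0 = ((l 1 + \<alpha> (exp (l 1))) - (l 0 + \<alpha> (exp (l 0)))) / (2 * of_real pi * \<i>)"
  proof (rule winding_number_exp_path)
    fix s :: real assume "s \<in> {0..1}"
    then show "U (exp (l s)) = 0 + exp (l s + \<alpha> (exp (l s)))"
      using U_eq[of "exp (l s)"] R unfolding exp_add by simp
  qed
  then show ?thesis by (simp add: c)
qed

lemma winding_number_\<zeta>:
  assumes l: "path l" and R: "\<And>s. s \<in> {0..1} \<Longrightarrow> norm (exp (l s)) < R" and c: "exp (l 1) = exp (l 0)"
  shows "winding_number (\<lambda>s. \<zeta> (exp (l s))) e = of_nat (m + 1) * (l 1 - l 0) / (2 * of_real pi * \<i>)"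
proof -
  have cl: "continuous_on {0..1} l" using l by (simp add: path_def)
  have "continuous_on {0..1} (\<lambda>s. \<beta> (exp (l s)))"
    by (rule continuous_on_compose2[OF \<beta>_cont]) (use R cl in \<open>auto intro!: continuous_intros\<close>)
  then have "path (\<lambda>s. of_nat (m + 1) * l s + \<beta> (exp (l s)))" unfolding path_def by (intro continuous_intros cl)
  then have "winding_number (\<lambda>s. \<zeta> (exp (l s))) e =
      ((of_nat (m + 1) * l 1 + \<beta> (exp (l 1))) - (of_nat (m + 1) * l 0 + \<beta> (exp (l 0)))) / (2 * of_real pi * \<i>)"
  proof (rule winding_number_exp_path)
    fix s :: real assume "s \<in> {0..1}"
    then show "\<zeta> (exp (l s)) = e + exp (of_nat (m + 1) * l s + \<beta> (exp (l s)))"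
      using \<zeta>_eq[of "exp (l s)"] R unfolding exp_add exp_of_nat_mult by simp
  qed
  then show ?thesis by (simp add: c right_diff_distrib)
qed

text \<open>The image in the \<open>(u, z)\<close>-plane of the ray in direction \<open>\<omega>\<close> of the \<open>q\<close>-disk; the
  bound on \<open>\<rho>\<close> expresses \<open>|t - T| < r\<close>.\<close>

definition ray :: "real \<Rightarrow> complex \<Rightarrow> (complex \<times> complex) set" where
  "ray r \<omega> = (\<lambda>\<rho>. (U (of_real \<rho> * \<omega>), \<zeta> (of_real \<rho> * \<omega>))) ` {\<rho>. 0 < \<rho> \<and> \<rho> ^ (m - 1) < r}"

lemma radius_bound:
  assumes "0 < \<rho>" "\<rho> ^ (m - 1) < r" "r \<le> R ^ (m - 1)" shows "\<rho> < R"
  by (rule power_less_imp_less_base[of _ "m - 1"]) (use assms R_pos in auto)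

lemma ray_mem_iff:
  assumes r: "r \<le> R ^ (m - 1)" and \<omega>: "norm \<omega> = 1" "norm \<eta> = 1" and \<rho>: "0 < \<rho>" "\<rho> ^ (m - 1) < r"
  shows "(U (of_real \<rho> * \<eta>), \<zeta> (of_real \<rho> * \<eta>)) \<in> ray r \<omega> \<longleftrightarrow> \<eta> = \<omega>"
proof
  assume "(U (of_real \<rho> * \<eta>), \<zeta> (of_real \<rho> * \<eta>)) \<in> ray r \<omega>"
  then obtain \<rho>' where \<rho>': "0 < \<rho>'" "\<rho>' ^ (m - 1) < r" "U (of_real \<rho> * \<eta>) = U (of_real \<rho>' * \<omega>)"
    by (auto simp: ray_def)
  have eq: "of_real \<rho> * \<eta> = of_real \<rho>' * \<omega>"
    by (rule U_inj) (use \<rho> \<rho>' \<omega> radius_bound r in \<open>auto simp: norm_mult\<close>)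
  then have "norm (of_real \<rho> * \<eta>) = norm (of_real \<rho>' * \<omega>)" by simp
  then have "\<rho> = \<rho>'" using \<omega> \<rho> \<rho>' by (simp add: norm_mult)
  then show "\<eta> = \<omega>" using eq \<rho> by simp
qed (use \<rho> in \<open>auto simp: ray_def\<close>)

text \<open>The \<open>(m - 1)\<close>-th root: the modulus of \<open>q\<close> at a time at distance \<open>x\<close> from \<open>T\<close>.\<close>

definition radius :: "real \<Rightarrow> real" where "radius x = exp (ln x / real (m - 1))"

lemma radius_pos: "radius x > 0" by (simp add: radius_def)

lemma radius_power: "x > 0 \<Longrightarrow> radius x ^ (m - 1) = x"
  using w_pos by (simp add: radius_def flip: exp_of_nat_mult)

lemma radius_of_power: "\<rho> > 0 \<Longrightarrow> radius (\<rho> ^ (m - 1)) = \<rho>"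
  using w_pos by (simp add: radius_def ln_realpow)

lemma radius_tendsto_0:
  assumes "(f \<longlongrightarrow> 0) G" "\<forall>\<^sub>F x in G. f x > 0" shows "((\<lambda>x. radius (f x)) \<longlongrightarrow> 0) G"
proof (rule tendstoI)
  fix \<epsilon> :: real assume "\<epsilon> > 0"
  then have "\<forall>\<^sub>F x in G. dist (f x) 0 < \<epsilon> ^ (m - 1)" using tendstoD[OF assms(1)] by simp
  with assms(2) show "\<forall>\<^sub>F x in G. dist (radius (f x)) 0 < \<epsilon>"
  proof eventually_elim
    case (elim x)
    then have "radius (f x) ^ (m - 1) < \<epsilon> ^ (m - 1)"
      unfolding radius_power[OF elim(1)] by simp
    then have "radius (f x) < \<epsilon>" by (rule power_less_imp_less_base) (use \<open>\<epsilon> > 0\<close> in simp)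
    then show ?case using radius_pos[of "f x"] by simp
  qed
qed

lemma ray_eq_image:
  assumes \<sigma>: "\<sigma> = 1 \<or> \<sigma> = - 1" and I: "I = {t. 0 < \<sigma> * (t - T) \<and> \<sigma> * (t - T) < r}"
  shows "(\<lambda>t. (U (of_real (radius (\<sigma> * (t - T))) * \<omega>), \<zeta> (of_real (radius (\<sigma> * (t - T))) * \<omega>))) ` I = ray r \<omega>"
proof -
  have "(\<lambda>t. radius (\<sigma> * (t - T))) ` I = {\<rho>. 0 < \<rho> \<and> \<rho> ^ (m - 1) < r}"
  proof (intro equalityI subsetI)
    fix \<rho> assume "\<rho> \<in> {\<rho>. 0 < \<rho> \<and> \<rho> ^ (m - 1) < r}"
    then have \<rho>: "0 < \<rho>" "\<rho> ^ (m - 1) < r" by auto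
    have s: "\<sigma> * ((T + \<sigma> * \<rho> ^ (m - 1)) - T) = \<rho> ^ (m - 1)" using \<sigma> by auto
    show "\<rho> \<in> (\<lambda>t. radius (\<sigma> * (t - T))) ` I"
    proof (rule image_eqI)
      show "\<rho> = radius (\<sigma> * ((T + \<sigma> * \<rho> ^ (m - 1)) - T))" unfolding s radius_of_power[OF \<rho>(1)] ..
      show "T + \<sigma> * \<rho> ^ (m - 1) \<in> I" unfolding I mem_Collect_eq s using \<rho> by simp
    qed
  qed (auto simp: I radius_pos radius_power simp del: One_nat_def)
  from this[symmetric] show ?thesis unfolding ray_def by (simp add: image_image)
qed

end

section \<open>Minimal blow-up loops\<close>

context blow_up_solution
begin

lemma loop_lift:
  assumes r: "0 < r" "r \<le> R ^ (m - 1)" and loop: "blow_up_loop m h T F X r w gt guz"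
  obtains l where "path l" "\<And>s. s \<in> {0..1} \<Longrightarrow> guz s = (U (exp (l s)), \<zeta> (exp (l s))) \<and> norm (exp (l s)) < R"
    "l 1 - l 0 = 2 * of_real pi * \<i> * of_nat w / of_nat (m - 1)" "exp (l 1) = exp (l 0)"
proof -
  obtain Y where Y: "continued_along m h gt Y" "guz 1 = guz 0" "time_cycle T r w gt"
    "\<And>s. s \<in> {0..1} \<Longrightarrow> (gt s, Y s) \<in> local_leaf m h T F X r \<and> guz s = uz (Y s)"
    using loop unfolding blow_up_loop_def by auto
  have "(gt 0, Y 0) \<in> local_leaf m h T F X r" using Y(4)[of 0] by simp
  then obtain l0 where l0: "gt 0 = of_real T + time l0" "Y 0 = sol l0"
    unfolding local_leaf_eq[OF r] by auto
  have "path_image gt \<subseteq> ball (of_real T) r - {of_real T}" "winding_number gt (of_real T) = of_nat w"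
    using Y(3) by (auto simp: time_cycle_def)
  then obtain l where l: "path l" "l 0 = l0"
    "\<And>s. s \<in> {0..1} \<Longrightarrow> gt s = of_real T + time (l s) \<and> Y s = sol (l s) \<and> norm (time (l s)) < r"
    "l 1 - l 0 = 2 * of_real pi * \<i> * of_nat w / of_nat (m - 1)"
    using continued_along_imp_lift[OF Y(1) _ r(2) l0] by metis
  have nR: "norm (exp (l s)) < R" if "s \<in> {0..1}" for s
    by (rule norm_exp_less) (use l(3)[OF that] r(2) in linarith)
  have g: "guz s = (U (exp (l s)), \<zeta> (exp (l s)))" if "s \<in> {0..1}" for s
    using Y(4)[OF that] l(3)[OF that] uz_sol[OF nR[OF that]] by simp
  have "U (exp (l 1)) = U (exp (l 0))" using g[of 0] g[of 1] Y(2) by simp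
  then have "exp (l 1) = exp (l 0)" using U_inj[OF nR[of 1] nR[of 0]] by simp
  then show thesis using l g nR by (intro that[of l]) auto
qed

text \<open>The increment \<open>2 \<pi> i w / (m - 1)\<close> of \<open>l\<close> along a closed loop is a multiple of \<open>2 \<pi> i\<close>,
  because \<open>u = U (exp l)\<close> determines \<open>exp l\<close>.\<close>

lemma loop_winding_dvd:
  assumes r: "0 < r" "r \<le> R ^ (m - 1)" and loop: "blow_up_loop m h T F X r w gt guz"
  shows "m - 1 dvd w"
proof -
  obtain l where "path l" "\<And>s. s \<in> {0..1} \<Longrightarrow> guz s = (U (exp (l s)), \<zeta> (exp (l s))) \<and> norm (exp (l s)) < R"
    and l: "l 1 - l 0 = 2 * of_real pi * \<i> * of_nat w / of_nat (m - 1)" "exp (l 1) = exp (l 0)"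
    by (rule loop_lift[OF assms]) (rule that)
  have "turn (real w / real (m - 1)) = exp (l 1 - l 0)" unfolding l(1) turn_def by simp
  also have "\<dots> = 1" using l(2) by (simp add: exp_diff)
  finally obtain n :: int where "real w / real (m - 1) = of_int n" unfolding turn_eq_1_iff Ints_def by auto
  then have "real_of_int (int w) = of_int (n * int (m - 1))" using w_pos by (simp add: field_simps)
  then have "int w = n * int (m - 1)" by (simp only: of_int_eq_iff)
  then show ?thesis by (metis dvd_triv_right int_dvd_int_iff)
qed

text \<open>A path of \<open>l\<close> of increment \<open>2 \<pi> i\<close> closes up in \<open>q\<close> and gives winding number
  \<open>m - 1\<close> in time; no smaller one is possible, since \<open>m - 1\<close> divides all of them.\<close>

lemma minimal_loop_of_lift:
  assumes r: "0 < r" "r \<le> R ^ (m - 1)" and l: "path l"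
    and gt: "\<And>s. s \<in> {0..1} \<Longrightarrow> gt s = of_real T + time (l s)"
    and guz: "\<And>s. s \<in> {0..1} \<Longrightarrow> guz s = uz (sol (l s))"
    and lr: "\<And>s. s \<in> {0..1} \<Longrightarrow> norm (time (l s)) < r" and closed: "l 1 - l 0 = 2 * of_real pi * \<i>"
  shows "minimal_blow_up_loop m h T F X r (m - 1) gt guz"
  unfolding minimal_blow_up_loop_def
proof (intro conjI allI impI)
  have nR: "norm (exp (l s)) < R" if "s \<in> {0..1}" for s
    by (rule norm_exp_less) (use lr[OF that] r(2) in linarith)
  have "exp (l 1 - l 0) = 1" unfolding closed by simp
  then have e: "exp (l 1) = exp (l 0)" by (simp add: exp_diff)
  have c: "continued_along m h gt (\<lambda>s. sol (l s))"
    by (rule continued_along_cong[OF continued_along_lift[OF l nR]]) (auto simp: gt)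
  have "path (\<lambda>s. of_nat (m - 1) * l s)" using l unfolding path_def by (intro continuous_intros)
  then have "winding_number gt (of_real T) = (of_nat (m - 1) * l 1 - of_nat (m - 1) * l 0) / (2 * of_real pi * \<i>)"
    by (rule winding_number_exp_path) (simp add: gt time_def)
  also have "\<dots> = of_nat (m - 1)" unfolding right_diff_distrib[symmetric] closed by simp
  finally have "time_cycle T r (m - 1) gt"
    using c e gt lr time_nonzero
    by (auto simp: time_cycle_def continued_along_def pathfinish_def pathstart_def time_eq_power path_image_def dist_norm)
  moreover have "(gt s, sol (l s)) \<in> local_leaf m h T F X r" if "s \<in> {0..1}" for s
    unfolding local_leaf_eq[OF r] using gt lr that by blast
  moreover have "guz 1 = guz 0" using guz[of 0] guz[of 1] e by (simp add: sol_def)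
  ultimately show "blow_up_loop m h T F X r (m - 1) gt guz"
    unfolding blow_up_loop_def using c guz fst_sol_nonzero nR w_pos
    by (intro conjI exI[of _ "\<lambda>s. sol (l s)"]) auto
  fix w' gt' guz' assume "blow_up_loop m h T F X r w' gt' guz'"
  then show "m - 1 \<le> w'"
    using loop_winding_dvd[OF r] by (intro dvd_imp_le) (auto simp: blow_up_loop_def)
qed

lemma minimal_loop_exists:
  assumes r: "0 < r" "r \<le> R ^ (m - 1)" and gt: "time_cycle T r (m - 1) gt"
  shows "\<exists>guz. minimal_blow_up_loop m h T F X r (m - 1) gt guz"
proof -
  have g: "path gt" "path_image gt \<subseteq> ball (of_real T) r - {of_real T}" "winding_number gt (of_real T) = of_nat (m - 1)"
    using gt by (auto simp: time_cycle_def)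
  have "gt 0 \<noteq> of_real T" using g(2) by (force simp: path_image_def)
  then have "gt 0 = of_real T + time (Ln (gt 0 - of_real T) / of_nat (m - 1))"
    using w_pos by (simp add: time_def)
  then obtain l where l: "path l" "\<And>s. s \<in> {0..1} \<Longrightarrow> gt s = of_real T + time (l s)"
    "l 1 - l 0 = 2 * of_real pi * \<i> * winding_number gt (of_real T) / of_nat (m - 1)"
    using time_path_lift[where g = gt and T = "of_real T"] g(1,2) by (metis Diff_iff insertI1 subsetD)
  have "norm (time (l s)) < r" if "s \<in> {0..1}" for s
  proof -
    have "gt s \<in> ball (of_real T) r" using g(2) that unfolding path_image_def by blast
    then show ?thesis using l(2)[OF that] by (simp add: dist_norm)
  qed
  moreover have "l 1 - l 0 = 2 * of_real pi * \<i>" using l(3) g(3) w_pos by simp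
  ultimately have "minimal_blow_up_loop m h T F X r (m - 1) gt (\<lambda>s. uz (sol (l s)))"
    using l by (intro minimal_loop_of_lift[OF r, of l]) auto
  then show ?thesis by blast
qed

text \<open>A lift of the circle \<open>|t - T| = r/2\<close>, run through \<open>m - 1\<close> times. The initial angle
  \<open>\<pi> / (m - 1)\<close> of \<open>q\<close> makes \<open>t - T\<close> start on the negative real axis, that is, on an incoming
  branch.\<close>

definition star_lift :: "real \<Rightarrow> real \<Rightarrow> complex" where
  "star_lift r s = of_real (ln (radius (r / 2))) + 2 * of_real pi * \<i> * of_real (s + 1 / (2 * real (m - 1)))"

lemma exp_star_lift: "exp (star_lift r s) = of_real (radius (r / 2)) * turn (s + 1 / (2 * real (m - 1)))"
  using radius_pos[of "r / 2"] by (simp add: star_lift_def turn_def exp_add exp_of_real)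

lemma star_lift_props:
  assumes "0 < r"
  shows "path (star_lift r)" "norm (time (star_lift r s)) < r" "star_lift r 1 - star_lift r 0 = 2 * of_real pi * \<i>"
proof -
  show "path (star_lift r)" unfolding path_def star_lift_def by (intro continuous_intros)
  show "norm (time (star_lift r s)) < r"
    unfolding norm_time exp_star_lift norm_mult norm_turn
    using radius_pos[of "r / 2"] radius_power[of "r / 2"] assms by simp
  show "star_lift r 1 - star_lift r 0 = 2 * of_real pi * \<i>" by (simp add: star_lift_def algebra_simps)
qed

lemma minimal_star_loop:
  assumes r: "0 < r" "r \<le> R ^ (m - 1)"
  shows "minimal_blow_up_loop m h T F X r (m - 1) (\<lambda>s. of_real T + time (star_lift r s)) (\<lambda>s. uz (sol (star_lift r s)))"
  by (rule minimal_loop_of_lift[OF r star_lift_props(1)[OF r(1)]]) (use star_lift_props[OF r(1)] in auto)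

lemma minimal_loop_winding:
  assumes r: "0 < r" "r \<le> R ^ (m - 1)" and loop: "minimal_blow_up_loop m h T F X r w gt guz"
  shows "w = m - 1" "winding_number (\<lambda>s. fst (guz s)) 0 = 1"
    "winding_number (\<lambda>s. snd (guz s)) e = of_nat (m + 1)"
proof -
  have b: "blow_up_loop m h T F X r w gt guz" using loop by (simp add: minimal_blow_up_loop_def)
  have "w \<le> m - 1" using loop minimal_star_loop[OF r] unfolding minimal_blow_up_loop_def by blast
  moreover have "m - 1 \<le> w"
    using loop_winding_dvd[OF r b] b by (intro dvd_imp_le) (auto simp: blow_up_loop_def)
  ultimately show w: "w = m - 1" by simp
  obtain l where l: "path l" "\<And>s. s \<in> {0..1} \<Longrightarrow> guz s = (U (exp (l s)), \<zeta> (exp (l s))) \<and> norm (exp (l s)) < R"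
    "l 1 - l 0 = 2 * of_real pi * \<i> * of_nat w / of_nat (m - 1)" "exp (l 1) = exp (l 0)"
    by (rule loop_lift[OF r b]) (rule that)
  have d: "l 1 - l 0 = 2 * of_real pi * \<i>" using l(3) w_pos unfolding w by simp
  have "winding_number (\<lambda>s. fst (guz s)) 0 = winding_number (\<lambda>s. U (exp (l s))) 0"
    by (rule winding_number_cong) (use l(2) in simp)
  also have "\<dots> = (l 1 - l 0) / (2 * of_real pi * \<i>)" using l by (intro winding_number_U) auto
  finally show "winding_number (\<lambda>s. fst (guz s)) 0 = 1" unfolding d by simp
  have "winding_number (\<lambda>s. snd (guz s)) e = winding_number (\<lambda>s. \<zeta> (exp (l s))) e"
    by (rule winding_number_cong) (use l(2) in simp)
  also have "\<dots> = of_nat (m + 1) * (l 1 - l 0) / (2 * of_real pi * \<i>)" using l by (intro winding_number_\<zeta>) auto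
  finally show "winding_number (\<lambda>s. snd (guz s)) e = of_nat (m + 1)" unfolding d by simp
qed

section \<open>The real-time blow-up star\<close>

text \<open>The sign \<open>\<sigma>\<close> is that of \<open>t - T\<close>. On a branch, \<open>q / |q|\<close> is continuous with values
  among the finitely many roots of \<open>\<omega>\<^sup>m\<^sup>-\<^sup>1 = \<sigma>\<close>, hence constant, and the branch is a ray.
  Conversely every such ray carries the solution
  \<open>sol (ln |t - T| / (m - 1) + Ln \<omega>)\<close>.\<close>

lemma branches_eq_rays:
  assumes r: "0 < r" "r \<le> R ^ (m - 1)" and \<sigma>: "\<sigma> = 1 \<or> \<sigma> = - 1"
    and I: "I = {t. 0 < \<sigma> * (t - T) \<and> \<sigma> * (t - T) < r}"
    and G: "G \<noteq> bot" "\<forall>\<^sub>F t in G. t \<in> I" "((\<lambda>t. t) \<longlongrightarrow> T) G"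
  shows "branches m h L T F X r G I = ray r ` {\<omega>. \<omega> ^ (m - 1) = of_real \<sigma>}"
proof (intro equalityI subsetI)
  have convI: "convex I"
  proof -
    have "I = {t. 0 < \<sigma> * (t - T)} \<inter> {t. \<sigma> * (t - T) < r}" unfolding I by auto
    moreover have "{t. 0 < \<sigma> * (t - T)} = (if \<sigma> = 1 then {T<..} else {..<T})"
      "{t. \<sigma> * (t - T) < r} = (if \<sigma> = 1 then {..<T + r} else {T - r<..})" using \<sigma> by auto
    ultimately show ?thesis by (auto intro!: convex_Int)
  qed
  fix B assume "B \<in> branches m h L T F X r G I"
  then obtain Z where Z: "B = (\<lambda>t. uz (Z t)) ` I"
    "\<And>t. t \<in> I \<Longrightarrow> real_solution m h L t Z \<and> (of_real t, Z t) \<in> local_leaf m h T F X r"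
    unfolding branches_def by auto
  define q where "q t = Q (1 / fst (Z t))" for t
  have q: "norm (q t) < R" "q t ^ (m - 1) = of_real (t - T)" "uz (Z t) = (U (q t), \<zeta> (q t))"
    "1 / fst (Z t) = U (q t)" "fst (Z t) \<noteq> 0" if t: "t \<in> I" for t
  proof -
    obtain l where l: "of_real t = of_real T + time l" "Z t = sol l" "norm (time l) < r"
      using Z(2)[OF t] unfolding local_leaf_eq[OF r] by auto
    have lR: "norm (exp l) < R" by (rule norm_exp_less) (use l(3) r(2) in linarith)
    then have f: "1 / fst (Z t) = U (exp l)" by (simp add: l(2) sol_def chart_point_def)
    then have ql: "q t = exp l" unfolding q_def using Q_U lR by simp
    show "norm (q t) < R" "1 / fst (Z t) = U (q t)" using lR f ql by auto
    show "q t ^ (m - 1) = of_real (t - T)" using l(1) unfolding ql time_eq_power[symmetric] by (simp add: algebra_simps)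
    show "uz (Z t) = (U (q t), \<zeta> (q t))" unfolding l(2) uz_sol[OF lR] ql ..
    show "fst (Z t) \<noteq> 0" unfolding l(2) by (rule fst_sol_nonzero[OF lR])
  qed
  have tI: "0 < \<sigma> * (t - T)" "t - T = \<sigma> * (\<sigma> * (t - T))" if "t \<in> I" for t using that \<sigma> by (auto simp: I)
  define \<omega> where "\<omega> t = q t / of_real (radius (\<sigma> * (t - T)))" for t
  have \<omega>: "\<omega> t ^ (m - 1) = of_real \<sigma>" if t: "t \<in> I" for t
  proof -
    have "\<omega> t ^ (m - 1) = of_real (\<sigma> * (\<sigma> * (t - T))) / of_real (\<sigma> * (t - T))"
      unfolding \<omega>_def power_divide q(2)[OF t] of_real_power[symmetric] radius_power[OF tI(1)[OF t]]
      by (simp only: tI(2)[OF t, symmetric])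
    also have "\<dots> = of_real \<sigma>" using tI(1)[OF t] by auto
    finally show ?thesis .
  qed
  have "continuous_on I (\<lambda>t. fst (Z t))"
  proof (intro continuous_at_imp_continuous_on ballI)
    fix t assume "t \<in> I"
    then have "isCont Z t" using Z(2)[of t] has_vector_derivative_continuous unfolding real_solution_def by blast
    then show "isCont (\<lambda>t. fst (Z t)) t" by (intro continuous_intros)
  qed
  then have "continuous_on I (\<lambda>t. 1 / fst (Z t))"
    by (rule continuous_on_divide[OF continuous_on_const]) (use q(5) in auto)
  then have "continuous_on I q" unfolding q_def
    by (rule continuous_on_compose2[OF holomorphic_on_imp_continuous_on[OF Q_hol]]) (use q(1,4) in auto)
  moreover have \<sigma>_ne: "\<sigma> * (t - T) \<noteq> 0" if "t \<in> I" for t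
    using tI(1)[OF that] by (metis less_irrefl)
  ultimately have "continuous_on I \<omega>"
    unfolding \<omega>_def radius_def
    by (intro continuous_intros) (use \<sigma>_ne w_pos in auto)
  moreover have "finite (\<omega> ` I)"
    by (rule finite_subset[OF _ finite_nth_roots[of "m - 1" "of_real \<sigma>"]]) (use \<omega> w_pos in auto)
  ultimately have "\<omega> constant_on I"
    by (intro continuous_finite_range_constant convex_connected[OF convI])
  then obtain \<omega>0 where \<omega>0: "\<And>t. t \<in> I \<Longrightarrow> \<omega> t = \<omega>0" unfolding constant_on_def by auto
  have "q t = of_real (radius (\<sigma> * (t - T))) * \<omega>0" if "t \<in> I" for t
    using \<omega>0[OF that] radius_pos[of "\<sigma> * (t - T)"] by (auto simp: \<omega>_def)
  then have "B = (\<lambda>t. (U (of_real (radius (\<sigma> * (t - T))) * \<omega>0), \<zeta> (of_real (radius (\<sigma> * (t - T))) * \<omega>0))) ` I"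
    unfolding Z(1) using q(3) by (intro image_cong) auto
  then have "B = ray r \<omega>0" unfolding ray_eq_image[OF \<sigma> I] .
  moreover obtain t where "t \<in> I" using eventually_happens'[OF G(1,2)] by blast
  ultimately show "B \<in> ray r ` {\<omega>. \<omega> ^ (m - 1) = of_real \<sigma>}" using \<omega>[of t] \<omega>0[of t] by auto
next
  fix B assume "B \<in> ray r ` {\<omega>. \<omega> ^ (m - 1) = of_real \<sigma>}"
  then obtain \<omega> where \<omega>: "\<omega> ^ (m - 1) = of_real \<sigma>" "B = ray r \<omega>" by auto
  have "\<omega> \<noteq> 0" using \<omega>(1) \<sigma> w_pos by (auto simp: power_0_left)
  define l where "l t = of_real (ln (\<sigma> * (t - T)) / real (m - 1)) + Ln \<omega>" for t
  have el: "exp (l t) = of_real (radius (\<sigma> * (t - T))) * \<omega>" for t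
    unfolding l_def radius_def exp_add exp_of_real using \<open>\<omega> \<noteq> 0\<close> by simp
  have tm: "time (l t) = of_real (t - T)" if "t \<in> I" for t
  proof -
    have "time (l t) = of_real (\<sigma> * (t - T)) * of_real \<sigma>"
      unfolding time_eq_power el power_mult_distrib \<omega>(1) of_real_power[symmetric]
      using radius_power[of "\<sigma> * (t - T)"] that by (simp add: I)
    then show ?thesis using \<sigma> by auto
  qed
  have tr: "norm (time (l t)) < r" if "t \<in> I" for t
  proof -
    have "\<bar>t - T\<bar> < r" using that \<sigma> by (auto simp: I)
    then show ?thesis unfolding tm[OF that] norm_of_real .
  qed
  have lR: "norm (exp (l t)) < R" if "t \<in> I" for t
    by (rule norm_exp_less) (use tr[OF that] r(2) in linarith)
  have rs: "real_solution m h L t (\<lambda>t. sol (l t))" if t: "t \<in> I" for t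
  proof -
    let ?f = "ham_field m h (sol (l t))"
    have pos: "\<sigma> * (t - T) > 0" "t \<noteq> T" using t by (auto simp: I)
    have "((\<lambda>t. ln (\<sigma> * (t - T)) / real (m - 1)) has_field_derivative 1 / (real (m - 1) * (t - T))) (at t)"
    proof -
      have "((\<lambda>t. \<sigma> * (t - T)) has_field_derivative \<sigma>) (at t)" by (auto intro!: derivative_eq_intros)
      from DERIV_cdivide[OF DERIV_chain2[OF DERIV_ln[OF pos(1)] this], of "real (m - 1)"]
      show ?thesis
      proof (rule DERIV_cong)
        have "inverse (\<sigma> * s) * \<sigma> / n = 1 / (n * s)" if "n \<noteq> 0" "s \<noteq> 0" for n s :: real
          using \<sigma> that by (auto simp: field_simps)
        then show "inverse (\<sigma> * (t - T)) * \<sigma> / real (m - 1) = 1 / (real (m - 1) * (t - T))"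
          using pos(2) w_pos by (simp del: One_nat_def)
      qed
    qed
    from has_vector_derivative_of_real[OF this]
    have "((\<lambda>t. of_real (ln (\<sigma> * (t - T)) / real (m - 1)) + Ln \<omega>) has_vector_derivative of_real (1 / (real (m - 1) * (t - T))) + 0) (at t)"
      by (intro has_vector_derivative_add has_vector_derivative_const)
    then have dl: "(l has_vector_derivative of_real (1 / (real (m - 1) * (t - T)))) (at t)"
      unfolding l_def by simp
    have c: "of_real (1 / (real (m - 1) * (t - T))) * (of_nat (m - 1) * time (l t) * f) = f" for f :: complex
    proof -
      have "of_nat (m - 1) * of_real (t - T) \<noteq> (0 :: complex)"
        using pos(2) w_pos by (simp del: One_nat_def of_real_diff)
      moreover have "1 / x * (x * f) = f" if "x \<noteq> 0" for x :: complex using that by simp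
      moreover have "complex_of_real (1 / (real (m - 1) * (t - T))) = 1 / (of_nat (m - 1) * of_real (t - T))"
        by (simp only: of_real_divide of_real_mult of_real_1 of_real_of_nat_eq)
      ultimately show ?thesis unfolding tm[OF t] by (simp only:) blast
    qed
    have "((\<lambda>t. fst (sol (l t))) has_vector_derivative fst ?f) (at t)"
      "((\<lambda>t. snd (sol (l t))) has_vector_derivative snd ?f) (at t)"
      using field_vector_diff_chain_at[OF dl DERIV_sol(1)[OF lR[OF t]]]
        field_vector_diff_chain_at[OF dl DERIV_sol(2)[OF lR[OF t]]]
      unfolding c o_def by auto
    then have "((\<lambda>t. (fst (sol (l t)), snd (sol (l t)))) has_derivative (\<lambda>x. (x *\<^sub>R fst ?f, x *\<^sub>R snd ?f))) (at t)"
      unfolding has_vector_derivative_def by (rule has_derivative_Pair)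
    then have "((\<lambda>t. sol (l t)) has_vector_derivative ?f) (at t)"
      unfolding has_vector_derivative_def by (simp add: scaleR_prod_def)
    then show ?thesis using sol_in_leaf[OF lR[OF t]] by (simp add: real_solution_def)
  qed
  have "blows m h L G (\<lambda>t. sol (l t))"
    unfolding blows_def
  proof (intro conjI allI)
    show "\<forall>\<^sub>F t in G. real_solution m h L t (\<lambda>t. sol (l t))" using G(2) by eventually_elim (rule rs)
    fix C :: real
    have "((\<lambda>t. \<sigma> * (t - T)) \<longlongrightarrow> \<sigma> * (T - T)) G" by (intro tendsto_intros G(3))
    then have "((\<lambda>t. radius (\<sigma> * (t - T))) \<longlongrightarrow> 0) G"
      by (intro radius_tendsto_0) (use G(2) in \<open>auto simp: I elim: eventually_mono\<close>)
    then have "((\<lambda>t. of_real (radius (\<sigma> * (t - T))) * \<omega>) \<longlongrightarrow> of_real 0 * \<omega>) G"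
      by (intro tendsto_intros)
    then have "((\<lambda>t. exp (l t)) \<longlongrightarrow> 0) G" unfolding el by simp
    moreover have "isCont U 0" using U_cont R_pos by (simp add: continuous_on_eq_continuous_at)
    ultimately have "((\<lambda>t. U (exp (l t))) \<longlongrightarrow> 0) G" using isCont_tendsto_compose[of 0 U] U_0 by metis
    then have "\<forall>\<^sub>F t in G. dist (U (exp (l t))) 0 < 1 / (\<bar>C\<bar> + 1)" by (rule tendstoD) simp
    with G(2) have "\<forall>\<^sub>F t in G. norm (sol (l t)) > C"
    proof eventually_elim
      case (elim t)
      have u: "U (exp (l t)) \<noteq> 0" using U_nonzero[OF lR[OF elim(1)]] by simp
      have "C < \<bar>C\<bar> + 1" by simp
      also have "\<dots> < 1 / norm (U (exp (l t)))" using elim(2) u by (simp add: field_simps)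
      also have "\<dots> = norm (fst (sol (l t)))" by (simp add: sol_def chart_point_def norm_divide)
      also have "\<dots> \<le> norm (sol (l t))" using norm_fst_le[of "fst (sol (l t))" "snd (sol (l t))"] by simp
      finally show ?case .
    qed
    then show "\<exists>\<^sub>F t in G. norm (sol (l t)) > C" using G(1) by (rule eventually_frequently[rotated])
  qed
  moreover have "(of_real t, sol (l t)) \<in> local_leaf m h T F X r" if "t \<in> I" for t
    unfolding local_leaf_eq[OF r] using tr[OF that] tm[OF that] by (auto intro!: exI[of _ "l t"])
  moreover have "(\<lambda>t. uz (sol (l t))) ` I = B"
    unfolding \<omega>(2) ray_eq_image[OF \<sigma> I, symmetric]
    by (intro image_cong refl) (simp only: uz_sol[OF lR] el)
  ultimately show "B \<in> branches m h L T F X r G I"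
    unfolding branches_def mem_Collect_eq using rs fst_sol_nonzero[OF lR]
    by (intro exI[of _ "\<lambda>t. sol (l t)"] conjI ballI) simp_all
qed

lemma incoming_eq_rays:
  assumes r: "0 < r" "r \<le> R ^ (m - 1)"
  shows "incoming_branches m h L T F X r = ray r ` {\<omega>. \<omega> ^ (m - 1) = - 1}"
proof -
  have "branches m h L T F X r (at_left T) {T - r<..<T} = ray r ` {\<omega>. \<omega> ^ (m - 1) = of_real (- 1)}"
  proof (rule branches_eq_rays[OF r])
    show "\<forall>\<^sub>F t in at_left T. t \<in> {T - r<..<T}" using r(1) by (intro eventually_at_leftI[of "T - r"]) auto
  qed (auto intro: tendsto_ident_at trivial_limit_at_left_real)
  then show ?thesis unfolding incoming_branches_def by simp
qed

lemma outgoing_eq_rays: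
  assumes r: "0 < r" "r \<le> R ^ (m - 1)"
  shows "outgoing_branches m h L T F X r = ray r ` {\<omega>. \<omega> ^ (m - 1) = 1}"
proof -
  have "branches m h L T F X r (at_right T) {T<..<T + r} = ray r ` {\<omega>. \<omega> ^ (m - 1) = of_real 1}"
  proof (rule branches_eq_rays[OF r])
    show "\<forall>\<^sub>F t in at_right T. t \<in> {T<..<T + r}" using r(1) by (intro eventually_at_rightI[of _ "T + r"]) auto
  qed (auto intro: tendsto_ident_at trivial_limit_at_right_real)
  then show ?thesis unfolding outgoing_branches_def by simp
qed

lemma inj_on_ray:
  assumes r: "0 < r" "r \<le> R ^ (m - 1)"
  shows "inj_on (ray r) {\<omega>. norm \<omega> = 1}"
proof (rule inj_onI)
  fix \<omega> \<omega>' assume n: "\<omega> \<in> {\<omega>. norm \<omega> = 1}" "\<omega>' \<in> {\<omega>. norm \<omega> = 1}" and eq: "ray r \<omega> = ray r \<omega>'"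
  have \<rho>: "0 < radius (r / 2)" "radius (r / 2) ^ (m - 1) < r" using r(1) radius_power[of "r / 2"] by (auto simp: radius_pos)
  show "\<omega> = \<omega>'"
    using ray_mem_iff[OF r(2) _ _ \<rho>, of \<omega> \<omega>] ray_mem_iff[OF r(2) _ _ \<rho>, of \<omega>' \<omega>] n eq by auto
qed

lemma norm_of_root:
  fixes \<omega> :: complex
  assumes "\<omega> ^ (m - 1) = c" "norm c = 1" shows "norm \<omega> = 1"
proof (rule power_eq_imp_eq_base)
  show "norm \<omega> ^ (m - 1) = 1 ^ (m - 1)" 
    by (simp only: norm_power[symmetric] assms power_one)
qed (use w_pos in auto)

lemma card_branches:
  assumes r: "0 < r" "r \<le> R ^ (m - 1)"
  shows "card (incoming_branches m h L T F X r) = m - 1" "card (outgoing_branches m h L T F X r) = m - 1"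
proof -
  have "card (ray r ` {\<omega>. \<omega> ^ (m - 1) = c}) = m - 1" if "norm c = 1" for c
  proof -
    have "inj_on (ray r) {\<omega>. \<omega> ^ (m - 1) = c}"
      by (rule inj_on_subset[OF inj_on_ray[OF r]]) (use norm_of_root that in auto)
    then have "card (ray r ` {\<omega>. \<omega> ^ (m - 1) = c}) = card {\<omega>. \<omega> ^ (m - 1) = c}" by (rule card_image)
    also have "\<dots> = m - 1" using that w_pos by (intro card_nth_roots) auto
    finally show ?thesis .
  qed
  then show "card (incoming_branches m h L T F X r) = m - 1" "card (outgoing_branches m h L T F X r) = m - 1"
    unfolding incoming_eq_rays[OF r] outgoing_eq_rays[OF r] by auto
qed

text \<open>At parameter \<open>s\<close> the loop has the direction \<open>turn (s + 1 / (2 n))\<close> with \<open>n = m - 1\<close>. It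
  meets the branches exactly at \<open>s = k / (2 n)\<close>, in the directions \<open>\<omega> k\<close>. These are all
  \<open>2 n\<close>-th roots of unity, and \<open>(\<omega> k)\<^sup>n = (- 1)\<^sup>k\<^sup>+\<^sup>1\<close>, so even \<open>k\<close> are incoming and
  odd \<open>k\<close> outgoing.\<close>

lemma star_alternates:
  assumes r: "0 < r" "r \<le> R ^ (m - 1)"
  shows "alternating_along (\<lambda>s. uz (sol (star_lift r s))) (m - 1)
    (incoming_branches m h L T F X r) (outgoing_branches m h L T F X r)"
proof -
  define n where "n = m - 1"
  have n: "n > 0" using w_pos by (simp add: n_def)
  let ?c = "\<lambda>s. uz (sol (star_lift r s))"
  let ?Inc = "incoming_branches m h L T F X r" and ?Out = "outgoing_branches m h L T F X r"
  define \<omega> where "\<omega> k = turn (real (k + 1) / (2 * real n))" for k :: nat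
  have \<rho>: "0 < radius (r / 2)" "radius (r / 2) ^ n < r"
    using r(1) radius_power[of "r / 2"] by (auto simp: radius_pos n_def)
  have c_mem: "?c s \<in> ray r \<eta> \<longleftrightarrow> turn (s + 1 / (2 * real n)) = \<eta>" if "norm \<eta> = 1" for s \<eta>
  proof -
    have "norm (exp (star_lift r s)) < R"
      unfolding exp_star_lift using radius_bound[OF \<rho>[unfolded n_def] r(2)] \<rho>(1) by (simp add: norm_mult norm_turn)
    then have "?c s = (U (of_real (radius (r / 2)) * turn (s + 1 / (2 * real n))), \<zeta> (of_real (radius (r / 2)) * turn (s + 1 / (2 * real n))))"
      unfolding uz_sol exp_star_lift n_def by (simp only: uz_sol exp_star_lift)
    then show ?thesis using ray_mem_iff[OF r(2) that norm_turn \<rho>[unfolded n_def]] by simp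
  qed
  have \<omega>n: "\<omega> k ^ n = (- 1) ^ (k + 1)" for k
    using n turn_half_nat[of "k + 1"] unfolding \<omega>_def turn_power by simp
  have \<omega>1: "norm (\<omega> k) = 1" for k by (simp add: \<omega>_def norm_turn)
  have inj: "inj_on \<omega> {..<2 * n}"
  proof (rule inj_onI)
    fix j k assume jk: "j \<in> {..<2 * n}" "k \<in> {..<2 * n}" "\<omega> j = \<omega> k"
    then obtain i :: int where "real (j + 1) / (2 * real n) - real (k + 1) / (2 * real n) = of_int i"
      unfolding \<omega>_def turn_eq_iff Ints_def by auto
    then have "(real j - real k) / (2 * real n) = of_int i" by (simp add: diff_divide_distrib[symmetric])
    then have "real j - real k = of_int i * (2 * real n)" using n by (simp add: divide_eq_eq)
    then have "real_of_int (int j - int k) = of_int (i * (2 * int n))" by simp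
    then have i: "int j - int k = i * (2 * int n)" by (simp only: of_int_eq_iff)
    have "\<bar>i\<bar> * (2 * int n) < 1 * (2 * int n)"
    proof -
      have "\<bar>int j - int k\<bar> < 2 * int n" using jk by auto
      then show ?thesis unfolding i abs_mult by simp
    qed
    then have "\<bar>i\<bar> < 1" using n by (subst (asm) mult_less_cancel_right) auto
    then show "j = k" using i by simp
  qed
  have roots: "\<omega> ` {..<2 * n} = {z. z ^ n = 1 \<or> z ^ n = - 1}"
  proof -
    have "{z :: complex. z ^ n = 1 \<or> z ^ n = - 1} = {z. z ^ (2 * n) = 1}"
      by (auto simp: power_mult mult.commute[of 2] power2_eq_1_iff)
    moreover have "\<omega> ` {..<2 * n} = {z. z ^ (2 * n) = 1}"
    proof (rule card_subset_eq)
      show "finite {z :: complex. z ^ (2 * n) = 1}" using n by (intro finite_nth_roots) auto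
      have "\<omega> k ^ (2 * n) = 1" for k
        using \<omega>n[of k] unfolding mult.commute[of 2] power_mult by (simp flip: power_mult)
      then show "\<omega> ` {..<2 * n} \<subseteq> {z. z ^ (2 * n) = 1}" by auto
      show "card (\<omega> ` {..<2 * n}) = card {z :: complex. z ^ (2 * n) = 1}"
        using n card_nth_roots[of 1 "2 * n"] by (simp add: card_image[OF inj])
    qed
    ultimately show ?thesis by simp
  qed
  have IncOut: "?Inc \<union> ?Out = ray r ` (\<omega> ` {..<2 * n})"
    unfolding incoming_eq_rays[OF r, folded n_def] outgoing_eq_rays[OF r, folded n_def] roots by blast
  have bij: "bij_betw (\<lambda>k. ray r (\<omega> k)) {..<2 * n} (?Inc \<union> ?Out)"
    unfolding bij_betw_def IncOut image_image
  proof
    show "inj_on (\<lambda>k. ray r (\<omega> k)) {..<2 * n}"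
    proof (rule inj_onI)
      fix j k assume "j \<in> {..<2 * n}" "k \<in> {..<2 * n}" "ray r (\<omega> j) = ray r (\<omega> k)"
      then show "j = k" using inj_onD[OF inj_on_ray[OF r]] \<omega>1 inj_onD[OF inj] by auto
    qed
  qed simp
  have turn_s: "turn (real k / (2 * real n) + 1 / (2 * real n)) = \<omega> k" for k
    by (simp add: \<omega>_def add_divide_distrib add.commute)
  have hits: "(\<lambda>k. real k / (2 * real n)) ` {..<2 * n} = {s \<in> {0..<1}. ?c s \<in> \<Union> (?Inc \<union> ?Out)}"
  proof (intro equalityI subsetI)
    fix s assume "s \<in> (\<lambda>k. real k / (2 * real n)) ` {..<2 * n}"
    then obtain k where k: "k < 2 * n" "s = real k / (2 * real n)" by auto
    have "?c s \<in> ray r (\<omega> k)" unfolding k c_mem[OF \<omega>1] by (rule turn_s)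
    moreover have "real k < 2 * real n" using k(1) by linarith
    then have "0 \<le> s" "s < 1" unfolding k(2) using n by (simp_all add: divide_less_eq)
    ultimately show "s \<in> {s \<in> {0..<1}. ?c s \<in> \<Union> (?Inc \<union> ?Out)}"
      using k(1) unfolding IncOut by auto
  next
    fix s assume "s \<in> {s \<in> {0..<1}. ?c s \<in> \<Union> (?Inc \<union> ?Out)}"
    then obtain k where s: "0 \<le> s" "s < 1" and k: "?c s \<in> ray r (\<omega> k)" unfolding IncOut by auto
    have "turn (s + 1 / (2 * real n)) = turn (real (k + 1) / (2 * real n))"
      using k c_mem[OF \<omega>1, of s k] unfolding \<omega>_def by blast
    then obtain i :: int where "s + 1 / (2 * real n) - real (k + 1) / (2 * real n) = of_int i"
      unfolding turn_eq_iff Ints_def by auto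
    then have "s = of_int i + real k / (2 * real n)" by (simp add: add_divide_distrib)
    then have i: "2 * real n * s = of_int (i * (2 * int n) + int k)"
      using n by (simp add: distrib_left)
    define j where "j = nat (i * (2 * int n) + int k)"
    have "0 \<le> 2 * real n * s" "2 * real n * s < 2 * real n" using s n by auto
    then have "0 \<le> i * (2 * int n) + int k" "i * (2 * int n) + int k < 2 * int n"
      unfolding i by linarith+
    then have j: "real j = 2 * real n * s" "j < 2 * n" unfolding i j_def by auto
    then have "s = real j / (2 * real n)" using n by simp
    then show "s \<in> (\<lambda>k. real k / (2 * real n)) ` {..<2 * n}" using j(2) by auto
  qed
  show ?thesis
    unfolding alternating_along_def n_def[symmetric]
  proof (intro exI conjI allI impI)
    show "strict_mono_on {..<2 * n} (\<lambda>k. real k / (2 * real n))"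
      using n by (auto simp: strict_mono_on_def divide_strict_right_mono)
    show "(\<lambda>k. real k / (2 * real n)) ` {..<2 * n} = {\<sigma> \<in> {0..<1}. ?c \<sigma> \<in> \<Union> (?Inc \<union> ?Out)}" by (rule hits)
    show "bij_betw (\<lambda>k. ray r (\<omega> k)) {..<2 * n} (?Inc \<union> ?Out)" by (rule bij)
    fix k assume k: "k < 2 * n"
    show "ray r (\<omega> k) \<in> (if even k then ?Inc else ?Out)"
      using \<omega>n[of k] unfolding incoming_eq_rays[OF r, folded n_def] outgoing_eq_rays[OF r, folded n_def] by auto
    fix j assume "j < 2 * n"
    then show "?c (real k / (2 * real n)) \<in> ray r (\<omega> j) \<longleftrightarrow> j = k"
      unfolding c_mem[OF \<omega>1] turn_s using k inj_onD[OF inj, of j k] by auto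
  qed
qed

text \<open>The loop is simple because \<open>U\<close> is injective and \<open>q\<close> runs around its circle once.\<close>

lemma real_time_star:
  assumes r: "0 < r" "r \<le> R ^ (m - 1)"
  shows "blow_up_star m h L T F X r (m - 1) (incoming_branches m h L T F X r) (outgoing_branches m h L T F X r)"
proof -
  let ?c = "\<lambda>s. uz (sol (star_lift r s))"
  have lR: "norm (exp (star_lift r s)) < R" for s
    by (rule norm_exp_less) (use star_lift_props(2)[OF r(1), of s] r(2) in linarith)
  have c: "?c s = (U (exp (star_lift r s)), \<zeta> (exp (star_lift r s)))" for s by (rule uz_sol[OF lR])
  have "continuous_on {0..1} (\<lambda>s. exp (star_lift r s))"
    using star_lift_props(1)[OF r(1)] unfolding path_def by (intro continuous_intros)
  then have "path ?c"
    unfolding path_def c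
    by (intro continuous_on_Pair continuous_on_compose2[OF U_cont] continuous_on_compose2[OF \<zeta>_cont]) (use lR in auto)
  moreover have "loop_free ?c"
    unfolding loop_free_def
  proof (intro ballI impI)
    fix x y :: real assume xy: "x \<in> {0..1}" "y \<in> {0..1}" "?c x = ?c y"
    then have "exp (star_lift r x) = exp (star_lift r y)" unfolding c using U_inj[OF lR lR] by simp
    then have "turn (x + 1 / (2 * real (m - 1))) = turn (y + 1 / (2 * real (m - 1)))"
      unfolding exp_star_lift using radius_pos[of "r / 2"] by simp
    then obtain i :: int where i: "x - y = of_int i" unfolding turn_eq_iff Ints_def by auto
    then have "- 1 \<le> i" "i \<le> 1" using xy by auto
    then have "i = - 1 \<or> i = 0 \<or> i = 1" by auto
    then show "x = y \<or> x = 0 \<and> y = 1 \<or> x = 1 \<and> y = 0" using i xy by auto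
  qed
  ultimately have "simple_path ?c" by (simp add: simple_path_def)
  then show ?thesis
    unfolding blow_up_star_def using minimal_star_loop[OF r] star_alternates[OF r] by blast
qed

lemma local_leaf_near_vertex:
  assumes r: "0 < r" "r \<le> R ^ (m - 1)" and \<rho>: "0 < \<rho>" "r \<le> \<rho> ^ (m - 1)"
    and near: "\<And>l. norm (exp l) < \<rho> \<Longrightarrow> dist (uz (sol l)) (0, e) < \<epsilon>"
    and mem: "(t, p) \<in> local_leaf m h T F X r"
  shows "p \<in> L \<and> fst p \<noteq> 0 \<and> dist (uz p) (0, e) < \<epsilon>"
proof -
  obtain l where l: "p = sol l" "norm (time l) < r" using mem unfolding local_leaf_eq[OF r] by auto
  have lR: "norm (exp l) < R" by (rule norm_exp_less) (use l(2) r(2) in linarith)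
  have "norm (exp l) ^ (m - 1) < \<rho> ^ (m - 1)" using l(2) \<rho>(2) unfolding norm_time by linarith
  then have "norm (exp l) < \<rho>" by (rule power_less_imp_less_base) (use \<rho>(1) in simp)
  then show ?thesis using near sol_in_leaf[OF lR] fst_sol_nonzero[OF lR] l(1) by simp
qed

end

theorem theorem10p4:
  fixes m :: nat and h :: "nat \<Rightarrow> complex" and L :: "(complex \<times> complex) set"
    and X :: "real \<Rightarrow> complex \<times> complex" and T :: real and F :: "real filter"
  assumes "m \<ge> 2"
    and "nondegenerate m h"
    and "is_leaf m h L" and "L \<subseteq> energy_level m h 1"
    and "F = at_left T \<or> F = at_right T"
    and "blows m h L F X"
  shows "\<exists>e. ham1 m h e = 0 \<and> deriv (ham1 m h) e \<noteq> 0 \<and>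
    (0, e) \<in> closure (uz ` {p \<in> L. fst p \<noteq> 0}) \<and>
    (\<forall>\<^sub>F t in F. fst (X t) \<noteq> 0) \<and>
    ((\<lambda>t. uz (X t)) \<longlongrightarrow> (0, e)) F \<and>
    (\<forall>\<epsilon>>0. \<exists>r0>0. \<forall>r. 0 < r \<and> r \<le> r0 \<longrightarrow>
      (\<forall>(t, p) \<in> local_leaf m h T F X r. p \<in> L \<and> fst p \<noteq> 0 \<and> dist (uz p) (0, e) < \<epsilon>) \<and>
      (\<forall>gt. time_cycle T r (m - 1) gt \<longrightarrow>
         (\<exists>guz. minimal_blow_up_loop m h T F X r (m - 1) gt guz)) \<and>
      (\<forall>w gt guz. minimal_blow_up_loop m h T F X r w gt guz \<longrightarrow>
         w = m - 1 \<and>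
         winding_number (\<lambda>s. fst (guz s)) 0 = 1 \<and>
         winding_number (\<lambda>s. snd (guz s)) e = of_nat (m + 1)) \<and>
      (\<exists>Inc Out. blow_up_star m h L T F X r (m - 1) Inc Out \<and>
         card Inc = m - 1 \<and> card Out = m - 1))"
proof -
  have h0: "h 0 \<noteq> 0" using assms(2) by (simp add: nondegenerate_def)
  have m1: "1 \<le> m" using assms(1) by simp
  obtain e where e: "ham1 m h e = 0" "\<forall>\<^sub>F t in F. fst (X t) \<noteq> 0" "((\<lambda>t. uz (X t)) \<longlongrightarrow> (0, e)) F"
    using blows_limit[where m = m and h = h and L = L and F = F and T = T and X = X, OF assms(5,6) m1 h0 assms(4)] by metis
  have e': "deriv (ham1 m h) e \<noteq> 0" using assms(2) e(1) by (simp add: nondegenerate_def)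
  obtain R U \<zeta> Q \<alpha> \<beta> \<delta> where chart: "blow_up_chart m h e R U \<zeta> Q \<alpha> \<beta> \<delta>"
    using blow_up_chart_exists[OF assms(1) e(1) e'] by metis
  have sol: "\<forall>\<^sub>F t in F. real_solution m h L t X" using assms(6) by (simp add: blows_def)
  interpret blow_up_solution m h e R U \<zeta> Q \<alpha> \<beta> \<delta> L X T F
    by (rule blow_up_solution.intro[OF chart], rule blow_up_solution_axioms.intro)
       (use assms e sol in auto)
  have "(0, e) \<in> closure (uz ` {p \<in> L. fst p \<noteq> 0})"
  proof (rule Lim_in_closed_set[OF closed_closure _ F_nontrivial e(3)])
    show "\<forall>\<^sub>F t in F. uz (X t) \<in> closure (uz ` {p \<in> L. fst p \<noteq> 0})"
      using sol e(2)
    proof eventually_elim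
      case (elim t)
      then show ?case by (intro subsetD[OF closure_subset] imageI) (simp add: real_solution_def)
    qed
  qed
  moreover have "\<exists>r0>0. \<forall>r. 0 < r \<and> r \<le> r0 \<longrightarrow>
      (\<forall>(t, p) \<in> local_leaf m h T F X r. p \<in> L \<and> fst p \<noteq> 0 \<and> dist (uz p) (0, e) < \<epsilon>) \<and>
      (\<forall>gt. time_cycle T r (m - 1) gt \<longrightarrow>
         (\<exists>guz. minimal_blow_up_loop m h T F X r (m - 1) gt guz)) \<and>
      (\<forall>w gt guz. minimal_blow_up_loop m h T F X r w gt guz \<longrightarrow>
         w = m - 1 \<and>
         winding_number (\<lambda>s. fst (guz s)) 0 = 1 \<and>
         winding_number (\<lambda>s. snd (guz s)) e = of_nat (m + 1)) \<and>
      (\<exists>Inc Out. blow_up_star m h L T F X r (m - 1) Inc Out \<and>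
         card Inc = m - 1 \<and> card Out = m - 1)" if "\<epsilon> > 0" for \<epsilon>
  proof -
    obtain \<rho> where \<rho>: "\<rho> > 0" "\<rho> \<le> R" "\<And>l. norm (exp l) < \<rho> \<Longrightarrow> dist (uz (sol l)) (0, e) < \<epsilon>"
      using sol_near_vertex[OF \<open>\<epsilon> > 0\<close>] by metis
    show ?thesis
    proof (rule exI[of _ "\<rho> ^ (m - 1)"], intro conjI allI impI)
      show "\<rho> ^ (m - 1) > 0" using \<rho>(1) by simp
      fix r assume r0: "0 < r \<and> r \<le> \<rho> ^ (m - 1)"
      have "\<rho> ^ (m - 1) \<le> R ^ (m - 1)" using \<rho> by (intro power_mono) auto
      then have r: "0 < r" "r \<le> R ^ (m - 1)" using r0 by auto
      show "\<forall>(t, p) \<in> local_leaf m h T F X r. p \<in> L \<and> fst p \<noteq> 0 \<and> dist (uz p) (0, e) < \<epsilon>"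
        using local_leaf_near_vertex[OF r \<rho>(1) _ \<rho>(3)] r0 by blast
      show "\<exists>guz. minimal_blow_up_loop m h T F X r (m - 1) gt guz" if "time_cycle T r (m - 1) gt" for gt
        by (rule minimal_loop_exists[OF r that])
      show "w = m - 1" "winding_number (\<lambda>s. fst (guz s)) 0 = 1" "winding_number (\<lambda>s. snd (guz s)) e = of_nat (m + 1)"
        if "minimal_blow_up_loop m h T F X r w gt guz" for w gt guz
        using minimal_loop_winding[OF r that] by auto
      show "\<exists>Inc Out. blow_up_star m h L T F X r (m - 1) Inc Out \<and> card Inc = m - 1 \<and> card Out = m - 1"
        using real_time_star[OF r] card_branches[OF r] by blast
    qed
  qed
  ultimately show ?thesis using e e' by blast
qed

end
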